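(* Let $\mathcal{K}$ be $SO(n)$, $U(n)$, $SU(n)$, $Sp(n)$ or $Sp(n)\cdot Sp(1)$, acting by its fundamental vector representation on $\mathbb{R}^{p}$ with $p=n,2n,2n,4n,4n$ respectively, and let $\mathcal{H}=\mathcal{K}\ltimes\mathbb{R}^p$ be the (non-compact) holonomy group of a metric connection $\nabla^{\mathcal H}$ on a Lorentzian manifold $\mathcal{M}^{p+2}$, with fundamental forms null along a $\nabla^{\mathcal H}$-parallel null 1-form $\kappa$. Then the Lie (super)algebras $\mathring{\mathfrak{f}}^{\mathcal H}_{\bar\curlywedge}$ of the fundamental forms are: - $\mathcal{K}=SO(n)$: $\mathbb{R}$; - $\mathcal{K}=U(n)$: $\mathbb{R}$; - $\mathcal{K}=SU(2k)$ (that is, $SU(n)$ with $n=2k$ even): $\hat{\mathfrak{e}}(2)$, the central extension of the Euclidean algebra in two dimensions; - $\mathcal{K}=SU(2k+1)$ (that is, $SU(n)$ with $n=2k+1$ odd): $\mathfrak{s}(2)$, the $N=2$ supersymmetry algebra in one dimension; - $\mathcal{K}=Sp(n)$: $\mathfrak{sp}(1)$; - $\mathcal{K}=Sp(n)\cdot Sp(1)$: $\mathbb{R}$.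
   Context: Setting: $\mathcal{M}^{p+2}$ is a smooth, oriented, spin, simply connected, time-oriented Lorentzian manifold with a metric connection $\nabla^{\mathcal H}$ of holonomy $\mathcal{K}\ltimes\mathbb{R}^p$, admitting a $\nabla^{\mathcal H}$-parallel nowhere vanishing null 1-form $\kappa$. Adapted local coframes: $(\mathbf{e}^-=\kappa,\mathbf{e}^+,\mathbf{e}^i;\ i=1,\dots,p)$, $g=2\mathbf{e}^-\mathbf{e}^++\delta_{ij}\mathbf{e}^i\mathbf{e}^j$. Null forms: $\phi$ is null along $\kappa$ iff $\kappa\wedge\phi=0$ and $i_{\vec\kappa}\phi=0$, where $\vec\kappa$ is the vector field metrically dual to $\kappa$; locally $\phi=\mathbf{e}^-\wedge\breve\phi$ with $\breve\phi=\frac1{\ell!}\phi_{i_1\dots i_\ell}\mathbf{e}^{i_1}\wedge\dots\wedge\mathbf{e}^{i_\ell}$, and $\phi$ is said to be represented by $\breve\phi$. For null forms define $\lambda\,\bar\curlywedge\,\phi:=\mathbf{e}^-\wedge i_{\vec{\breve\lambda}}\breve\phi$ and $\lambda\curlywedge\phi:=\lambda\wedge\breve\phi$ (both globally defined). Here for a $q$-form $\breve\lambda$ and $r$-form $\breve\phi$, $i_{\vec{\breve\lambda}}\breve\phi=\frac1{(q-1)!(r-1)!}\breve\lambda^{k}{}_{i_1\dots i_{q-1}}\breve\phi_{k j_1\dots j_{r-1}}\mathbf{e}^{i_1}\wedge\dots\wedge\mathbf{e}^{i_{q-1}}\wedge\mathbf{e}^{j_1}\wedge\dots\wedge\mathbf{e}^{j_{r-1}}$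 (zero if $q=0$ or $r=0$). The (super) Lie bracket is the one induced by $\bar\curlywedge$: a null form $\lambda$ has parity equal to the degree of $\breve\lambda$ mod 2, and, as for inner derivations where $[i_{\vec\lambda},i_{\vec\chi}]=(-1)^{q}i_{\overrightarrow{\lambda\bar\wedge\chi}}$ with $\lambda\bar\wedge\chi:=i_{\vec\lambda}\chi$ for a $q$-form $\lambda$, the bracket is $\lambda\,\bar\curlywedge\,\chi$ up to the sign $(-1)^{\deg\breve\lambda}$. Besides $\kappa$, the fundamental forms $\mathfrak{f}^{\mathcal H}$ (all $\nabla^{\mathcal H}$-parallel and null along $\kappa$) are: $SO(n)$: the $(n+1)$-form $\epsilon$ represented by the transverse volume $n$-form; $U(n)$: the 3-form $\omega$ represented by the Hermitian 2-form; $SU(n)$: $\omega$ together with the $(n+1)$-forms $\chi_1,\chi_2$ represented by the real and imaginary components of the fundamental $(n,0)$-form; $Sp(n)$: the three 3-forms represented by the Hermitian forms of the hyper-complex structure; $Sp(n)\cdot Sp(1)$: the 5-form represented by the fundamental 4-form of $Sp(n)\cdot Sp(1)$. $\mathfrak{f}^{\mathcal H}_{\bar\curlywedge}$ is the closure of the span of $\mathfrak{f}^{\mathcal H}$ under $\bar\curlywedge$ (possibly including further parallel null forms such as $\curlywedge$-products needed for closure; for $SU(n)$ the extra generator is $\curlywedge^{n-1}\omega$); $\kappa$ commutes with everything, and $\mathring{\mathfrak{f}}^{\mathcal H}_{\bar\curlywedge}$ denotes the algebra with the generator $\kappa$ removed, so that $\mathfrak{f}^{\mathcal H}_{\bar\curlywedge}=\mathring{\mathfrak{f}}^{\mathcal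 H}_{\bar\curlywedge}\oplus\mathbb{R}\langle\kappa\rangle$. $\hat{\mathfrak{e}}(2)$: basis $J,P_1,P_2,Z$ with $Z$ central, $[J,P_1]=-P_2$, $[J,P_2]=P_1$, $[P_1,P_2]=Z$. $\mathfrak{s}(2)$: even generators $R,E$ and odd generators $Q_1,Q_2$ with $E$ (hamiltonian) central, $[Q_i,Q_j]=\delta_{ij}E$ and $R$ the R-symmetry generator rotating the supercharges, $[R,Q_1]=-Q_2$, $[R,Q_2]=Q_1$.
   Formalization: SU(n) is taken with n ≥ 3, SO(n) with n ≥ 2, the others with n ≥ 1: for SU(2) the forms generate the 3-dimensional sp(1), not ê(2), and for SU(1) and SO(1) products of the generators give κ, so the algebra with κ removed is not defined. *)

theory Defs
  imports "HOL-Analysis.Analysis" "Jordan_Normal_Form.Determinant"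
begin

section \<open>Smooth manifolds and tensor fields\<close>

text \<open>
  The manifold is the type \<open>'m\<close>, modelled on the Euclidean space \<open>'e\<close>; a chart is a pair of
  its domain and its coordinate map.  The tangent space at \<open>x\<close> is a copy of \<open>'e\<close>, identified
  with the space of coordinate vectors in one chosen chart around \<open>x\<close> (\<open>chart_at\<close>).
  The choice of that chart plays no role: smoothness and derivatives of tensor fields
  are always read off from the components in the charts of the atlas.
\<close>

fun Ck_on :: "nat \<Rightarrow> ('a::real_normed_vector \<Rightarrow> 'b::real_normed_vector) \<Rightarrow> 'a set \<Rightarrow> bool" where
  "Ck_on 0 f S \<longleftrightarrow> continuous_on S f"
| "Ck_on (Suc k) f S \<longleftrightarrow> (\<forall>y\<in>S. f differentiable (at y)) \<and>
     (\<forall>v. Ck_on k (\<lambda>y. frechet_derivative f (at y) v) S)"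

text \<open>Only used for open sets \<open>S\<close>.\<close>
definition smooth_on :: "('a::real_normed_vector \<Rightarrow> 'b::real_normed_vector) \<Rightarrow> 'a set \<Rightarrow> bool" where
  "smooth_on f S \<longleftrightarrow> (\<forall>k. Ck_on k f S)"

type_synonym ('m, 'e) chart = "'m set \<times> ('m \<Rightarrow> 'e)"

definition chart_inv :: "('m, 'e) chart \<Rightarrow> 'e \<Rightarrow> 'm" where
  "chart_inv c = inv_into (fst c) (snd c)"

definition chart_image :: "('m, 'e) chart \<Rightarrow> 'e set" where
  "chart_image c = snd c ` fst c"

definition smooth_atlas ::
  "('m::topological_space, 'e::euclidean_space) chart set \<Rightarrow> bool" where
  "smooth_atlas A \<longleftrightarrow>
     (\<forall>c\<in>A. open (fst c) \<and> open (chart_image c) \<and>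
        homeomorphism (fst c) (chart_image c) (snd c) (chart_inv c)) \<and>
     (\<Union>c\<in>A. fst c) = UNIV \<and>
     (\<forall>c\<in>A. \<forall>d\<in>A. smooth_on (snd d \<circ> chart_inv c) (snd c ` (fst c \<inter> fst d)))"

definition chart_at :: "('m, 'e) chart set \<Rightarrow> 'm \<Rightarrow> ('m, 'e) chart" where
  "chart_at A x = (SOME c. c \<in> A \<and> x \<in> fst c)"

definition transition_deriv ::
  "('m, 'e::euclidean_space) chart \<Rightarrow> ('m, 'e) chart \<Rightarrow> 'm \<Rightarrow> 'e \<Rightarrow> 'e" where
  "transition_deriv c d x = frechet_derivative (snd d \<circ> chart_inv c) (at (snd c x))"

text \<open>Components in the chart \<open>c\<close> of a tangent vector at \<open>x\<close>, and conversely.\<close>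
definition to_coord ::
  "('m, 'e::euclidean_space) chart set \<Rightarrow> ('m, 'e) chart \<Rightarrow> 'm \<Rightarrow> 'e \<Rightarrow> 'e" where
  "to_coord A c x = transition_deriv (chart_at A x) c x"

definition of_coord ::
  "('m, 'e::euclidean_space) chart set \<Rightarrow> ('m, 'e) chart \<Rightarrow> 'm \<Rightarrow> 'e \<Rightarrow> 'e" where
  "of_coord A c x = transition_deriv c (chart_at A x) x"

text \<open>
  A covariant tensor is a function of the list of its arguments; a covariant tensor of rank \<open>k\<close>
  is supported on lists of length \<open>k\<close>, and a general function encodes a sum of tensors of
  different ranks.
\<close>
type_synonym ('e, 'f) tensor = "'e list \<Rightarrow> 'f"
type_synonym ('m, 'e) tensor_field = "'m \<Rightarrow> ('e, real) tensor"

definition covector :: "('e \<Rightarrow> 'f::zero) \<Rightarrow> ('e, 'f) tensor" where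
  "covector \<alpha> vs = (if length vs = 1 then \<alpha> (vs ! 0) else 0)"

definition bilin :: "('e \<Rightarrow> 'e \<Rightarrow> 'f::zero) \<Rightarrow> ('e, 'f) tensor" where
  "bilin b vs = (if length vs = 2 then b (vs ! 0) (vs ! 1) else 0)"

definition components ::
  "('m, 'e::euclidean_space) chart set \<Rightarrow> ('m, 'e) chart \<Rightarrow> ('m, 'e) tensor_field
     \<Rightarrow> 'e \<Rightarrow> ('e, real) tensor" where
  "components A c T y ws = T (chart_inv c y) (map (of_coord A c (chart_inv c y)) ws)"

definition smooth_tensor_on ::
  "('m, 'e::euclidean_space) chart set \<Rightarrow> 'm set \<Rightarrow> ('m, 'e) tensor_field \<Rightarrow> bool" where
  "smooth_tensor_on A U T \<longleftrightarrow>
     (\<forall>c\<in>A. \<forall>ws. smooth_on (\<lambda>y. components A c T y ws) (snd c ` (fst c \<inter> U)))"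

definition smooth_vector_field ::
  "('m, 'e::euclidean_space) chart set \<Rightarrow> ('m \<Rightarrow> 'e) \<Rightarrow> bool" where
  "smooth_vector_field A X \<longleftrightarrow>
     (\<forall>c\<in>A. smooth_on (\<lambda>y. to_coord A c (chart_inv c y) (X (chart_inv c y))) (chart_image c))"

section \<open>Exterior algebra\<close>

definition alternating_form :: "('e::real_vector, real) tensor \<Rightarrow> bool" where
  "alternating_form \<phi> \<longleftrightarrow>
     (\<forall>vs i. i < length vs \<longrightarrow> linear (\<lambda>v. \<phi> (vs[i := v]))) \<and>
     (\<forall>vs. \<not> distinct vs \<longrightarrow> \<phi> vs = 0)"

text \<open>
  The sum runs over all shuffles, given by the set \<open>I\<close> of the positions that go into the first
  factor; there is no combinatorial prefactor, so that \<open>(e\<^sup>1 \<and> e\<^sup>2) (v, w) = e\<^sup>1 v e\<^sup>2 w - e\<^sup>1 w e\<^sup>2 v\<close>.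
\<close>
definition wedge :: "('e, 'f::comm_ring_1) tensor \<Rightarrow> ('e, 'f) tensor \<Rightarrow> ('e, 'f) tensor"
    (infixr "\<and>\<^sub>w" 70) where
  "(\<alpha> \<and>\<^sub>w \<beta>) vs =
     (\<Sum>I\<in>Pow {..<length vs}.
        (- 1) ^ card {(i, j). i \<in> I \<and> j \<in> {..<length vs} - I \<and> j < i}
        * \<alpha> (nths vs I) * \<beta> (nths vs ({..<length vs} - I)))"

definition one_form_unit :: "('e, 'f::comm_ring_1) tensor" where
  "one_form_unit vs = (if vs = [] then 1 else 0)"

definition wedge_list :: "('e, 'f::comm_ring_1) tensor list \<Rightarrow> ('e, 'f) tensor" where
  "wedge_list \<alpha>s = foldr wedge \<alpha>s one_form_unit"

definition contract_vec :: "'e \<Rightarrow> ('e, 'f) tensor \<Rightarrow> ('e, 'f) tensor" where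
  "contract_vec v \<phi> vs = \<phi> (v # vs)"

section \<open>Lorentzian spin manifolds\<close>

definition lorentz_frame :: "('e::euclidean_space \<Rightarrow> 'e \<Rightarrow> real) \<Rightarrow> (nat \<Rightarrow> 'e) \<Rightarrow> bool" where
  "lorentz_frame b f \<longleftrightarrow>
     (\<forall>i<DIM('e). \<forall>j<DIM('e). b (f i) (f j) = (if i \<noteq> j then 0 else if i = 0 then - 1 else 1))"

definition lorentzian_metric ::
  "('m, 'e::euclidean_space) chart set \<Rightarrow> ('m \<Rightarrow> 'e \<Rightarrow> 'e \<Rightarrow> real) \<Rightarrow> bool" where
  "lorentzian_metric A g \<longleftrightarrow>
     (\<forall>x. bilinear (g x) \<and> (\<forall>v w. g x v w = g x w v) \<and> (\<exists>f. lorentz_frame (g x) f)) \<and>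
     smooth_tensor_on A UNIV (\<lambda>x. bilin (g x))"

text \<open>An orientation, given by a nowhere vanishing form of top degree.\<close>
definition orientation_form ::
  "('m, 'e::euclidean_space) chart set \<Rightarrow> ('m, 'e) tensor_field \<Rightarrow> bool" where
  "orientation_form A \<mu> \<longleftrightarrow>
     smooth_tensor_on A UNIV \<mu> \<and>
     (\<forall>x. alternating_form (\<mu> x) \<and> (\<forall>vs. length vs \<noteq> DIM('e) \<longrightarrow> \<mu> x vs = 0) \<and>
          (\<exists>vs. \<mu> x vs \<noteq> 0))"

definition time_orientation ::
  "('m, 'e::euclidean_space) chart set \<Rightarrow> ('m \<Rightarrow> 'e \<Rightarrow> 'e \<Rightarrow> real) \<Rightarrow> ('m \<Rightarrow> 'e) \<Rightarrow> bool" where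
  "time_orientation A g X \<longleftrightarrow> smooth_vector_field A X \<and> (\<forall>x. g x (X x) (X x) < 0)"

text \<open>Oriented and time-oriented orthonormal frames; the entries from \<open>DIM('e)\<close> on are padding.\<close>
definition frame_bundle ::
  "('m \<Rightarrow> 'e \<Rightarrow> 'e \<Rightarrow> real) \<Rightarrow> ('m, 'e::euclidean_space) tensor_field \<Rightarrow> ('m \<Rightarrow> 'e)
     \<Rightarrow> ('m \<times> (nat \<Rightarrow> 'e)) set" where
  "frame_bundle g \<mu> X =
     {(x, f). lorentz_frame (g x) f \<and> (\<forall>i\<ge>DIM('e). f i = 0) \<and>
              \<mu> x (map f [0..<DIM('e)]) > 0 \<and> g x (f 0) (X x) < 0}"

definition frame_coord ::
  "('m, 'e::euclidean_space) chart set \<Rightarrow> ('m, 'e) chart \<Rightarrow> 'm \<times> (nat \<Rightarrow> 'e) \<Rightarrow> 'e \<times> (nat \<Rightarrow> 'e)"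
  where
  "frame_coord A c = (\<lambda>(x, f). (snd c x, \<lambda>i. to_coord A c x (f i)))"

definition frame_topology ::
  "('m, 'e::euclidean_space) chart set \<Rightarrow> ('m \<Rightarrow> 'e \<Rightarrow> 'e \<Rightarrow> real) \<Rightarrow> ('m, 'e) tensor_field
     \<Rightarrow> ('m \<Rightarrow> 'e) \<Rightarrow> ('m \<times> (nat \<Rightarrow> 'e)) topology" where
  "frame_topology A g \<mu> X =
     topology_generated_by
       {{u \<in> frame_bundle g \<mu> X. fst u \<in> fst c \<and> frame_coord A c u \<in> W} | c W. c \<in> A \<and> open W}"

definition double_covering :: "'q topology \<Rightarrow> ('q \<Rightarrow> 'b) \<Rightarrow> 'b topology \<Rightarrow> bool" where
  "double_covering Q q B \<longleftrightarrow>
     continuous_map Q B q \<and>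
     (\<forall>y\<in>topspace B. \<exists>V S1 S2. openin B V \<and> y \<in> V \<and> openin Q S1 \<and> openin Q S2 \<and>
        S1 \<inter> S2 = {} \<and> {z \<in> topspace Q. q z \<in> V} = S1 \<union> S2 \<and>
        homeomorphic_map (subtopology Q S1) (subtopology B V) q \<and>
        homeomorphic_map (subtopology Q S2) (subtopology B V) q)"

text \<open>
  A spin structure, as a double covering of the bundle of oriented and time-oriented orthonormal
  frames that restricts to the nontrivial double covering of each fibre.
\<close>
definition spin_structure ::
  "('m, 'e::euclidean_space) chart set \<Rightarrow> ('m \<Rightarrow> 'e \<Rightarrow> 'e \<Rightarrow> real) \<Rightarrow> ('m, 'e) tensor_field
     \<Rightarrow> ('m \<Rightarrow> 'e) \<Rightarrow> 'q topology \<Rightarrow> ('q \<Rightarrow> 'm \<times> (nat \<Rightarrow> 'e)) \<Rightarrow> bool" where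
  "spin_structure A g \<mu> X Q q \<longleftrightarrow>
     double_covering Q q (frame_topology A g \<mu> X) \<and>
     (\<forall>x. connectedin Q {z \<in> topspace Q. fst (q z) = x})"

section \<open>Connections and holonomy\<close>

text \<open>
  \<open>\<Gamma> c y u v\<close> is the value at the point with coordinates \<open>y\<close> of the connection coefficients in the
  chart \<open>c\<close>, so that \<open>\<nabla>\<^sub>u V = D V (u) + \<Gamma> c y u V\<close>.  No symmetry in \<open>u\<close>, \<open>v\<close> is required (torsion).
\<close>
type_synonym ('m, 'e) conn = "('m, 'e) chart \<Rightarrow> 'e \<Rightarrow> 'e \<Rightarrow> 'e \<Rightarrow> 'e"

definition connection ::
  "('m, 'e::euclidean_space) chart set \<Rightarrow> ('m, 'e) conn \<Rightarrow> bool" where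
  "connection A \<Gamma> \<longleftrightarrow>
     (\<forall>c\<in>A. (\<forall>y\<in>chart_image c. bilinear (\<Gamma> c y)) \<and>
        (\<forall>u v. smooth_on (\<lambda>y. \<Gamma> c y u v) (chart_image c))) \<and>
     (\<forall>c\<in>A. \<forall>d\<in>A. \<forall>y\<in>snd c ` (fst c \<inter> fst d). \<forall>u v.
        let \<tau> = snd d \<circ> chart_inv c; D = (\<lambda>z. frechet_derivative \<tau> (at z)) in
        D y (\<Gamma> c y u v) =
          frechet_derivative (\<lambda>z. D z v) (at y) u + \<Gamma> d (\<tau> y) (D y u) (D y v))"

definition parallel_tensor ::
  "('m, 'e::euclidean_space) chart set \<Rightarrow> ('m, 'e) conn \<Rightarrow> ('m, 'e) tensor_field \<Rightarrow> bool" where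
  "parallel_tensor A \<Gamma> T \<longleftrightarrow>
     (\<forall>c\<in>A. \<forall>y\<in>chart_image c. \<forall>u ws.
        frechet_derivative (\<lambda>z. components A c T z ws) (at y) u =
        (\<Sum>i<length ws. components A c T y (ws[i := \<Gamma> c y u (ws ! i)])))"

definition metric_connection ::
  "('m, 'e::euclidean_space) chart set \<Rightarrow> ('m \<Rightarrow> 'e \<Rightarrow> 'e \<Rightarrow> real) \<Rightarrow> ('m, 'e) conn \<Rightarrow> bool" where
  "metric_connection A g \<Gamma> \<longleftrightarrow> connection A \<Gamma> \<and> parallel_tensor A \<Gamma> (\<lambda>x. bilin (g x))"

text \<open>
  \<open>parallel_transport A \<Gamma> x h y\<close>: \<open>h\<close> is the parallel transport from \<open>x\<close> to \<open>y\<close> along some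
  piecewise \<open>C\<^sup>1\<close> curve, that is, along a finite concatenation of \<open>C\<^sup>1\<close> segments \<open>z\<close> each of
  which lies in a chart.
\<close>
inductive parallel_transport ::
  "('m, 'e::euclidean_space) chart set \<Rightarrow> ('m, 'e) conn \<Rightarrow> 'm \<Rightarrow> ('e \<Rightarrow> 'e) \<Rightarrow> 'm \<Rightarrow> bool"
  for A \<Gamma> where
  refl: "parallel_transport A \<Gamma> x id x"
| segment: "\<lbrakk> c \<in> A; z ` {0..1} \<subseteq> chart_image c;
     \<And>t. t \<in> {0..1} \<Longrightarrow> (z has_vector_derivative z' t) (at t within {0..1::real});
     continuous_on {0..1} z';
     \<And>v. W 0 v = v;
     \<And>t v. t \<in> {0..1} \<Longrightarrow>
       ((\<lambda>s. W s v) has_vector_derivative - \<Gamma> c (z t) (z' t) (W t v)) (at t within {0..1});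
     x = chart_inv c (z 0); y = chart_inv c (z 1) \<rbrakk>
   \<Longrightarrow> parallel_transport A \<Gamma> x (of_coord A c y \<circ> W 1 \<circ> to_coord A c x) y"
| trans: "\<lbrakk> parallel_transport A \<Gamma> x h y; parallel_transport A \<Gamma> y k z \<rbrakk>
   \<Longrightarrow> parallel_transport A \<Gamma> x (k \<circ> h) z"

definition holonomy_group ::
  "('m, 'e::euclidean_space) chart set \<Rightarrow> ('m, 'e) conn \<Rightarrow> 'm \<Rightarrow> ('e \<Rightarrow> 'e) set" where
  "holonomy_group A \<Gamma> x = {h. parallel_transport A \<Gamma> x h x}"

section \<open>The groups K\<close>

datatype structure_group = SO nat | U nat | SU nat | Sp nat | SpSp1 nat

fun transverse_dim :: "structure_group \<Rightarrow> nat" where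
  "transverse_dim (SO n) = n"
| "transverse_dim (U n) = 2 * n"
| "transverse_dim (SU n) = 2 * n"
| "transverse_dim (Sp n) = 4 * n"
| "transverse_dim (SpSp1 n) = 4 * n"

definition orthogonal_mats :: "nat \<Rightarrow> real mat set" where
  "orthogonal_mats p = {a \<in> carrier_mat p p. transpose_mat a * a = 1\<^sub>m p}"

definition unitary_mats :: "nat \<Rightarrow> complex mat set" where
  "unitary_mats n = {B \<in> carrier_mat n n. transpose_mat (map_mat cnj B) * B = 1\<^sub>m n}"

text \<open>Complex coordinates on \<open>\<real>\<^sup>2\<^sup>n\<close> are \<open>z\<^sub>a = x\<^bsub>2a\<^esub> + \<i> x\<^bsub>2a+1\<^esub>\<close>, for \<open>a < n\<close>.\<close>
definition realify :: "nat \<Rightarrow> complex mat \<Rightarrow> real mat" where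
  "realify n B = mat (2 * n) (2 * n) (\<lambda>(i, j).
     let b = B $$ (i div 2, j div 2) in
     if even i then (if even j then Re b else - Im b) else (if even j then Im b else Re b))"

definition complex_structure :: "nat \<Rightarrow> real mat" where
  "complex_structure n = realify n (\<i> \<cdot>\<^sub>m 1\<^sub>m n)"

text \<open>
  Quaternionic coordinates on \<open>\<real>\<^sup>4\<^sup>n\<close> are \<open>x\<^bsub>4a\<^esub> + x\<^bsub>4a+1\<^esub> i + x\<^bsub>4a+2\<^esub> j + x\<^bsub>4a+3\<^esub> k\<close>, for \<open>a < n\<close>; the
  hyper-complex structure \<open>(hyper n 0, hyper n 1, hyper n 2)\<close> is the left multiplication by
  \<open>i\<close>, \<open>j\<close>, \<open>k\<close>.
\<close>
definition quaternion_unit :: "nat \<Rightarrow> real list list" where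
  "quaternion_unit r =
     [ [[0, -1, 0, 0], [1, 0, 0, 0], [0, 0, 0, -1], [0, 0, 1, 0]],
       [[0, 0, -1, 0], [0, 0, 0, 1], [1, 0, 0, 0], [0, -1, 0, 0]],
       [[0, 0, 0, -1], [0, 0, -1, 0], [0, 1, 0, 0], [1, 0, 0, 0]] ] ! r"

definition hyper :: "nat \<Rightarrow> nat \<Rightarrow> real mat" where
  "hyper n r = mat (4 * n) (4 * n) (\<lambda>(i, j).
     if i div 4 = j div 4 then quaternion_unit r ! (i mod 4) ! (j mod 4) else 0)"

text \<open>The isometries of \<open>\<real>\<^sup>4\<^sup>n\<close> that are linear over the quaternions.\<close>
definition Sp_mats :: "nat \<Rightarrow> real mat set" where
  "Sp_mats n = {a \<in> orthogonal_mats (4 * n). \<forall>r<3. a * hyper n r = hyper n r * a}"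

fun group_mats :: "structure_group \<Rightarrow> real mat set" where
  "group_mats (SO n) = {a \<in> orthogonal_mats n. Determinant.det a = 1}"
| "group_mats (U n) = realify n ` unitary_mats n"
| "group_mats (SU n) = realify n ` {B \<in> unitary_mats n. Determinant.det B = 1}"
| "group_mats (Sp n) = Sp_mats n"
| "group_mats (SpSp1 n) =
     {a * (c0 \<cdot>\<^sub>m 1\<^sub>m (4 * n) + c1 \<cdot>\<^sub>m hyper n 0 + c2 \<cdot>\<^sub>m hyper n 1 + c3 \<cdot>\<^sub>m hyper n 2) | a c0 c1 c2 c3.
        a \<in> Sp_mats n \<and> c0\<^sup>2 + c1\<^sup>2 + c2\<^sup>2 + c3\<^sup>2 = 1}"

section \<open>Adapted coframes and null forms\<close>

text \<open>\<open>(k, ep, e)\<close> is the coframe \<open>(e\<^sup>-, e\<^sup>+, e\<^sup>i)\<close> at a point; \<open>e\<^sup>i\<close> is indexed by \<open>i < p\<close>.\<close>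
definition adapted_coframe ::
  "('e::euclidean_space \<Rightarrow> 'e \<Rightarrow> real) \<Rightarrow> ('e \<Rightarrow> real) \<Rightarrow> ('e \<Rightarrow> real) \<Rightarrow> (nat \<Rightarrow> 'e \<Rightarrow> real) \<Rightarrow> bool"
  where
  "adapted_coframe b k ep e \<longleftrightarrow>
     linear k \<and> linear ep \<and> (\<forall>i<DIM('e) - 2. linear (e i)) \<and>
     (\<forall>v w. b v w = k v * ep w + ep v * k w + (\<Sum>i<DIM('e) - 2. e i v * e i w))"

text \<open>The vector metrically dual to a covector.\<close>
definition sharp :: "('e \<Rightarrow> 'e \<Rightarrow> real) \<Rightarrow> ('e \<Rightarrow> real) \<Rightarrow> 'e" where
  "sharp b \<alpha> = (THE v. \<forall>w. b v w = \<alpha> w)"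

definition null_form :: "('e \<Rightarrow> 'e \<Rightarrow> real) \<Rightarrow> ('e \<Rightarrow> real) \<Rightarrow> ('e, real) tensor \<Rightarrow> bool" where
  "null_form b k \<phi> \<longleftrightarrow>
     covector k \<and>\<^sub>w \<phi> = (\<lambda>_. 0) \<and> contract_vec (sharp b k) \<phi> = (\<lambda>_. 0)"

text \<open>
  The transverse form representing a null form \<open>\<phi>\<close> in an adapted coframe: the vector dual to
  \<open>e\<^sup>+\<close> pairs to 1 with \<open>e\<^sup>-\<close> and to 0 with \<open>e\<^sup>+\<close> and \<open>e\<^sup>i\<close>, so its contraction with \<open>e\<^sup>- \<and> \<psi>\<close> is \<open>\<psi>\<close>
  for every \<open>\<psi>\<close> in the exterior algebra of the \<open>e\<^sup>i\<close>.
\<close>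
definition transverse_part ::
  "('e \<Rightarrow> 'e \<Rightarrow> real) \<Rightarrow> ('e \<Rightarrow> real) \<Rightarrow> ('e, real) tensor \<Rightarrow> ('e, real) tensor" where
  "transverse_part b ep \<phi> = contract_vec (sharp b ep) \<phi>"

text \<open>
  The contraction of two transverse forms over their first indices; the
  combinatorial factors of the index expression are absorbed in the wedge product.
\<close>
definition transverse_contraction ::
  "('e::euclidean_space \<Rightarrow> 'e \<Rightarrow> real) \<Rightarrow> (nat \<Rightarrow> 'e \<Rightarrow> real)
     \<Rightarrow> ('e, real) tensor \<Rightarrow> ('e, real) tensor \<Rightarrow> ('e, real) tensor" where
  "transverse_contraction b e \<alpha> \<beta> vs =
     (\<Sum>i<DIM('e) - 2. (contract_vec (sharp b (e i)) \<alpha> \<and>\<^sub>w contract_vec (sharp b (e i)) \<beta>) vs)"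

text \<open>
  The product of null forms at a point, computed in an arbitrary adapted coframe (the result does not
  depend on it), and of fields of null forms.
\<close>
definition null_prod_at ::
  "('e::euclidean_space \<Rightarrow> 'e \<Rightarrow> real) \<Rightarrow> ('e \<Rightarrow> real)
     \<Rightarrow> ('e, real) tensor \<Rightarrow> ('e, real) tensor \<Rightarrow> ('e, real) tensor" where
  "null_prod_at b k \<phi> \<psi> =
     (let (ep, e) = (SOME (ep, e). adapted_coframe b k ep e) in
      covector k \<and>\<^sub>w
        transverse_contraction b e (transverse_part b ep \<phi>) (transverse_part b ep \<psi>))"

definition null_prod ::
  "('m \<Rightarrow> 'e::euclidean_space \<Rightarrow> 'e \<Rightarrow> real) \<Rightarrow> ('m \<Rightarrow> 'e \<Rightarrow> real)
     \<Rightarrow> ('m, 'e) tensor_field \<Rightarrow> ('m, 'e) tensor_field \<Rightarrow> ('m, 'e) tensor_field" where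
  "null_prod g \<kappa> \<phi> \<psi> = (\<lambda>x. null_prod_at (g x) (\<kappa> x) (\<phi> x) (\<psi> x))"

text \<open>
  The subgroup \<open>K \<ltimes> \<real>\<^sup>p\<close> of the Lorentz group, in the given coframe: \<open>a\<close> is the component in \<open>K\<close>
  and \<open>t\<close> the translation, and these determine \<open>h\<close>.
\<close>
definition semidirect_group ::
  "structure_group \<Rightarrow> ('e::euclidean_space \<Rightarrow> 'e \<Rightarrow> real) \<Rightarrow> ('e \<Rightarrow> real) \<Rightarrow> (nat \<Rightarrow> 'e \<Rightarrow> real)
     \<Rightarrow> ('e \<Rightarrow> 'e) set" where
  "semidirect_group K b k e =
     {h. linear h \<and> (\<forall>v w. b (h v) (h w) = b v w) \<and> (\<forall>v. k (h v) = k v) \<and>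
         (\<exists>a\<in>group_mats K. \<exists>t::nat \<Rightarrow> real. \<forall>i<transverse_dim K. \<forall>v.
            e i (h v) = (\<Sum>j<transverse_dim K. a $$ (i, j) * e j v) + t i * k v)}"

definition has_holonomy ::
  "('m, 'e::euclidean_space) chart set \<Rightarrow> ('m \<Rightarrow> 'e \<Rightarrow> 'e \<Rightarrow> real) \<Rightarrow> ('m, 'e) conn
     \<Rightarrow> ('m \<Rightarrow> 'e \<Rightarrow> real) \<Rightarrow> structure_group \<Rightarrow> bool" where
  "has_holonomy A g \<Gamma> \<kappa> K \<longleftrightarrow>
     DIM('e) = transverse_dim K + 2 \<and>
     (\<forall>x. \<exists>ep e. adapted_coframe (g x) (\<kappa> x) ep e \<and>
        holonomy_group A \<Gamma> x = semidirect_group K (g x) (\<kappa> x) e)"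

definition parallel_null_one_form ::
  "('m, 'e::euclidean_space) chart set \<Rightarrow> ('m \<Rightarrow> 'e \<Rightarrow> 'e \<Rightarrow> real) \<Rightarrow> ('m, 'e) conn
     \<Rightarrow> ('m \<Rightarrow> 'e \<Rightarrow> real) \<Rightarrow> bool" where
  "parallel_null_one_form A g \<Gamma> \<kappa> \<longleftrightarrow>
     smooth_tensor_on A UNIV (\<lambda>x. covector (\<kappa> x)) \<and>
     parallel_tensor A \<Gamma> (\<lambda>x. covector (\<kappa> x)) \<and>
     (\<forall>x. linear (\<kappa> x) \<and> \<kappa> x \<noteq> (\<lambda>_. 0) \<and> \<kappa> x (sharp (g x) (\<kappa> x)) = 0)"

section \<open>Fundamental forms\<close>

text \<open>The Hermitian form \<open>\<omega>(v, w) = \<delta>(I v, w)\<close> of a complex structure \<open>I\<close> on \<open>\<real>\<^sup>p\<close>.\<close>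
definition hermitian_form :: "real mat \<Rightarrow> (nat \<Rightarrow> 'e \<Rightarrow> real) \<Rightarrow> ('e, real) tensor" where
  "hermitian_form I e =
     bilin (\<lambda>v w. \<Sum>i<dim_row I. \<Sum>j<dim_row I. I $$ (i, j) * e j v * e i w)"

text \<open>The \<open>(n, 0)\<close>-form \<open>dz\<^sub>0 \<and> \<dots> \<and> dz\<^bsub>n-1\<^esub>\<close>.\<close>
definition holomorphic_volume :: "nat \<Rightarrow> (nat \<Rightarrow> 'e \<Rightarrow> real) \<Rightarrow> ('e, complex) tensor" where
  "holomorphic_volume n e =
     wedge_list (map (\<lambda>a. covector (\<lambda>v. Complex (e (2 * a) v) (e (2 * a + 1) v))) [0..<n])"

fun transverse_forms ::
  "structure_group \<Rightarrow> (nat \<Rightarrow> 'e \<Rightarrow> real) \<Rightarrow> ('e, real) tensor list" where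
  "transverse_forms (SO n) e = [wedge_list (map (\<lambda>i. covector (e i)) [0..<n])]"
| "transverse_forms (U n) e = [hermitian_form (complex_structure n) e]"
| "transverse_forms (SU n) e =
     [hermitian_form (complex_structure n) e,
      \<lambda>vs. Re (holomorphic_volume n e vs), \<lambda>vs. Im (holomorphic_volume n e vs)]"
| "transverse_forms (Sp n) e = map (\<lambda>r. hermitian_form (hyper n r) e) [0, 1, 2]"
| "transverse_forms (SpSp1 n) e =
     [\<lambda>vs. \<Sum>r<3. (hermitian_form (hyper n r) e \<and>\<^sub>w hermitian_form (hyper n r) e) vs]"

text \<open>
  The list \<open>F\<close> of the fundamental forms other than \<open>\<kappa>\<close>: parallel null forms such that around every point
  there is a smooth adapted coframe in which the holonomy group is \<open>K \<ltimes> \<real>\<^sup>p\<close> and in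
  which the forms are represented by the standard invariant forms of \<open>K\<close>.
\<close>
definition fundamental_forms ::
  "('m::topological_space, 'e::euclidean_space) chart set \<Rightarrow> ('m \<Rightarrow> 'e \<Rightarrow> 'e \<Rightarrow> real)
     \<Rightarrow> ('m, 'e) conn \<Rightarrow> ('m \<Rightarrow> 'e \<Rightarrow> real) \<Rightarrow> structure_group \<Rightarrow> ('m, 'e) tensor_field list \<Rightarrow> bool"
  where
  "fundamental_forms A g \<Gamma> \<kappa> K F \<longleftrightarrow>
     (\<forall>\<phi>\<in>set F. smooth_tensor_on A UNIV \<phi> \<and> parallel_tensor A \<Gamma> \<phi> \<and>
        (\<forall>x. alternating_form (\<phi> x) \<and> null_form (g x) (\<kappa> x) (\<phi> x))) \<and>
     (\<forall>x. \<exists>V ep e. open V \<and> x \<in> V \<and>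
        smooth_tensor_on A V (\<lambda>y. covector (ep y)) \<and>
        (\<forall>i<transverse_dim K. smooth_tensor_on A V (\<lambda>y. covector (e y i))) \<and>
        (\<forall>y\<in>V. adapted_coframe (g y) (\<kappa> y) (ep y) (e y) \<and>
           holonomy_group A \<Gamma> y = semidirect_group K (g y) (\<kappa> y) (e y) \<and>
           map (\<lambda>\<phi>. \<phi> y) F = map (\<lambda>\<psi>. covector (\<kappa> y) \<and>\<^sub>w \<psi>) (transverse_forms K (e y))))"

section \<open>Lie superalgebras\<close>

record 'a lie_superalgebra =
  lsa_carrier :: "'a set"
  lsa_add :: "'a \<Rightarrow> 'a \<Rightarrow> 'a"
  lsa_scale :: "real \<Rightarrow> 'a \<Rightarrow> 'a"
  lsa_bracket :: "'a \<Rightarrow> 'a \<Rightarrow> 'a"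
  lsa_even :: "'a set"
  lsa_odd :: "'a set"

definition lsa_iso :: "'a lie_superalgebra \<Rightarrow> 'b lie_superalgebra \<Rightarrow> bool" (infix "\<simeq>\<^sub>L" 50) where
  "L \<simeq>\<^sub>L M \<longleftrightarrow>
     (\<exists>h. bij_betw h (lsa_carrier L) (lsa_carrier M) \<and>
        (\<forall>u\<in>lsa_carrier L. \<forall>v\<in>lsa_carrier L. h (lsa_add L u v) = lsa_add M (h u) (h v)) \<and>
        (\<forall>c. \<forall>u\<in>lsa_carrier L. h (lsa_scale L c u) = lsa_scale M c (h u)) \<and>
        (\<forall>u\<in>lsa_carrier L. \<forall>v\<in>lsa_carrier L. h (lsa_bracket L u v) = lsa_bracket M (h u) (h v)) \<and>
        h ` lsa_even L = lsa_even M \<and> h ` lsa_odd L = lsa_odd M)"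

text \<open>The smallest vector space of forms that contains \<open>S\<close> and is closed under the product.\<close>
inductive_set null_closure ::
  "('m \<Rightarrow> 'e::euclidean_space \<Rightarrow> 'e \<Rightarrow> real) \<Rightarrow> ('m \<Rightarrow> 'e \<Rightarrow> real) \<Rightarrow> ('m, 'e) tensor_field set
     \<Rightarrow> ('m, 'e) tensor_field set"
  for g \<kappa> S where
  gen: "\<phi> \<in> S \<Longrightarrow> \<phi> \<in> null_closure g \<kappa> S"
| zero: "(\<lambda>x vs. 0) \<in> null_closure g \<kappa> S"
| add: "\<phi> \<in> null_closure g \<kappa> S \<Longrightarrow> \<psi> \<in> null_closure g \<kappa> S
    \<Longrightarrow> (\<lambda>x vs. \<phi> x vs + \<psi> x vs) \<in> null_closure g \<kappa> S"
| scale: "\<phi> \<in> null_closure g \<kappa> S \<Longrightarrow> (\<lambda>x vs. c * \<phi> x vs) \<in> null_closure g \<kappa> S"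
| prod: "\<phi> \<in> null_closure g \<kappa> S \<Longrightarrow> \<psi> \<in> null_closure g \<kappa> S
    \<Longrightarrow> null_prod g \<kappa> \<phi> \<psi> \<in> null_closure g \<kappa> S"

text \<open>
  On a form \<open>\<phi>\<close> of degree \<open>d\<close>, represented by a transverse form of degree \<open>d - 1\<close>, the sign of the
  bracket is \<open>(-1)\<^bsup>d-1\<^esup>\<close>; even elements are the sums of forms of odd degree \<open>d\<close>.
\<close>
definition null_bracket ::
  "('m \<Rightarrow> 'e::euclidean_space \<Rightarrow> 'e \<Rightarrow> real) \<Rightarrow> ('m \<Rightarrow> 'e \<Rightarrow> real)
     \<Rightarrow> ('m, 'e) tensor_field \<Rightarrow> ('m, 'e) tensor_field \<Rightarrow> ('m, 'e) tensor_field" where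
  "null_bracket g \<kappa> \<phi> \<psi> = null_prod g \<kappa> (\<lambda>x vs. (- 1) ^ (length vs + 1) * \<phi> x vs) \<psi>"

definition null_algebra ::
  "('m \<Rightarrow> 'e::euclidean_space \<Rightarrow> 'e \<Rightarrow> real) \<Rightarrow> ('m \<Rightarrow> 'e \<Rightarrow> real) \<Rightarrow> ('m, 'e) tensor_field set
     \<Rightarrow> ('m, 'e) tensor_field lie_superalgebra" where
  "null_algebra g \<kappa> S =
     \<lparr> lsa_carrier = null_closure g \<kappa> S,
       lsa_add = (\<lambda>\<phi> \<psi> x vs. \<phi> x vs + \<psi> x vs),
       lsa_scale = (\<lambda>c \<phi> x vs. c * \<phi> x vs),
       lsa_bracket = null_bracket g \<kappa>,
       lsa_even = {\<phi> \<in> null_closure g \<kappa> S. \<forall>x vs. even (length vs) \<longrightarrow> \<phi> x vs = 0},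
       lsa_odd = {\<phi> \<in> null_closure g \<kappa> S. \<forall>x vs. odd (length vs) \<longrightarrow> \<phi> x vs = 0} \<rparr>"

text \<open>The one-dimensional abelian Lie (super)algebra; the argument tells whether its generator is odd.\<close>
definition line_alg :: "bool \<Rightarrow> real lie_superalgebra" where
  "line_alg odd_gen =
     \<lparr> lsa_carrier = UNIV, lsa_add = (+), lsa_scale = (*), lsa_bracket = (\<lambda>_ _. 0),
       lsa_even = (if odd_gen then {0} else UNIV), lsa_odd = (if odd_gen then UNIV else {0}) \<rparr>"

text \<open>\<open>(j, a, b, c)\<close> stands for \<open>j J + a P\<^sub>1 + b P\<^sub>2 + c Z\<close>.\<close>
definition e2_hat :: "(real \<times> real \<times> real \<times> real) lie_superalgebra" where
  "e2_hat =
     \<lparr> lsa_carrier = UNIV, lsa_add = (+), lsa_scale = (*\<^sub>R),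
       lsa_bracket = (\<lambda>(j, a, b, c) (j', a', b', c').
         (0, j * b' - b * j', - (j * a' - a * j'), a * b' - b * a')),
       lsa_even = UNIV, lsa_odd = {0} \<rparr>"

text \<open>\<open>(r, a, b, c)\<close> stands for \<open>r R + a Q\<^sub>1 + b Q\<^sub>2 + c E\<close>.\<close>
definition s2_alg :: "(real \<times> real \<times> real \<times> real) lie_superalgebra" where
  "s2_alg =
     \<lparr> lsa_carrier = UNIV, lsa_add = (+), lsa_scale = (*\<^sub>R),
       lsa_bracket = (\<lambda>(r, a, b, c) (r', a', b', c').
         (0, r * b' - b * r', - (r * a' - a * r'), a * a' + b * b')),
       lsa_even = {(r, a, b, c). a = 0 \<and> b = 0}, lsa_odd = {(r, a, b, c). r = 0 \<and> c = 0} \<rparr>"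

text \<open>The Lie algebra of \<open>Sp_mats n\<close>, with the commutator.\<close>
definition sp_alg :: "nat \<Rightarrow> real mat lie_superalgebra" where
  "sp_alg n =
     (let L = {X \<in> carrier_mat (4 * n) (4 * n). transpose_mat X = - X \<and>
                 (\<forall>r<3. X * hyper n r = hyper n r * X)} in
     \<lparr> lsa_carrier = L, lsa_add = (+), lsa_scale = (\<cdot>\<^sub>m), lsa_bracket = (\<lambda>X Y. X * Y - Y * X),
       lsa_even = L, lsa_odd = {0\<^sub>m (4 * n) (4 * n)} \<rparr>)"

end

theory Submission
  imports Defs "HOL-Library.Function_Algebras"
begin

text \<open>
  The proof takes place in a single tangent space.  Every null form in question is \<open>e\<^sup>- \<and> \<psi>\<close> with \<open>\<psi>\<close>
  in the exterior algebra of the transverse covectors \<open>e\<^sup>i\<close>, and the product of two of them is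
  \<open>e\<^sup>- \<and> C(\<psi>, \<chi>)\<close> with \<open>C(\<psi>, \<chi>) = \<Sum>\<^sub>j i\<^sub>j \<psi> \<and> i\<^sub>j \<chi>\<close> (\<open>null_prod_at_covector_wedge\<close>).  The result is the
  same in all adapted coframes: the representatives of a null form differ by multiples of
  \<open>e\<^sup>-\<close>, which the factor \<open>e\<^sup>-\<close> kills, and the transverse frames differ by an orthogonal matrix.
  As the products of the standard invariant forms turn out to be combinations of
  these forms and one further form with coefficients that do not depend on the point, the fields of
  null forms generate an algebra with the same structure constants.

  The exterior calculus rests on the antiderivation property \<open>contract_wedge\<close> of the contraction,
  which doubles as a recursion for the wedge product along the list of arguments; associativity and
  graded commutativity follow from it by induction.

  If \<open>\<psi>\<close> has even degree, every \<open>i\<^sub>j \<psi>\<close> is odd and squares to zero, so \<open>C(\<psi>, \<psi>) = 0\<close>.  This settles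
  \<open>U(n)\<close> and \<open>Sp(n)\<cdot>Sp(1)\<close>.  For \<open>SO(n)\<close>, the contraction of the volume form with \<open>e\<^sub>j\<close> is still
  divisible by any other \<open>e\<^sup>l\<close>, so again it squares to zero.

  For \<open>SU(n)\<close>, let \<open>\<Omega> = \<chi>\<^sub>1 + \<i> \<chi>\<^sub>2\<close> be the form \<open>dz\<^sub>0 \<and> \<dots> \<and> dz\<^bsub>n-1\<^esub>\<close> and \<open>Z\<^sub>a\<close> its contraction with
  \<open>\<partial>/\<partial>x\<^sub>a\<close>, which is \<open>\<plusminus>\<Omega>\<close> without its factor \<open>dz\<^sub>a\<close>.  The map \<open>C(\<omega>, _)\<close> is a derivation which
  multiplies a holomorphic form of degree \<open>k\<close> by \<open>- \<i> k\<close>; hence it rotates \<open>\<chi>\<^sub>1\<close> and \<open>\<chi>\<^sub>2\<close>.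
  Moreover \<open>C(\<Omega>, \<Omega>) = 0\<close>, while \<open>C(\<Omega>, cnj \<Omega>) = 2 V\<close> with
  \<open>V = \<Sum>\<^sub>a Z\<^sub>a \<and> cnj Z\<^sub>a\<close>, a nonzero multiple of \<open>\<omega>\<^bsup>n-1\<^esup>\<close>.  The weights of \<open>Z\<^sub>a\<close> and \<open>cnj Z\<^sub>a\<close>
  under \<open>C(\<omega>, _)\<close> cancel, so \<open>C(\<omega>, V) = 0\<close>; and
  \<open>C(\<Omega>, V) = 0\<close> because it consists of terms with a factor \<open>Z\<^sub>a \<and> Z\<^sub>b\<close>, in which some \<open>dz\<^sub>c\<close> occurs
  twice when \<open>n \<ge> 3\<close>.  Taking real parts, \<open>C(\<chi>\<^sub>i, \<chi>\<^sub>j)\<close> is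
  antisymmetric for even \<open>n\<close> and symmetric for odd \<open>n\<close>, and so is either a multiple of the symplectic form
  or of the metric in \<open>i, j\<close>, times a real multiple \<open>W\<close> of \<open>\<omega>\<^bsup>n-1\<^esup>\<close> that is central.  This is
  the extended Euclidean algebra in the first case, the supersymmetry algebra in the second.

  For \<open>Sp(n)\<close>, the multiplication table of the quaternions gives
  \<open>C(\<omega>\<^sub>i, \<omega>\<^sub>j) = 2 \<omega>\<^sub>k\<close>, cyclically; these are the commutation
  relations of the right multiplications with the conjugate units, which span the Lie algebra of \<open>Sp(1)\<close>.

  The locale \<open>null_model\<close> collects what has to be known of a parametrization of transverse forms by a Lie
  superalgebra to conclude that the algebra of null forms is isomorphic to it.
\<close>

section \<open>The wedge product as a shuffle algebra\<close>

text \<open>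
  Forms are added and negated as elements of an abelian group; the evaluation of such operations at a
  list of arguments is therefore not a default rewrite rule.
\<close>
lemmas pointwise = zero_fun_apply plus_fun_apply uminus_apply minus_apply

declare pointwise [simp del]

text \<open>
  The grade involution.  It makes the sign rule of the contraction meaningful for forms of
  mixed degree.
\<close>
definition grade_inv :: "('e, 'f::comm_ring_1) tensor \<Rightarrow> ('e, 'f) tensor" where
  "grade_inv \<alpha> vs = (- 1) ^ length vs * \<alpha> vs"

definition tscale :: "'f \<Rightarrow> ('e, 'f::comm_ring_1) tensor \<Rightarrow> ('e, 'f) tensor" (infixr "*\<^sub>t" 75) where
  "(c *\<^sub>t \<alpha>) vs = c * \<alpha> vs"

lemma wedge_Nil: "(\<alpha> \<and>\<^sub>w \<beta>) [] = \<alpha> [] * \<beta> []"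
  by (simp add: wedge_def)

lemma sum_fun_apply: "(\<Sum>i\<in>I. f i) x = (\<Sum>i\<in>I. f i x)"
  for f :: "'i \<Rightarrow> 'a \<Rightarrow> 'b::comm_monoid_add"
  by (induction I rule: infinite_finite_induct) (auto simp: pointwise)

text \<open>
  Shuffles of \<open>n + 1\<close> positions are split according to the factor that receives the first
  position.
\<close>
lemma sum_Pow_lessThan_Suc:
  fixes h :: "nat set \<Rightarrow> 'b::comm_monoid_add"
  shows "(\<Sum>I\<in>Pow {..<Suc n}. h I) =
    (\<Sum>J\<in>Pow {..<n}. h (insert 0 (Suc ` J))) + (\<Sum>J\<in>Pow {..<n}. h (Suc ` J))"
proof -
  have eq: "{..<Suc n} = insert 0 (Suc ` {..<n})"
    by (simp add: lessThan_Suc_eq_insert_0)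
  have 1: "Pow {..<Suc n} = insert 0 ` Pow (Suc ` {..<n}) \<union> Pow (Suc ` {..<n})"
    unfolding eq Pow_insert by blast
  have 2: "Pow (Suc ` {..<n}) = image Suc ` Pow {..<n}"
    by (simp add: image_Pow_surj)
  have disj: "insert 0 ` Pow (Suc ` {..<n}) \<inter> Pow (Suc ` {..<n}) = {}"
    by auto
  have inj1: "inj_on (image Suc) (Pow {..<n})"
    by (rule inj_on_image_Pow) simp
  have inj2: "inj_on (\<lambda>J. insert 0 (Suc ` J)) (Pow {..<n})"
  proof (rule inj_onI)
    fix J J' assume "insert 0 (Suc ` J) = insert 0 (Suc ` J')"
    then have "Suc ` J = Suc ` J'"
      by (metis Diff_insert_absorb Suc_not_Zero image_iff)
    then show "J = J'" by (simp add: inj_image_eq_iff)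
  qed
  have "(\<Sum>I\<in>Pow {..<Suc n}. h I) =
    (\<Sum>I\<in>insert 0 ` Pow (Suc ` {..<n}). h I) + (\<Sum>I\<in>Pow (Suc ` {..<n}). h I)"
    unfolding 1 by (rule sum.union_disjoint) (use disj in auto)
  then show ?thesis
    unfolding 2 image_image by (simp add: sum.reindex[OF inj1] sum.reindex[OF inj2] o_def)
qed

text \<open>
  If the first argument goes into the left factor, it creates no inversions; if it goes into
  the right factor, it creates one inversion for each argument of the left factor, which is the sign of
  the grade involution.
\<close>
lemma contract_wedge:
  fixes \<alpha> \<beta> :: "('e, 'f::comm_ring_1) tensor"
  shows "contract_vec v (\<alpha> \<and>\<^sub>w \<beta>) = contract_vec v \<alpha> \<and>\<^sub>w \<beta> + grade_inv \<alpha> \<and>\<^sub>w contract_vec v \<beta>"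
proof
  fix vs :: "'e list"
  let ?n = "length vs"
  let ?s = "\<lambda>n I. card {(i, j). i \<in> I \<and> j \<in> {..<n} - I \<and> j < i}"
  have compl1: "{..<Suc ?n} - insert 0 (Suc ` J) = Suc ` ({..<?n} - J)" if "J \<subseteq> {..<?n}" for J
    using that by (auto simp: lessThan_Suc_eq_insert_0)
  have compl2: "{..<Suc ?n} - Suc ` J = insert 0 (Suc ` ({..<?n} - J))" if "J \<subseteq> {..<?n}" for J
    using that by (auto simp: lessThan_Suc_eq_insert_0)
  have pre: "{j. Suc j \<in> insert 0 (Suc ` J)} = J" "{j. Suc j \<in> Suc ` J} = J" for J :: "nat set"
    by auto
  have finS: "finite {(i, j). i \<in> J \<and> j \<in> {..<?n} - J \<and> j < i}" if "J \<subseteq> {..<?n}" for J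
    by (rule finite_subset[of _ "{..<?n} \<times> {..<?n}"]) (use that in auto)
  have s1: "?s (Suc ?n) (insert 0 (Suc ` J)) = ?s ?n J" if "J \<subseteq> {..<?n}" for J
  proof -
    have "{(i, j). i \<in> insert 0 (Suc ` J) \<and> j \<in> {..<Suc ?n} - insert 0 (Suc ` J) \<and> j < i} =
      map_prod Suc Suc ` {(i, j). i \<in> J \<and> j \<in> {..<?n} - J \<and> j < i}"
      unfolding compl1[OF that] by (auto simp: map_prod_def image_iff)
    then show ?thesis
      by (simp add: card_image inj_on_def map_prod_def split_beta prod_eq_iff)
  qed
  have s2: "?s (Suc ?n) (Suc ` J) = card J + ?s ?n J" if "J \<subseteq> {..<?n}" for J
  proof -
    have eq: "{(i, j). i \<in> Suc ` J \<and> j \<in> {..<Suc ?n} - Suc ` J \<and> j < i} =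
      (\<lambda>i. (Suc i, 0)) ` J \<union> map_prod Suc Suc ` {(i, j). i \<in> J \<and> j \<in> {..<?n} - J \<and> j < i}"
      unfolding compl2[OF that] by (auto simp: map_prod_def image_iff)
    have "finite J" using that finite_subset by blast
    then have "?s (Suc ?n) (Suc ` J) = card ((\<lambda>i. (Suc i, 0::nat)) ` J) +
      card (map_prod Suc Suc ` {(i, j). i \<in> J \<and> j \<in> {..<?n} - J \<and> j < i})"
      unfolding eq by (intro card_Un_disjoint) (use finS[OF that] in auto)
    then show ?thesis
      by (simp add: card_image inj_on_def map_prod_def split_beta prod_eq_iff)
  qed
  have len: "length (nths vs J) = card J" if "J \<subseteq> {..<?n}" for J
    unfolding length_nths by (rule arg_cong[of _ _ card]) (use that in auto)
  have "contract_vec v (\<alpha> \<and>\<^sub>w \<beta>) vs =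
    (\<Sum>J\<in>Pow {..<?n}. (- 1) ^ ?s ?n J * \<alpha> (v # nths vs J) * \<beta> (nths vs ({..<?n} - J))) +
    (\<Sum>J\<in>Pow {..<?n}. (- 1) ^ (card J + ?s ?n J) * \<alpha> (nths vs J) * \<beta> (v # nths vs ({..<?n} - J)))"
    unfolding contract_vec_def wedge_def length_Cons sum_Pow_lessThan_Suc
    by (intro arg_cong2[of _ _ _ _ "(+)"] sum.cong HOL.refl)
       (simp_all only: Pow_iff s1 s2, simp_all add: compl1 compl2 nths_Cons pre)
  also have "\<dots> = (contract_vec v \<alpha> \<and>\<^sub>w \<beta>) vs + (grade_inv \<alpha> \<and>\<^sub>w contract_vec v \<beta>) vs"
    unfolding contract_vec_def wedge_def grade_inv_def
    by (intro arg_cong2[of _ _ _ _ "(+)"] sum.cong HOL.refl) (simp_all add: len power_add algebra_simps)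
  finally show "contract_vec v (\<alpha> \<and>\<^sub>w \<beta>) vs =
    (contract_vec v \<alpha> \<and>\<^sub>w \<beta> + grade_inv \<alpha> \<and>\<^sub>w contract_vec v \<beta>) vs" by (simp add: pointwise)
qed

lemma wedge_Cons:
  "(\<alpha> \<and>\<^sub>w \<beta>) (v # vs) = (contract_vec v \<alpha> \<and>\<^sub>w \<beta>) vs + (grade_inv \<alpha> \<and>\<^sub>w contract_vec v \<beta>) vs"
  using fun_cong[OF contract_wedge, of v \<alpha> \<beta> vs] by (simp add: contract_vec_def pointwise)

text \<open>
  Together with \<open>contract_wedge\<close>, this allows identities between forms to be proved by contracting
  both sides.
\<close>
lemma tensor_eqI:
  assumes "\<alpha> [] = \<beta> []" "\<And>v. contract_vec v \<alpha> = contract_vec v \<beta>"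
  shows "\<alpha> = \<beta>"
proof
  show "\<alpha> vs = \<beta> vs" for vs
    using assms(1) fun_cong[OF assms(2)] by (cases vs) (auto simp: contract_vec_def)
qed

lemma contract_add [simp]: "contract_vec v (\<alpha> + \<beta>) = contract_vec v \<alpha> + contract_vec v \<beta>"
  and contract_zero [simp]: "contract_vec v 0 = 0"
  and contract_minus [simp]: "contract_vec v (- \<alpha>) = - contract_vec v \<alpha>"
  and contract_diff [simp]: "contract_vec v (\<alpha> - \<beta>) = contract_vec v \<alpha> - contract_vec v \<beta>"
  for \<alpha> \<beta> :: "('e, 'f::comm_ring_1) tensor"
  by (auto simp: contract_vec_def fun_eq_iff pointwise)

lemma contract_scale [simp]: "contract_vec v (c *\<^sub>t \<alpha>) = c *\<^sub>t contract_vec v \<alpha>"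
  by (auto simp: contract_vec_def tscale_def fun_eq_iff pointwise)

lemma contract_sum [simp]:
  "contract_vec v (\<Sum>i\<in>I. \<alpha> i) = (\<Sum>i\<in>I. contract_vec v (\<alpha> i))"
  for \<alpha> :: "'i \<Rightarrow> ('e, 'f::comm_ring_1) tensor"
  by (auto simp: contract_vec_def sum_fun_apply fun_eq_iff pointwise)

lemma grade_inv_add [simp]: "grade_inv (\<alpha> + \<beta>) = grade_inv \<alpha> + grade_inv \<beta>"
  and grade_inv_zero [simp]: "grade_inv 0 = 0"
  and grade_inv_minus [simp]: "grade_inv (- \<alpha>) = - grade_inv \<alpha>"
  and grade_inv_diff [simp]: "grade_inv (\<alpha> - \<beta>) = grade_inv \<alpha> - grade_inv \<beta>"
  and grade_inv_scale [simp]: "grade_inv (c *\<^sub>t \<alpha>) = c *\<^sub>t grade_inv \<alpha>"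
  and grade_inv_grade_inv [simp]: "grade_inv (grade_inv \<alpha>) = \<alpha>"
  by (auto simp: grade_inv_def tscale_def fun_eq_iff pointwise distrib_left right_diff_distrib mult.left_commute left_minus_one_mult_self)

lemma grade_inv_contract: "grade_inv (contract_vec v \<alpha>) = - contract_vec v (grade_inv \<alpha>)"
  and contract_grade_inv [simp]: "contract_vec v (grade_inv \<alpha>) = - grade_inv (contract_vec v \<alpha>)"
  by (auto simp: grade_inv_def contract_vec_def fun_eq_iff pointwise)

lemma wedge_add_left: "(\<alpha> + \<alpha>') \<and>\<^sub>w \<beta> = \<alpha> \<and>\<^sub>w \<beta> + \<alpha>' \<and>\<^sub>w \<beta>"
  and wedge_add_right: "\<beta> \<and>\<^sub>w (\<alpha> + \<alpha>') = \<beta> \<and>\<^sub>w \<alpha> + \<beta> \<and>\<^sub>w \<alpha>'"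
  by (auto simp: wedge_def fun_eq_iff pointwise algebra_simps sum.distrib)

lemma wedge_scale_left [simp]: "(c *\<^sub>t \<alpha>) \<and>\<^sub>w \<beta> = c *\<^sub>t (\<alpha> \<and>\<^sub>w \<beta>)"
  and wedge_scale_right [simp]: "\<alpha> \<and>\<^sub>w (c *\<^sub>t \<beta>) = c *\<^sub>t (\<alpha> \<and>\<^sub>w \<beta>)"
  and wedge_zero_left [simp]: "0 \<and>\<^sub>w \<beta> = 0"
  and wedge_zero_right [simp]: "\<alpha> \<and>\<^sub>w 0 = 0"
  and wedge_minus_left [simp]: "(- \<alpha>) \<and>\<^sub>w \<beta> = - (\<alpha> \<and>\<^sub>w \<beta>)"
  and wedge_minus_right [simp]: "\<alpha> \<and>\<^sub>w (- \<beta>) = - (\<alpha> \<and>\<^sub>w \<beta>)"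
  by (auto simp: wedge_def tscale_def fun_eq_iff pointwise algebra_simps sum_distrib_left sum_negf)

lemma wedge_diff_left: "(\<alpha> - \<alpha>') \<and>\<^sub>w \<beta> = \<alpha> \<and>\<^sub>w \<beta> - \<alpha>' \<and>\<^sub>w \<beta>"
  and wedge_diff_right: "\<beta> \<and>\<^sub>w (\<alpha> - \<alpha>') = \<beta> \<and>\<^sub>w \<alpha> - \<beta> \<and>\<^sub>w \<alpha>'"
  by (simp_all only: diff_conv_add_uminus wedge_add_left wedge_add_right
        wedge_minus_left wedge_minus_right)

lemma wedge_sum_left: "(\<Sum>i\<in>I. \<alpha> i) \<and>\<^sub>w \<beta> = (\<Sum>i\<in>I. \<alpha> i \<and>\<^sub>w \<beta>)"
  by (induction I rule: infinite_finite_induct) (simp_all add: wedge_add_left)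

lemma wedge_sum_right: "\<beta> \<and>\<^sub>w (\<Sum>i\<in>I. \<alpha> i) = (\<Sum>i\<in>I. \<beta> \<and>\<^sub>w \<alpha> i)"
  by (induction I rule: infinite_finite_induct) (simp_all add: wedge_add_right)

lemma tscale_one [simp]: "1 *\<^sub>t \<alpha> = \<alpha>"
  and tscale_zero [simp]: "0 *\<^sub>t \<alpha> = 0" "c *\<^sub>t 0 = 0"
  and tscale_tscale [simp]: "c *\<^sub>t d *\<^sub>t \<alpha> = (c * d) *\<^sub>t \<alpha>"
  and tscale_minus [simp]: "c *\<^sub>t (- \<alpha>) = - (c *\<^sub>t \<alpha>)" "(- c) *\<^sub>t \<alpha> = - (c *\<^sub>t \<alpha>)"
  and tscale_add_right: "c *\<^sub>t (\<alpha> + \<beta>) = c *\<^sub>t \<alpha> + c *\<^sub>t \<beta>"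
  and tscale_diff_right: "c *\<^sub>t (\<alpha> - \<beta>) = c *\<^sub>t \<alpha> - c *\<^sub>t \<beta>"
  and tscale_add_left: "(c + d) *\<^sub>t \<alpha> = c *\<^sub>t \<alpha> + d *\<^sub>t \<alpha>"
  by (auto simp: tscale_def fun_eq_iff pointwise algebra_simps)

lemma tscale_sum_right: "c *\<^sub>t (\<Sum>i\<in>I. \<alpha> i) = (\<Sum>i\<in>I. c *\<^sub>t \<alpha> i)"
  by (auto simp: tscale_def fun_eq_iff pointwise sum_fun_apply sum_distrib_left)

lemma grade_inv_wedge [simp]: "grade_inv (\<alpha> \<and>\<^sub>w \<beta>) = grade_inv \<alpha> \<and>\<^sub>w grade_inv \<beta>"
proof
  fix vs
  show "grade_inv (\<alpha> \<and>\<^sub>w \<beta>) vs = (grade_inv \<alpha> \<and>\<^sub>w grade_inv \<beta>) vs"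
  proof (induction vs arbitrary: \<alpha> \<beta>)
    case Nil
    show ?case by (simp add: grade_inv_def wedge_Nil)
  next
    case (Cons v vs)
    have "grade_inv (\<alpha> \<and>\<^sub>w \<beta>) (v # vs) = - grade_inv (contract_vec v (\<alpha> \<and>\<^sub>w \<beta>)) vs"
      by (simp add: grade_inv_def contract_vec_def)
    also have "\<dots> = (grade_inv \<alpha> \<and>\<^sub>w grade_inv \<beta>) (v # vs)"
      by (simp add: contract_wedge wedge_Cons pointwise Cons.IH)
    finally show ?case .
  qed
qed

lemma wedge_assoc: "(\<alpha> \<and>\<^sub>w \<beta>) \<and>\<^sub>w \<gamma> = \<alpha> \<and>\<^sub>w \<beta> \<and>\<^sub>w \<gamma>"
proof
  fix vs
  show "((\<alpha> \<and>\<^sub>w \<beta>) \<and>\<^sub>w \<gamma>) vs = (\<alpha> \<and>\<^sub>w \<beta> \<and>\<^sub>w \<gamma>) vs"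
  proof (induction vs arbitrary: \<alpha> \<beta> \<gamma>)
    case Nil
    show ?case by (simp add: wedge_Nil mult.assoc)
  next
    case (Cons v vs)
    show ?case
      by (simp add: wedge_Cons pointwise contract_wedge wedge_add_left wedge_add_right Cons.IH)
  qed
qed

text \<open>
  Only the parity of \<open>d\<close> matters.  Contraction changes the parity of every form, including those of
  degree zero, so that a parity can be tracked by \<open>Suc\<close> without side conditions.
\<close>
definition has_parity :: "nat \<Rightarrow> ('e, 'f::comm_ring_1) tensor \<Rightarrow> bool" where
  "has_parity d \<alpha> \<longleftrightarrow> grade_inv \<alpha> = (- 1) ^ d *\<^sub>t \<alpha>"

lemma has_parity_contract:
  "has_parity d \<alpha> \<Longrightarrow> has_parity (Suc d) (contract_vec v \<alpha>)"
  by (simp add: has_parity_def grade_inv_contract del: contract_grade_inv)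

lemma wedge_commute:
  assumes "has_parity d \<alpha>" "has_parity e \<beta>"
  shows "\<beta> \<and>\<^sub>w \<alpha> = (- 1) ^ (d * e) *\<^sub>t (\<alpha> \<and>\<^sub>w \<beta>)"
proof
  fix vs
  show "(\<beta> \<and>\<^sub>w \<alpha>) vs = ((- 1) ^ (d * e) *\<^sub>t (\<alpha> \<and>\<^sub>w \<beta>)) vs"
    using assms
  proof (induction vs arbitrary: d e \<alpha> \<beta>)
    case Nil
    have "\<alpha> [] = (- 1) ^ d * \<alpha> []" "\<beta> [] = (- 1) ^ e * \<beta> []"
      using Nil by (auto simp: has_parity_def grade_inv_def tscale_def fun_eq_iff pointwise dest: spec[of _ "[]"])
    then have "(-1) ^ (d * e) * \<alpha> [] = \<alpha> []"
      by (cases "even d"; cases "even e") auto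
    then show ?case by (simp add: wedge_Nil tscale_def mult.commute[of "\<beta> []"] flip: mult.assoc)
  next
    case (Cons v vs)
    have 1: "(contract_vec v \<beta> \<and>\<^sub>w \<alpha>) vs = (- 1) ^ (d * Suc e) * (\<alpha> \<and>\<^sub>w contract_vec v \<beta>) vs"
      using Cons.IH[OF Cons.prems(1) has_parity_contract[OF Cons.prems(2)]] by (simp add: tscale_def)
    have 2: "(\<beta> \<and>\<^sub>w contract_vec v \<alpha>) vs = (- 1) ^ (Suc d * e) * (contract_vec v \<alpha> \<and>\<^sub>w \<beta>) vs"
      using Cons.IH[OF has_parity_contract[OF Cons.prems(1)] Cons.prems(2)] by (simp add: tscale_def)
    have "grade_inv \<alpha> = (- 1) ^ d *\<^sub>t \<alpha>" "grade_inv \<beta> = (- 1) ^ e *\<^sub>t \<beta>"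
      using Cons.prems by (auto simp: has_parity_def)
    then show ?case
      by (simp only: wedge_Cons pointwise tscale_def wedge_scale_left 1 2)
         (cases "even d"; cases "even e"; simp add: algebra_simps)
  qed
qed

lemma wedge_self_odd:
  fixes \<alpha> :: "('e, real) tensor"
  assumes "has_parity d \<alpha>" "odd d"
  shows "\<alpha> \<and>\<^sub>w \<alpha> = 0"
  using wedge_commute[OF assms(1) assms(1)] assms(2) by (auto simp: fun_eq_iff pointwise tscale_def)

section \<open>Wedge products with covectors\<close>

lemma contract_unit [simp]: "contract_vec v one_form_unit = 0"
  by (auto simp: contract_vec_def one_form_unit_def fun_eq_iff pointwise)

lemma grade_inv_unit [simp]: "grade_inv one_form_unit = one_form_unit"
  by (auto simp: grade_inv_def one_form_unit_def fun_eq_iff pointwise)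

lemma wedge_unit [simp]: "one_form_unit \<and>\<^sub>w \<alpha> = \<alpha>" "\<alpha> \<and>\<^sub>w one_form_unit = \<alpha>"
proof -
  have "(one_form_unit \<and>\<^sub>w \<alpha>) vs = \<alpha> vs \<and> (\<alpha> \<and>\<^sub>w one_form_unit) vs = \<alpha> vs" for vs
    by (induction vs arbitrary: \<alpha>)
       (simp_all add: wedge_Nil wedge_Cons pointwise, simp_all add: one_form_unit_def contract_vec_def)
  then show "one_form_unit \<and>\<^sub>w \<alpha> = \<alpha>" "\<alpha> \<and>\<^sub>w one_form_unit = \<alpha>" by auto
qed

lemma contract_covector [simp]: "contract_vec v (covector a) = a v *\<^sub>t one_form_unit"
  by (auto simp: contract_vec_def covector_def one_form_unit_def tscale_def fun_eq_iff pointwise)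

lemma covector_Nil [simp]: "covector a [] = 0"
  by (simp add: covector_def)

lemma grade_inv_covector [simp]: "grade_inv (covector a) = - covector a"
  by (auto simp: grade_inv_def covector_def fun_eq_iff pointwise)

lemma contract_covector_wedge:
  "contract_vec v (covector a \<and>\<^sub>w \<alpha>) = a v *\<^sub>t \<alpha> - covector a \<and>\<^sub>w contract_vec v \<alpha>"
  by (simp add: contract_wedge)

lemma wedge_covector_right: "\<alpha> \<and>\<^sub>w covector a = covector a \<and>\<^sub>w grade_inv \<alpha>"
proof
  fix vs
  show "(\<alpha> \<and>\<^sub>w covector a) vs = (covector a \<and>\<^sub>w grade_inv \<alpha>) vs"
  proof (induction vs arbitrary: \<alpha>)
    case (Cons v vs)
    then show ?case by (simp add: wedge_Cons pointwise)
  qed (simp add: wedge_Nil pointwise)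
qed

lemma covector_wedge_self: "covector a \<and>\<^sub>w covector a = 0"
proof (rule tensor_eqI)
  show "contract_vec v (covector a \<and>\<^sub>w covector a) = contract_vec v 0" for v
    by (simp add: contract_covector_wedge)
qed (simp add: wedge_Nil pointwise)

lemma covector_wedge_wedge_self: "covector a \<and>\<^sub>w covector a \<and>\<^sub>w \<alpha> = 0"
  by (simp add: covector_wedge_self flip: wedge_assoc)

lemma covector_wedge_swap: "\<alpha> \<and>\<^sub>w covector a \<and>\<^sub>w \<beta> = covector a \<and>\<^sub>w grade_inv \<alpha> \<and>\<^sub>w \<beta>"
  by (simp add: wedge_covector_right flip: wedge_assoc)

text \<open>
  The exterior multiplication with a nonzero covector is an exact complex, with the contraction
  as a homotopy.
\<close>
lemma covector_divides:
  assumes "covector a \<and>\<^sub>w \<alpha> = 0" "a v = 1"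
  shows "\<alpha> = covector a \<and>\<^sub>w contract_vec v \<alpha>"
  using contract_covector_wedge[of v a \<alpha>] assms by simp

lemma wedge_eq_0_if_common_divisor:
  assumes "covector a \<and>\<^sub>w \<alpha> = 0" "covector a \<and>\<^sub>w \<beta> = 0" "a v = 1"
  shows "\<alpha> \<and>\<^sub>w \<beta> = 0"
proof -
  obtain \<alpha>' \<beta>' where "\<alpha> = covector a \<and>\<^sub>w \<alpha>'" "\<beta> = covector a \<and>\<^sub>w \<beta>'"
    using covector_divides[OF assms(1,3)] covector_divides[OF assms(2,3)] by blast
  moreover have "(covector a \<and>\<^sub>w \<alpha>') \<and>\<^sub>w covector a \<and>\<^sub>w \<beta>' = 0"
    by (subst covector_wedge_swap) (simp add: wedge_assoc covector_wedge_wedge_self)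
  ultimately show ?thesis by simp
qed

lemma covector_wedge_list_eq_0:
  "a \<in> set as \<Longrightarrow> covector a \<and>\<^sub>w wedge_list (map covector as) = 0"
proof (induction as)
  case (Cons c as)
  show ?case
  proof (cases "a = c")
    case True
    then show ?thesis by (simp add: wedge_list_def covector_wedge_wedge_self)
  next
    case False
    have "covector a \<and>\<^sub>w wedge_list (map covector (c # as)) =
      - (covector c \<and>\<^sub>w covector a \<and>\<^sub>w wedge_list (map covector as))"
      using covector_wedge_swap[of "covector a" c] by (simp add: wedge_list_def)
    moreover have "covector a \<and>\<^sub>w wedge_list (map covector as) = 0"
      using Cons False by (meson set_ConsD)
    ultimately show ?thesis by simp
  qed
qed simp


section \<open>Degree\<close>

definition has_degree :: "nat \<Rightarrow> ('e, 'f::zero) tensor \<Rightarrow> bool" where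
  "has_degree d \<alpha> \<longleftrightarrow> (\<forall>vs. length vs \<noteq> d \<longrightarrow> \<alpha> vs = 0)"

lemma has_parity_if_has_degree: "has_degree d \<alpha> \<Longrightarrow> has_parity d \<alpha>"
  by (auto simp: has_degree_def has_parity_def grade_inv_def tscale_def fun_eq_iff pointwise)

lemma has_degree_wedge:
  assumes "has_degree a \<alpha>" "has_degree b \<beta>"
  shows "has_degree (a + b) (\<alpha> \<and>\<^sub>w \<beta>)"
  unfolding has_degree_def
proof (intro allI impI)
  fix vs :: "'a list"
  assume len: "length vs \<noteq> a + b"
  have "\<alpha> (nths vs I) * \<beta> (nths vs ({..<length vs} - I)) = 0" if "I \<subseteq> {..<length vs}" for I
  proof -
    have "length (nths vs I) = card I"
      unfolding length_nths by (rule arg_cong[of _ _ card]) (use that in auto)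
    moreover have "length (nths vs ({..<length vs} - I)) = length vs - card I"
      unfolding length_nths using that
      by (subst card_lessThan[of "length vs", symmetric], subst card_Diff_subset[symmetric])
         (auto intro: finite_subset arg_cong[of _ _ card])
    moreover have "card I \<le> length vs"
      using card_mono[OF _ that] by simp
    ultimately have "length (nths vs I) \<noteq> a \<or> length (nths vs ({..<length vs} - I)) \<noteq> b"
      using len by linarith
    then show ?thesis using assms by (auto simp: has_degree_def)
  qed
  then show "(\<alpha> \<and>\<^sub>w \<beta>) vs = 0"
    unfolding wedge_def by (intro sum.neutral) (auto simp: mult.assoc)
qed

lemma has_degree_contract: "has_degree (Suc d) \<alpha> \<Longrightarrow> has_degree d (contract_vec v \<alpha>)"
  by (auto simp: has_degree_def contract_vec_def)

lemma has_degree_sum: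
  "(\<And>i. i \<in> I \<Longrightarrow> has_degree d (\<alpha> i)) \<Longrightarrow> has_degree d (\<Sum>i\<in>I. \<alpha> i)"
  for \<alpha> :: "'i \<Rightarrow> ('e, 'f::comm_ring_1) tensor"
  by (auto simp: has_degree_def sum_fun_apply pointwise)

lemma has_degree_scale: "has_degree d \<alpha> \<Longrightarrow> has_degree d (c *\<^sub>t \<alpha>)"
  by (auto simp: has_degree_def tscale_def)

lemma has_degree_covector: "has_degree 1 (covector a)"
  by (auto simp: has_degree_def covector_def)

lemma has_degree_unit: "has_degree 0 one_form_unit"
  by (auto simp: has_degree_def one_form_unit_def)

lemma wedge_list_Nil [simp]: "wedge_list [] = one_form_unit"
  and wedge_list_Cons [simp]: "wedge_list (\<alpha> # \<alpha>s) = \<alpha> \<and>\<^sub>w wedge_list \<alpha>s"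
  by (simp_all add: wedge_list_def)

lemma has_degree_wedge_list: "has_degree (length is) (wedge_list (map (\<lambda>i. covector (a i)) is))"
proof (induction "is")
  case (Cons i "is")
  then show ?case
    using has_degree_wedge[OF has_degree_covector[of "a i"]] by fastforce
qed (simp add: has_degree_unit)

lemma contract_wedge_list_eq_0:
  assumes "\<And>i. i \<in> set is \<Longrightarrow> a i v = 0"
  shows "contract_vec v (wedge_list (map (\<lambda>i. covector (a i)) is)) = 0"
  using assms
proof (induction "is")
  case (Cons i "is")
  then have "contract_vec v (wedge_list (map (\<lambda>i. covector (a i)) is)) = 0" "a i v = 0"
    by simp_all
  then show ?case by (simp add: contract_covector_wedge)
qed simp

text \<open>
  With dual vectors as arguments, only the diagonal of the determinant contributes.
\<close>
lemma wedge_list_dual_vectors: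
  assumes "distinct is" "\<And>i j. i \<in> set is \<Longrightarrow> j \<in> set is \<Longrightarrow> i \<noteq> j \<Longrightarrow> a i (v j) = 0"
  shows "wedge_list (map (\<lambda>i. covector (a i)) is) (map v is) = (\<Prod>i\<in>set is. a i (v i))"
  using assms
proof (induction "is")
  case Nil
  show ?case by (simp add: one_form_unit_def)
next
  case (Cons i "is")
  have "contract_vec (v i) (wedge_list (map (\<lambda>i. covector (a i)) is)) = 0"
    by (rule contract_wedge_list_eq_0) (use Cons.prems in auto)
  with Cons show ?case by (simp add: wedge_Cons pointwise tscale_def)
qed

lemma covector_wedge_list_index_eq_0:
  "i \<in> set is \<Longrightarrow> covector (a i) \<and>\<^sub>w wedge_list (map (\<lambda>i. covector (a i)) is) = 0"
  using covector_wedge_list_eq_0[of "a i" "map a is"] by (simp add: o_def)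

lemma wedge_covector_covector:
  "covector a \<and>\<^sub>w covector b = bilin (\<lambda>v w. a v * b w - a w * b v)"
proof
  fix vs
  show "(covector a \<and>\<^sub>w covector b) vs = bilin (\<lambda>v w. a v * b w - a w * b v) vs"
    by (cases vs rule: list.exhaust[case_product list.exhaust])
       (auto simp: wedge_Nil wedge_Cons pointwise bilin_def tscale_def one_form_unit_def covector_def
         neq_Nil_conv length_Suc_conv split: if_splits)
qed

section \<open>The contraction of forms\<close>

text \<open>
  The transverse part of the product of null forms, for a frame \<open>E\<close> that is orthonormal.
\<close>
definition frame_contraction ::
  "nat \<Rightarrow> (nat \<Rightarrow> 'e) \<Rightarrow> ('e, 'f::comm_ring_1) tensor \<Rightarrow> ('e, 'f) tensor \<Rightarrow> ('e, 'f) tensor" where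
  "frame_contraction p E \<alpha> \<beta> = (\<Sum>i<p. contract_vec (E i) \<alpha> \<and>\<^sub>w contract_vec (E i) \<beta>)"

lemma frame_contraction_add_left:
    "frame_contraction p E (\<alpha> + \<beta>) \<gamma> = frame_contraction p E \<alpha> \<gamma> + frame_contraction p E \<beta> \<gamma>"
  and frame_contraction_add_right:
    "frame_contraction p E \<gamma> (\<alpha> + \<beta>) = frame_contraction p E \<gamma> \<alpha> + frame_contraction p E \<gamma> \<beta>"
  and frame_contraction_diff_right:
    "frame_contraction p E \<gamma> (\<alpha> - \<beta>) = frame_contraction p E \<gamma> \<alpha> - frame_contraction p E \<gamma> \<beta>"
  and frame_contraction_scale_left [simp]:
    "frame_contraction p E (c *\<^sub>t \<alpha>) \<gamma> = c *\<^sub>t frame_contraction p E \<alpha> \<gamma>"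
  and frame_contraction_scale_right [simp]:
    "frame_contraction p E \<gamma> (c *\<^sub>t \<alpha>) = c *\<^sub>t frame_contraction p E \<gamma> \<alpha>"
  and frame_contraction_zero_left [simp]: "frame_contraction p E 0 \<gamma> = 0"
  and frame_contraction_zero_right [simp]: "frame_contraction p E \<gamma> 0 = 0"
  by (simp_all add: frame_contraction_def wedge_add_left wedge_add_right wedge_diff_right sum.distrib
      sum_subtractf tscale_sum_right)

lemma frame_contraction_sum_right:
  "frame_contraction p E \<gamma> (\<Sum>i\<in>I. \<alpha> i) = (\<Sum>i\<in>I. frame_contraction p E \<gamma> (\<alpha> i))"
  unfolding frame_contraction_def contract_sum wedge_sum_right by (rule sum.swap)

lemma frame_contraction_commute:
  assumes "has_parity d \<alpha>" "has_parity d' \<beta>"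
  shows "frame_contraction p E \<beta> \<alpha> = (- 1) ^ (Suc d * Suc d') *\<^sub>t frame_contraction p E \<alpha> \<beta>"
  unfolding frame_contraction_def[of p E] tscale_sum_right
  by (rule sum.cong[OF HOL.refl], rule wedge_commute) (intro has_parity_contract assms)+

text \<open>
  The summands are squares of forms of odd degree.
\<close>
lemma frame_contraction_self_even:
  fixes \<alpha> :: "('e, real) tensor"
  assumes "has_parity d \<alpha>" "even d"
  shows "frame_contraction p E \<alpha> \<alpha> = 0"
  unfolding frame_contraction_def
  by (intro sum.neutral ballI wedge_self_odd[of "Suc d"] has_parity_contract assms)
     (use assms in simp)

lemma has_degree_frame_contraction:
  assumes "has_degree (Suc a) \<alpha>" "has_degree (Suc b) \<beta>"
  shows "has_degree (a + b) (frame_contraction p E \<alpha> \<beta>)"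
  unfolding frame_contraction_def
  by (intro has_degree_sum has_degree_wedge has_degree_contract assms)

section \<open>The exterior algebra of a transverse coframe\<close>

text \<open>
  The exterior algebra generated by \<open>e\<^sup>i\<close>, \<open>i < p\<close>, with real or complex coefficients.  The inductive
  definition reduces the properties of contractions to a check on one covector factor; alternation of
  the arguments is not part of it but a consequence (\<open>contract_anticommute\<close>).
\<close>
inductive transverse :: "nat \<Rightarrow> (nat \<Rightarrow> 'e \<Rightarrow> real) \<Rightarrow> ('e, 'f::real_field) tensor \<Rightarrow> bool"
  for p e where
  unit: "transverse p e one_form_unit"
| covector_wedge: "i < p \<Longrightarrow> transverse p e \<alpha>
    \<Longrightarrow> transverse p e (covector (\<lambda>v. of_real (e i v)) \<and>\<^sub>w \<alpha>)"
| add: "transverse p e \<alpha> \<Longrightarrow> transverse p e \<beta> \<Longrightarrow> transverse p e (\<alpha> + \<beta>)"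
| scale: "transverse p e \<alpha> \<Longrightarrow> transverse p e (c *\<^sub>t \<alpha>)"

lemma transverse_zero: "transverse p e 0"
  using transverse.scale[OF transverse.unit, of p e 0] by simp

lemma transverse_minus: "transverse p e \<alpha> \<Longrightarrow> transverse p e (- \<alpha>)"
  using transverse.scale[of p e \<alpha> "- 1"] by simp

lemma transverse_diff: "transverse p e \<alpha> \<Longrightarrow> transverse p e \<beta> \<Longrightarrow> transverse p e (\<alpha> - \<beta>)"
  using transverse.add[of p e \<alpha> "- \<beta>"] transverse_minus[of p e \<beta>] by simp

lemma transverse_sum:
  "(\<And>i. i \<in> I \<Longrightarrow> transverse p e (\<alpha> i)) \<Longrightarrow> transverse p e (\<Sum>i\<in>I. \<alpha> i)"
proof (induction I rule: infinite_finite_induct)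
  case (insert i I)
  then show ?case by (simp add: transverse.add)
qed (simp_all add: transverse_zero)

lemma transverse_covector: "i < p \<Longrightarrow> transverse p e (covector (\<lambda>v. of_real (e i v)))"
  using transverse.covector_wedge[OF _ transverse.unit] by fastforce

lemma transverse_covector_real: "i < p \<Longrightarrow> transverse p e (covector (e i))"
  using transverse_covector[where 'b = real] by fastforce

lemma transverse_wedge:
  assumes "transverse p e \<alpha>" "transverse p e \<beta>"
  shows "transverse p e (\<alpha> \<and>\<^sub>w \<beta>)"
  using assms by induction (simp_all add: wedge_assoc wedge_add_left transverse.intros)

lemma transverse_contract:
  assumes "transverse p e \<alpha>"
  shows "transverse p e (contract_vec v \<alpha>)"
  using assms
  by induction
     (simp_all add: contract_covector_wedge transverse.intros transverse_diff transverse_zero)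

lemma transverse_grade_inv:
  assumes "transverse p e \<alpha>"
  shows "transverse p e (grade_inv \<alpha>)"
  using assms
  by induction (simp_all add: transverse.intros transverse_minus)

lemma transverse_frame_contraction:
  assumes "transverse p e \<alpha>" "transverse p e \<beta>"
  shows "transverse p e (frame_contraction q E \<alpha> \<beta>)"
  unfolding frame_contraction_def
  by (intro transverse_sum transverse_wedge transverse_contract assms)

lemma contract_anticommute:
  assumes "transverse p e \<alpha>"
  shows "contract_vec u (contract_vec v \<alpha>) = - contract_vec v (contract_vec u \<alpha>)"
  using assms
proof induction
  case (covector_wedge i \<alpha>)
  then show ?case by (simp add: contract_covector_wedge)
next
  case (add \<alpha> \<beta>)
  then show ?case by (simp)
next
  case (scale \<alpha> c)
  then show ?case by (simp)
qed simp

lemma contract_eq_0: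
  assumes "transverse p e \<alpha>" "\<And>i. i < p \<Longrightarrow> e i v = 0"
  shows "contract_vec v \<alpha> = 0"
  using assms(1)
proof induction
  case (covector_wedge i \<alpha>)
  then show ?case by (simp only: contract_covector_wedge assms(2)) simp
next
  case (add \<alpha> \<beta>)
  then show ?case by (simp only: contract_add) simp
next
  case (scale \<alpha> c)
  then show ?case by (simp only: contract_scale) simp
qed simp

locale dual_frame =
  fixes p :: nat and e :: "nat \<Rightarrow> 'e \<Rightarrow> real" and E :: "nat \<Rightarrow> 'e"
  assumes dual: "i < p \<Longrightarrow> j < p \<Longrightarrow> e i (E j) = (if i = j then 1 else 0)"
begin

abbreviation C :: "('e, 'f::comm_ring_1) tensor \<Rightarrow> ('e, 'f) tensor \<Rightarrow> ('e, 'f) tensor" where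
  "C \<equiv> frame_contraction p E"

text \<open>
  Transverse forms see only the components of a vector along the frame.
\<close>
lemma contract_expand:
  assumes "transverse p e \<alpha>"
  shows "contract_vec v \<alpha> = (\<Sum>j<p. of_real (e j v) *\<^sub>t contract_vec (E j) \<alpha>)"
  using assms
proof induction
  case unit
  show ?case by simp
next
  case (covector_wedge i \<alpha>)
  let ?x = "covector (\<lambda>v. of_real (e i v))"
  have 1: "of_real (e i (E j)) *\<^sub>t \<alpha> = (if j = i then \<alpha> else 0)" if "j < p" for j
    using dual[OF covector_wedge.hyps(1) that] by (simp)
  have "(\<Sum>j<p. of_real (e j v) *\<^sub>t contract_vec (E j) (?x \<and>\<^sub>w \<alpha>)) =
    (\<Sum>j<p. of_real (e j v) *\<^sub>t (if j = i then \<alpha> else 0)) -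
    (\<Sum>j<p. of_real (e j v) *\<^sub>t (?x \<and>\<^sub>w contract_vec (E j) \<alpha>))"
    unfolding sum_subtractf[symmetric]
    by (intro sum.cong HOL.refl) (simp only: contract_covector_wedge 1 lessThan_iff tscale_diff_right)
  also have "(\<Sum>j<p. of_real (e j v) *\<^sub>t (if j = i then \<alpha> else 0)) =
    (\<Sum>j<p. if j = i then of_real (e i v) *\<^sub>t \<alpha> else 0)"
    by (intro sum.cong) auto
  also have "\<dots> = of_real (e i v) *\<^sub>t \<alpha>"
    using covector_wedge.hyps(1) by (subst sum.delta) auto
  also have "(\<Sum>j<p. of_real (e j v) *\<^sub>t (?x \<and>\<^sub>w contract_vec (E j) \<alpha>)) =
    ?x \<and>\<^sub>w (\<Sum>j<p. of_real (e j v) *\<^sub>t contract_vec (E j) \<alpha>)"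
    unfolding wedge_sum_right wedge_scale_right ..
  also have "\<dots> = ?x \<and>\<^sub>w contract_vec v \<alpha>"
    unfolding covector_wedge.IH[symmetric] ..
  finally show ?case by (simp add: contract_covector_wedge)
next
  case (add \<alpha> \<beta>)
  then show ?case by (simp only: contract_add tscale_add_right sum.distrib)
next
  case (scale \<alpha> c)
  then show ?case
    by (simp only: contract_scale tscale_sum_right tscale_tscale mult.commute)
qed

text \<open>
  The contraction of the volume form with \<open>E i\<close> is annihilated by \<open>e l\<close> for \<open>l \<noteq> i\<close>; hence it is
  divisible by \<open>e l\<close> and squares to zero, whatever its degree.  An index \<open>l\<close> exists as \<open>p \<ge> 2\<close>.
\<close>
lemma frame_contraction_volume:
  assumes "p \<ge> 2"
  defines "\<epsilon> \<equiv> wedge_list (map (\<lambda>i. covector (e i)) [0..<p])"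
  shows "C \<epsilon> \<epsilon> = 0"
  unfolding frame_contraction_def
proof (intro sum.neutral ballI)
  fix i assume "i \<in> {..<p}"
  define l where "l = (if i = 0 then 1 else 0 :: nat)"
  have l: "l < p" "l \<noteq> i" using assms(1) by (auto simp: l_def)
  have "covector (e l) \<and>\<^sub>w \<epsilon> = 0"
    unfolding \<epsilon>_def by (rule covector_wedge_list_index_eq_0) (use l in simp)
  then have "covector (e l) \<and>\<^sub>w contract_vec (E i) \<epsilon> = 0"
    using contract_covector_wedge[of "E i" "e l" \<epsilon>] dual[OF l(1), of i] l(2) \<open>i \<in> {..<p}\<close> by simp
  from wedge_eq_0_if_common_divisor[OF this this, of "E l"]
  show "contract_vec (E i) \<epsilon> \<and>\<^sub>w contract_vec (E i) \<epsilon> = 0"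
    by (simp add: dual l)
qed

lemma transverse_volume: "transverse p e (wedge_list (map (\<lambda>i. covector (e i)) [0..<p]) :: ('e, real) tensor)"
proof -
  have "set is \<subseteq> {..<p} \<Longrightarrow> transverse p e (wedge_list (map (\<lambda>i. covector (e i)) is))" for "is"
    by (induction "is") (auto intro: transverse.unit transverse_wedge transverse_covector_real)
  then show ?thesis by (simp add: lessThan_atLeast0)
qed

lemma volume_neq_0: "wedge_list (map (\<lambda>i. covector (e i)) [0..<p]) (map E [0..<p]) = 1"
  by (subst wedge_list_dual_vectors) (auto simp: dual intro!: prod.neutral)

end


section \<open>Hermitian forms\<close>

lemma sum_lessThan_double: "(\<Sum>i<2 * n. f i) = (\<Sum>a<n. f (2 * a) + f (2 * a + 1))"
  for f :: "nat \<Rightarrow> 'b::comm_monoid_add"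
  by (induction n) (simp_all add: add.assoc)

lemma sum_lessThan_quadruple:
  "(\<Sum>i<4 * n. f i) = (\<Sum>a<n. f (4 * a) + f (4 * a + 1) + f (4 * a + 2) + f (4 * a + 3))"
  for f :: "nat \<Rightarrow> 'b::comm_monoid_add"
  by (induction n) (simp_all add: add.assoc eval_nat_numeral)

lemma sum_if_eq: "a < n \<Longrightarrow> (\<Sum>b<n. if a = b then f b else 0) = f a"
  "a < n \<Longrightarrow> (\<Sum>b<n. if b = a then f b else 0) = f a"
  for f :: "nat \<Rightarrow> 'b::comm_monoid_add"
  by (simp_all add: sum.delta sum.delta')

lemma hermitian_form_complex_structure:
  "hermitian_form (complex_structure n) e =
     (\<Sum>a<n. covector (e (2 * a)) \<and>\<^sub>w covector (e (2 * a + 1)))"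
proof
  fix vs
  have entries: "complex_structure n $$ (2 * a, 2 * b) = 0"
    "complex_structure n $$ (2 * a, 2 * b + 1) = (if a = b then - 1 else 0)"
    "complex_structure n $$ (2 * a + 1, 2 * b) = (if a = b then 1 else 0)"
    "complex_structure n $$ (2 * a + 1, 2 * b + 1) = 0" if "a < n" "b < n" for a b
    using that by (auto simp: complex_structure_def realify_def)
  have "(\<Sum>i<2 * n. \<Sum>j<2 * n. complex_structure n $$ (i, j) * e j v * e i w) =
    (\<Sum>a<n. e (2 * a) v * e (2 * a + 1) w - e (2 * a) w * e (2 * a + 1) v)" for v w
  proof -
    have 1: "(\<Sum>j<2 * n. complex_structure n $$ (2 * a, j) * e j v * e (2 * a) w) =
      - e (2 * a + 1) v * e (2 * a) w" if "a < n" for a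
    proof -
      have "(\<Sum>j<2 * n. complex_structure n $$ (2 * a, j) * e j v * e (2 * a) w) =
        (\<Sum>b<n. if a = b then - e (2 * b + 1) v * e (2 * b) w else 0)"
        unfolding sum_lessThan_double
        by (rule sum.cong[OF HOL.refl]) (simp only: lessThan_iff entries[OF that], simp)
      then show ?thesis by (simp only: sum_if_eq(1)[OF that])
    qed
    have 2: "(\<Sum>j<2 * n. complex_structure n $$ (2 * a + 1, j) * e j v * e (2 * a + 1) w) =
      e (2 * a) v * e (2 * a + 1) w" if "a < n" for a
    proof -
      have "(\<Sum>j<2 * n. complex_structure n $$ (2 * a + 1, j) * e j v * e (2 * a + 1) w) =
        (\<Sum>b<n. if a = b then e (2 * b) v * e (2 * b + 1) w else 0)"
        unfolding sum_lessThan_double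
        by (rule sum.cong[OF HOL.refl]) (simp only: lessThan_iff entries[OF that], simp)
      then show ?thesis by (simp only: sum_if_eq(1)[OF that])
    qed
    show ?thesis
      by (subst sum_lessThan_double, rule sum.cong[OF HOL.refl]) (simp only: lessThan_iff 1 2, simp)
  qed
  then show "hermitian_form (complex_structure n) e vs =
      (\<Sum>a<n. covector (e (2 * a)) \<and>\<^sub>w covector (e (2 * a + 1))) vs"
    by (simp add: hermitian_form_def wedge_covector_covector sum_fun_apply bilin_def
        complex_structure_def realify_def)
qed

text \<open>
  The Hermitian form of the standard complex structure, with real or complex coefficients,
  so that it acts on real as well as on complex forms.
\<close>
definition kahler_form :: "nat \<Rightarrow> (nat \<Rightarrow> 'e \<Rightarrow> real) \<Rightarrow> ('e, 'f::real_field) tensor" where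
  "kahler_form n e = (\<Sum>a<n. covector (\<lambda>v. of_real (e (2 * a) v)) \<and>\<^sub>w
     covector (\<lambda>v. of_real (e (2 * a + 1) v)))"

lemma hermitian_form_eq_kahler_form: "hermitian_form (complex_structure n) e = kahler_form n e"
  by (simp add: hermitian_form_complex_structure kahler_form_def)

lemma has_degree_kahler_form: "has_degree 2 (kahler_form n e)"
  unfolding kahler_form_def
  using has_degree_wedge[OF has_degree_covector has_degree_covector]
  by (intro has_degree_sum) (simp add: numeral_2_eq_2)

lemma transverse_kahler_form: "2 * n \<le> p \<Longrightarrow> transverse p e (kahler_form n e)"
  unfolding kahler_form_def
  by (intro transverse_sum transverse_wedge transverse_covector) auto

context dual_frame
begin

abbreviation X :: "nat \<Rightarrow> ('e, 'f::real_field) tensor" where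
  "X i \<equiv> covector (\<lambda>v. of_real (e i v))"

lemma contract_kahler_form:
  assumes "2 * n \<le> p" "a < n"
  shows "contract_vec (E (2 * a)) (kahler_form n e :: ('e, 'f::real_field) tensor) = X (2 * a + 1)"
    and "contract_vec (E (2 * a + 1)) (kahler_form n e :: ('e, 'f) tensor) = - X (2 * a)"
proof -
  have "contract_vec (E (2 * a)) (kahler_form n e :: ('e, 'f) tensor) =
    (\<Sum>b<n. if a = b then X (2 * b + 1) else 0)"
    unfolding kahler_form_def contract_sum
    by (rule sum.cong[OF HOL.refl]) (use assms in \<open>auto simp: contract_covector_wedge dual\<close>)
  then show "contract_vec (E (2 * a)) (kahler_form n e :: ('e, 'f) tensor) = X (2 * a + 1)"
    by (simp only: sum_if_eq(1)[OF assms(2)])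
  have neq: "2 * b \<noteq> Suc (2 * a)" for a b :: nat by presburger
  have "contract_vec (E (2 * a + 1)) (kahler_form n e :: ('e, 'f) tensor) =
    (\<Sum>b<n. if a = b then - X (2 * b) else 0)"
    unfolding kahler_form_def contract_sum
    by (rule sum.cong[OF HOL.refl]) (use assms in \<open>auto simp: contract_covector_wedge dual neq\<close>)
  then show "contract_vec (E (2 * a + 1)) (kahler_form n e :: ('e, 'f) tensor) = - X (2 * a)"
    by (simp only: sum_if_eq(1)[OF assms(2)])
qed

lemma frame_contraction_kahler_form:
  assumes "p = 2 * n"
  shows "C (kahler_form n e) \<beta> =
    (\<Sum>a<n. X (2 * a + 1) \<and>\<^sub>w contract_vec (E (2 * a)) \<beta> - X (2 * a) \<and>\<^sub>w contract_vec (E (2 * a + 1)) \<beta>)"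
  unfolding frame_contraction_def assms sum_lessThan_double
  by (rule sum.cong[OF HOL.refl]) (use assms in \<open>simp add: contract_kahler_form del: add_Suc_right One_nat_def\<close>)

text \<open>
  The contractions of the two-form are covectors, which move past \<open>\<alpha>\<close> with the same sign as
  the contraction itself.
\<close>
lemma frame_contraction_kahler_form_wedge:
  assumes "p = 2 * n"
  shows "C (kahler_form n e) (\<alpha> \<and>\<^sub>w \<beta>) = C (kahler_form n e) \<alpha> \<and>\<^sub>w \<beta> + \<alpha> \<and>\<^sub>w C (kahler_form n e) \<beta>"
  unfolding frame_contraction_kahler_form[OF assms] wedge_sum_left wedge_sum_right sum.distrib[symmetric]
  by (rule sum.cong[OF HOL.refl])
     (simp add: contract_wedge wedge_add_right wedge_diff_left wedge_diff_right wedge_assoc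
       covector_wedge_swap[of \<alpha>])

lemma frame_contraction_kahler_form_self:
  "C (kahler_form n e) (kahler_form n e :: ('e, real) tensor) = 0"
  by (rule frame_contraction_self_even[OF has_parity_if_has_degree[OF has_degree_kahler_form]]) simp

lemma kahler_form_eval:
  assumes "2 * n \<le> p" "0 < n"
  shows "kahler_form n e [E 0, E 1] = (1 :: real)"
proof -
  have "kahler_form n e [E 0, E 1] = contract_vec (E (2 * 0)) (kahler_form n e) [E 1]"
    by (simp add: contract_vec_def)
  also have "\<dots> = (1 :: real)"
    unfolding contract_kahler_form(1)[OF assms] using assms by (simp add: covector_def dual)
  finally show ?thesis .
qed

end

section \<open>Complex forms\<close>

definition cplx :: "('e, real) tensor \<Rightarrow> ('e, complex) tensor" where
  "cplx \<alpha> vs = of_real (\<alpha> vs)"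

definition tcnj :: "('e, complex) tensor \<Rightarrow> ('e, complex) tensor" where
  "tcnj \<alpha> vs = cnj (\<alpha> vs)"

lemma cplx_wedge: "cplx (\<alpha> \<and>\<^sub>w \<beta>) = cplx \<alpha> \<and>\<^sub>w cplx \<beta>"
  and tcnj_wedge: "tcnj (\<gamma> \<and>\<^sub>w \<delta>) = tcnj \<gamma> \<and>\<^sub>w tcnj \<delta>"
  by (simp_all add: cplx_def tcnj_def wedge_def fun_eq_iff)

lemma cplx_contract: "cplx (contract_vec v \<alpha>) = contract_vec v (cplx \<alpha>)"
  and tcnj_contract: "tcnj (contract_vec v \<gamma>) = contract_vec v (tcnj \<gamma>)"
  by (simp_all add: cplx_def tcnj_def contract_vec_def fun_eq_iff)

lemma cplx_sum: "cplx (\<Sum>i\<in>I. \<alpha> i) = (\<Sum>i\<in>I. cplx (\<alpha> i))"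
  and tcnj_sum: "tcnj (\<Sum>i\<in>I. \<gamma> i) = (\<Sum>i\<in>I. tcnj (\<gamma> i))"
  by (simp_all add: cplx_def tcnj_def sum_fun_apply fun_eq_iff)

lemma cplx_frame_contraction:
    "cplx (frame_contraction p E \<alpha> \<beta>) = frame_contraction p E (cplx \<alpha>) (cplx \<beta>)"
  and tcnj_frame_contraction:
    "tcnj (frame_contraction p E \<gamma> \<delta>) = frame_contraction p E (tcnj \<gamma>) (tcnj \<delta>)"
  by (simp_all add: frame_contraction_def cplx_sum tcnj_sum cplx_wedge tcnj_wedge cplx_contract tcnj_contract)

lemma cplx_covector: "cplx (covector a) = covector (\<lambda>v. of_real (a v))"
  by (auto simp: cplx_def covector_def fun_eq_iff)

lemma tcnj_minus: "tcnj (- \<gamma>) = - tcnj \<gamma>"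
  by (simp add: tcnj_def fun_eq_iff pointwise)

lemma tcnj_scale: "tcnj (c *\<^sub>t \<gamma>) = cnj c *\<^sub>t tcnj \<gamma>"
  by (simp add: tcnj_def tscale_def fun_eq_iff)

lemma cplx_eq_0_iff: "cplx \<alpha> = 0 \<longleftrightarrow> \<alpha> = 0"
  by (simp add: cplx_def fun_eq_iff pointwise)

lemma cplx_eq_iff:
  "cplx \<alpha> + \<i> *\<^sub>t cplx \<beta> = cplx \<alpha>' + \<i> *\<^sub>t cplx \<beta>' \<longleftrightarrow> \<alpha> = \<alpha>' \<and> \<beta> = \<beta>'"
  by (auto simp: cplx_def tscale_def fun_eq_iff pointwise complex_eq_iff)

lemma Re_Im_split: "\<gamma> = cplx (\<lambda>vs. Re (\<gamma> vs)) + \<i> *\<^sub>t cplx (\<lambda>vs. Im (\<gamma> vs))"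
  and tcnj_split: "tcnj \<gamma> = cplx (\<lambda>vs. Re (\<gamma> vs)) - \<i> *\<^sub>t cplx (\<lambda>vs. Im (\<gamma> vs))"
  by (simp_all add: cplx_def tcnj_def tscale_def fun_eq_iff pointwise complex_eq_iff)

text \<open>
  The induction is over the stronger claim that \<open>\<gamma>\<close> splits into real transverse forms, since the
  real part of a complex multiple involves the imaginary part.
\<close>
lemma transverse_Re_Im:
  assumes "transverse p e \<gamma>"
  shows "transverse p e (\<lambda>vs. Re (\<gamma> vs))" "transverse p e (\<lambda>vs. Im (\<gamma> vs))"
proof -
  have "\<exists>\<alpha> \<beta>. transverse p e \<alpha> \<and> transverse p e \<beta> \<and> \<gamma> = cplx \<alpha> + \<i> *\<^sub>t cplx \<beta>"
    using assms
  proof induction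
    case unit
    have "one_form_unit = cplx one_form_unit + \<i> *\<^sub>t cplx (0 :: ('e, real) tensor)"
      by (auto simp: cplx_def tscale_def one_form_unit_def fun_eq_iff pointwise)
    then show ?case using transverse.unit transverse_zero by blast
  next
    case (covector_wedge i \<gamma>)
    then obtain \<alpha> \<beta> where *: "transverse p e \<alpha>" "transverse p e \<beta>" "\<gamma> = cplx \<alpha> + \<i> *\<^sub>t cplx \<beta>"
      by blast
    have "covector (\<lambda>v. of_real (e i v)) \<and>\<^sub>w \<gamma> =
      cplx (covector (e i) \<and>\<^sub>w \<alpha>) + \<i> *\<^sub>t cplx (covector (e i) \<and>\<^sub>w \<beta>)"
      by (simp add: * cplx_wedge cplx_covector wedge_add_right)
    then show ?case
      using transverse_wedge[OF transverse_covector_real[OF covector_wedge.hyps(1)]] * by metis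
  next
    case (add \<gamma> \<delta>)
    then obtain \<alpha> \<beta> \<alpha>' \<beta>' where *: "transverse p e \<alpha>" "transverse p e \<beta>" "\<gamma> = cplx \<alpha> + \<i> *\<^sub>t cplx \<beta>"
      "transverse p e \<alpha>'" "transverse p e \<beta>'" "\<delta> = cplx \<alpha>' + \<i> *\<^sub>t cplx \<beta>'"
      by blast
    have "\<gamma> + \<delta> = cplx (\<alpha> + \<alpha>') + \<i> *\<^sub>t cplx (\<beta> + \<beta>')"
      by (simp add: * cplx_def tscale_def fun_eq_iff pointwise algebra_simps)
    then show ?case using * transverse.add by metis
  next
    case (scale \<gamma> c)
    then obtain \<alpha> \<beta> where *: "transverse p e \<alpha>" "transverse p e \<beta>" "\<gamma> = cplx \<alpha> + \<i> *\<^sub>t cplx \<beta>"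
      by blast
    have "c *\<^sub>t \<gamma> = cplx (Re c *\<^sub>t \<alpha> - Im c *\<^sub>t \<beta>) + \<i> *\<^sub>t cplx (Re c *\<^sub>t \<beta> + Im c *\<^sub>t \<alpha>)"
      by (simp add: * cplx_def tscale_def fun_eq_iff pointwise complex_eq_iff algebra_simps)
    then show ?case using * transverse.add transverse_diff transverse.scale by metis
  qed
  then obtain \<alpha> \<beta> where *: "transverse p e \<alpha>" "transverse p e \<beta>" "\<gamma> = cplx \<alpha> + \<i> *\<^sub>t cplx \<beta>"
    by blast
  then have "(\<lambda>vs. Re (\<gamma> vs)) = \<alpha>" "(\<lambda>vs. Im (\<gamma> vs)) = \<beta>"
    by (auto simp: cplx_def tscale_def fun_eq_iff pointwise)
  with * show "transverse p e (\<lambda>vs. Re (\<gamma> vs))" "transverse p e (\<lambda>vs. Im (\<gamma> vs))" by auto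
qed

section \<open>The complex volume form\<close>

locale complex_dual_frame = dual_frame p e E
  for p e and E :: "nat \<Rightarrow> 'e" +
  fixes n :: nat
  assumes p_eq: "p = 2 * n"
begin

definition dz :: "nat \<Rightarrow> ('e, complex) tensor" where
  "dz a = covector (\<lambda>v. Complex (e (2 * a) v) (e (2 * a + 1) v))"

abbreviation \<Omega> :: "('e, complex) tensor" where "\<Omega> \<equiv> holomorphic_volume n e"

abbreviation \<omega> :: "('e, complex) tensor" where "\<omega> \<equiv> kahler_form n e"

definition Z :: "nat \<Rightarrow> ('e, complex) tensor" where
  "Z a = contract_vec (E (2 * a)) \<Omega>"

text \<open>
  This is, up to a constant factor, the power \<open>\<omega>\<^bsup>n-1\<^esup>\<close>.
\<close>
definition V :: "('e, complex) tensor" where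
  "V = (\<Sum>a<n. Z a \<and>\<^sub>w tcnj (Z a))"

text \<open>
  For \<open>s = \<i>\<close> the form is annihilated by all \<open>\<partial>/\<partial>cnj z\<^sub>a\<close>, that is, it is of type \<open>(k, 0)\<close>; for \<open>s = - \<i>\<close>
  it is of type \<open>(0, k)\<close>.
\<close>
definition of_complex_type :: "complex \<Rightarrow> ('e, complex) tensor \<Rightarrow> bool" where
  "of_complex_type s \<beta> \<longleftrightarrow> (\<forall>a<n. contract_vec (E (2 * a + 1)) \<beta> = s *\<^sub>t contract_vec (E (2 * a)) \<beta>)"

lemma dual2:
  assumes "a < n" "b < n"
  shows "e (2 * a) (E (2 * b)) = (if a = b then 1 else 0)"
    "e (2 * a + 1) (E (2 * b)) = 0" "e (2 * a) (E (2 * b + 1)) = 0"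
    "e (2 * a + 1) (E (2 * b + 1)) = (if a = b then 1 else 0)"
proof -
  have neq: "2 * b \<noteq> Suc (2 * a)" for a b :: nat by presburger
  show "e (2 * a) (E (2 * b)) = (if a = b then 1 else 0)"
    "e (2 * a + 1) (E (2 * b)) = 0" "e (2 * a) (E (2 * b + 1)) = 0"
    "e (2 * a + 1) (E (2 * b + 1)) = (if a = b then 1 else 0)"
    using assms p_eq by (auto simp: dual neq neq[symmetric])
qed

lemma \<Omega>_eq: "\<Omega> = wedge_list (map dz [0..<n])"
  by (simp add: holomorphic_volume_def dz_def[abs_def])

lemma dz_eq: "dz a = X (2 * a) + \<i> *\<^sub>t X (2 * a + 1)"
  by (auto simp: dz_def covector_def tscale_def fun_eq_iff pointwise complex_eq_iff)

lemma contract_dz_wedge: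
  assumes "a < n" "b < n"
  shows "contract_vec (E (2 * b)) (dz a \<and>\<^sub>w \<beta>) =
      (if a = b then \<beta> else 0) - dz a \<and>\<^sub>w contract_vec (E (2 * b)) \<beta>"
    and "contract_vec (E (2 * b + 1)) (dz a \<and>\<^sub>w \<beta>) =
      (if a = b then \<i> *\<^sub>t \<beta> else 0) - dz a \<and>\<^sub>w contract_vec (E (2 * b + 1)) \<beta>"
proof -
  have "Complex 1 0 = 1" "Complex 0 1 = \<i>" "Complex 0 0 = 0" by (simp_all add: complex_eq_iff)
  then show "contract_vec (E (2 * b)) (dz a \<and>\<^sub>w \<beta>) =
      (if a = b then \<beta> else 0) - dz a \<and>\<^sub>w contract_vec (E (2 * b)) \<beta>"
    "contract_vec (E (2 * b + 1)) (dz a \<and>\<^sub>w \<beta>) =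
      (if a = b then \<i> *\<^sub>t \<beta> else 0) - dz a \<and>\<^sub>w contract_vec (E (2 * b + 1)) \<beta>"
    unfolding dz_def contract_covector_wedge dual2[OF assms] by (auto simp del: One_nat_def add_Suc_right)
qed

lemma transverse_dz_list: "set as \<subseteq> {..<n} \<Longrightarrow> transverse p e (wedge_list (map dz as))"
proof (induction as)
  case (Cons a as)
  then have "transverse p e (dz a)"
    unfolding dz_eq by (intro transverse.add transverse.scale transverse_covector) (auto simp: p_eq)
  with Cons show ?case by (simp add: transverse_wedge)
qed (simp add: transverse.unit)

lemma transverse_\<Omega>: "transverse p e \<Omega>"
  unfolding \<Omega>_eq by (rule transverse_dz_list) auto

lemma of_complex_type_dz_list: "set as \<subseteq> {..<n} \<Longrightarrow> of_complex_type \<i> (wedge_list (map dz as))"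
proof (induction as)
  case (Cons a as)
  then show ?case
    unfolding of_complex_type_def list.map wedge_list_Cons
    by (auto simp: contract_dz_wedge tscale_diff_right simp del: One_nat_def add_Suc_right)
qed (simp add: of_complex_type_def)

lemma of_complex_type_\<Omega>: "of_complex_type \<i> \<Omega>"
  unfolding \<Omega>_eq by (rule of_complex_type_dz_list) auto

lemma of_complex_type_contract:
  assumes "of_complex_type s \<beta>" "transverse p e \<beta>"
  shows "of_complex_type s (contract_vec v \<beta>)"
  unfolding of_complex_type_def
proof (intro allI impI)
  fix a assume "a < n"
  then show "contract_vec (E (2 * a + 1)) (contract_vec v \<beta>) =
    s *\<^sub>t contract_vec (E (2 * a)) (contract_vec v \<beta>)"
    using assms(1) unfolding of_complex_type_def contract_anticommute[OF assms(2), of _ v] by simp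
qed

lemma of_complex_type_tcnj: "of_complex_type s \<beta> \<Longrightarrow> of_complex_type (cnj s) (tcnj \<beta>)"
  by (simp add: of_complex_type_def tcnj_scale flip: tcnj_contract)

lemma of_complex_type_Z: "of_complex_type \<i> (Z a)"
  unfolding Z_def by (rule of_complex_type_contract[OF of_complex_type_\<Omega> transverse_\<Omega>])

lemma dz_wedge_\<Omega>: "a < n \<Longrightarrow> dz a \<and>\<^sub>w \<Omega> = 0"
  unfolding \<Omega>_eq dz_def by (rule covector_wedge_list_index_eq_0) simp

lemma dz_wedge_Z:
  assumes "a < n" "b < n"
  shows "dz a \<and>\<^sub>w Z b = (if a = b then \<Omega> else 0)"
  using contract_dz_wedge(1)[OF assms, of \<Omega>] by (simp add: dz_wedge_\<Omega>[OF assms(1)] Z_def)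

text \<open>
  On forms of type \<open>(k, 0)\<close>, the contraction with \<open>\<omega>\<close> is \<open>- \<i>\<close> times the Euler operator that counts
  the factors \<open>dz\<^sub>a\<close>.
\<close>
lemma frame_contraction_\<omega>_of_complex_type:
  assumes "of_complex_type \<i> \<beta>"
  shows "C \<omega> \<beta> = (- \<i>) *\<^sub>t (\<Sum>a<n. dz a \<and>\<^sub>w contract_vec (E (2 * a)) \<beta>)"
  unfolding frame_contraction_kahler_form[OF p_eq] tscale_sum_right
proof (rule sum.cong[OF HOL.refl])
  fix a assume "a \<in> {..<n}"
  then have "contract_vec (E (2 * a + 1)) \<beta> = \<i> *\<^sub>t contract_vec (E (2 * a)) \<beta>"
    using assms by (simp add: of_complex_type_def)
  then show "X (2 * a + 1) \<and>\<^sub>w contract_vec (E (2 * a)) \<beta> - X (2 * a) \<and>\<^sub>w contract_vec (E (2 * a + 1)) \<beta> =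
    (- \<i>) *\<^sub>t (dz a \<and>\<^sub>w contract_vec (E (2 * a)) \<beta>)"
    by (simp add: dz_eq wedge_add_left tscale_add_right del: One_nat_def add_Suc_right)
qed

lemma tscale_of_nat_sum: "(\<Sum>a<m. \<alpha>) = of_nat m *\<^sub>t \<alpha>"
  by (induction m) (simp_all add: tscale_add_left add.commute del: sum_constant)

lemma frame_contraction_\<omega>_\<Omega>: "C \<omega> \<Omega> = (- \<i> * of_nat n) *\<^sub>t \<Omega>"
proof -
  have "(\<Sum>a<n. dz a \<and>\<^sub>w contract_vec (E (2 * a)) \<Omega>) = (\<Sum>a<n. \<Omega>)"
    by (rule sum.cong[OF HOL.refl]) (simp add: dz_wedge_Z flip: Z_def)
  then show ?thesis
    unfolding frame_contraction_\<omega>_of_complex_type[OF of_complex_type_\<Omega>] by (simp add: tscale_of_nat_sum del: sum_constant)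
qed

text \<open>
  \<open>Z a\<close> has all factors of \<open>\<Omega>\<close> but \<open>dz\<^sub>a\<close>, so the Euler operator counts \<open>n - 1\<close>.
\<close>
lemma frame_contraction_\<omega>_Z:
  assumes "a < n"
  shows "C \<omega> (Z a) = (- \<i> * (of_nat n - 1)) *\<^sub>t Z a"
proof -
  have "dz b \<and>\<^sub>w contract_vec (E (2 * b)) (Z a) = Z a - (if b = a then Z b else 0)" if "b < n" for b
  proof -
    have "dz b \<and>\<^sub>w contract_vec (E (2 * b)) (Z a) = - (dz b \<and>\<^sub>w contract_vec (E (2 * a)) (Z b))"
      unfolding Z_def contract_anticommute[OF transverse_\<Omega>, of "E (2 * b)"] by simp
    also have "\<dots> = contract_vec (E (2 * a)) (dz b \<and>\<^sub>w Z b) - (if b = a then Z b else 0)"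
      unfolding contract_dz_wedge(1)[OF that assms] by simp
    finally show ?thesis using dz_wedge_Z[OF that that] by (simp add: Z_def)
  qed
  then have "(\<Sum>b<n. dz b \<and>\<^sub>w contract_vec (E (2 * b)) (Z a)) = (\<Sum>b<n. Z a - (if b = a then Z b else 0))"
    by (intro sum.cong HOL.refl) auto
  also have "\<dots> = (of_nat n - 1) *\<^sub>t Z a"
    unfolding sum_subtractf sum_if_eq(2)[OF assms] tscale_of_nat_sum
    using tscale_add_left[of "of_nat n - 1" 1 "Z a"] by simp
  finally show ?thesis
    unfolding frame_contraction_\<omega>_of_complex_type[OF of_complex_type_Z] by simp
qed

lemma tcnj_\<omega>: "tcnj \<omega> = \<omega>"
proof -
  have "tcnj (X i) = X i" for i by (auto simp: tcnj_def covector_def fun_eq_iff)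
  then show ?thesis by (simp add: kahler_form_def tcnj_sum tcnj_wedge)
qed

text \<open>
  By the derivation property, the eigenvalues \<open>\<plusminus> \<i> (n - 1)\<close> of \<open>Z a\<close> and its conjugate add up to
  zero.
\<close>
lemma frame_contraction_\<omega>_V: "C \<omega> V = 0"
proof -
  have "C \<omega> (tcnj (Z a)) = (\<i> * (of_nat n - 1)) *\<^sub>t tcnj (Z a)" if "a < n" for a
    using arg_cong[OF frame_contraction_\<omega>_Z[OF that], of tcnj]
    by (simp add: tcnj_frame_contraction tcnj_\<omega> tcnj_scale tcnj_minus)
  then show ?thesis
    unfolding V_def frame_contraction_sum_right frame_contraction_kahler_form_wedge[OF p_eq]
    by (intro sum.neutral) (auto simp: frame_contraction_\<omega>_Z)
qed

lemma frame_contraction_\<Omega>: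
  "C \<Omega> \<beta> = (\<Sum>a<n. Z a \<and>\<^sub>w (contract_vec (E (2 * a)) \<beta> + \<i> *\<^sub>t contract_vec (E (2 * a + 1)) \<beta>))"
  unfolding frame_contraction_def p_eq sum_lessThan_double
  by (rule sum.cong[OF HOL.refl])
     (use of_complex_type_\<Omega> in \<open>simp add: of_complex_type_def wedge_add_right Z_def del: One_nat_def add_Suc_right\<close>)

text \<open>
  The frame pairs \<open>\<partial>/\<partial>z\<^sub>a\<close> with \<open>\<partial>/\<partial>cnj z\<^sub>a\<close>, and the latter annihilates \<open>\<Omega>\<close>.
\<close>
lemma frame_contraction_\<Omega>_\<Omega>: "C \<Omega> \<Omega> = 0"
  unfolding frame_contraction_\<Omega>
  by (intro sum.neutral) (use of_complex_type_\<Omega> in \<open>simp add: of_complex_type_def del: One_nat_def add_Suc_right\<close>)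

lemma frame_contraction_\<Omega>_tcnj_\<Omega>: "C \<Omega> (tcnj \<Omega>) = 2 *\<^sub>t V"
  unfolding frame_contraction_\<Omega> V_def tscale_sum_right
proof (rule sum.cong[OF HOL.refl])
  fix a assume "a \<in> {..<n}"
  then have "contract_vec (E (2 * a + 1)) (tcnj \<Omega>) = (- \<i>) *\<^sub>t tcnj (Z a)"
    using of_complex_type_tcnj[OF of_complex_type_\<Omega>] by (simp add: of_complex_type_def Z_def tcnj_contract del: One_nat_def add_Suc_right)
  then have "contract_vec (E (2 * a)) (tcnj \<Omega>) + \<i> *\<^sub>t contract_vec (E (2 * a + 1)) (tcnj \<Omega>) =
    2 *\<^sub>t tcnj (Z a)"
    by (simp add: Z_def tcnj_contract fun_eq_iff pointwise tscale_def del: One_nat_def add_Suc_right)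
  then show "Z a \<and>\<^sub>w (contract_vec (E (2 * a)) (tcnj \<Omega>) + \<i> *\<^sub>t contract_vec (E (2 * a + 1)) (tcnj \<Omega>)) =
    2 *\<^sub>t (Z a \<and>\<^sub>w tcnj (Z a))"
    by simp
qed

lemma has_degree_\<Omega>: "has_degree n \<Omega>"
  using has_degree_wedge_list[of "[0..<n]"] by (simp add: \<Omega>_eq dz_def[abs_def])

text \<open>
  For \<open>n \<ge> 3\<close> there is an index \<open>c\<close> other than \<open>a\<close> and \<open>b\<close>, and \<open>dz\<^sub>c\<close> divides both factors.
\<close>
lemma Z_wedge_Z:
  assumes "n \<ge> 3" "a < n" "b < n"
  shows "Z a \<and>\<^sub>w Z b = 0"
proof -
  define c where "c = (if a \<noteq> 0 \<and> b \<noteq> 0 then 0 else if a \<noteq> 1 \<and> b \<noteq> 1 then 1 else 2 :: nat)"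
  have c: "c < n" "c \<noteq> a" "c \<noteq> b" using assms(1) by (auto simp: c_def)
  have "dz c \<and>\<^sub>w Z a = 0" "dz c \<and>\<^sub>w Z b = 0"
    using dz_wedge_Z[OF c(1)] c assms by auto
  moreover have "Complex (e (2 * c) (E (2 * c))) (e (2 * c + 1) (E (2 * c))) = 1"
    unfolding dual2[OF c(1) c(1)] by (simp add: complex_eq_iff)
  ultimately show ?thesis
    unfolding dz_def by (rule wedge_eq_0_if_common_divisor)
qed

text \<open>
  Only \<open>\<partial>/\<partial>cnj z\<^sub>a\<close> acts on \<open>V\<close>; it passes \<open>Z b\<close> and acts on its conjugate, so every term contains
  \<open>Z a \<and> Z b\<close>.
\<close>
lemma frame_contraction_\<Omega>_V:
  assumes "n \<ge> 3"
  shows "C \<Omega> V = 0"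
  unfolding frame_contraction_\<Omega>
proof (intro sum.neutral ballI)
  fix a assume "a \<in> {..<n}"
  then have a: "a < n" by simp
  have par: "grade_inv (Z b) = (- 1) ^ Suc n *\<^sub>t Z b" for b
    using has_parity_contract[OF has_parity_if_has_degree[OF has_degree_\<Omega>]]
    unfolding Z_def has_parity_def by blast
  have "Z a \<and>\<^sub>w (contract_vec (E (2 * a)) (Z b \<and>\<^sub>w tcnj (Z b)) +
      \<i> *\<^sub>t contract_vec (E (2 * a + 1)) (Z b \<and>\<^sub>w tcnj (Z b))) = 0" if b: "b < n" for b
  proof -
    have 1: "contract_vec (E (2 * a + 1)) (Z b) = \<i> *\<^sub>t contract_vec (E (2 * a)) (Z b)"
      using of_complex_type_Z[of b] a by (simp add: of_complex_type_def)
    have "Z a \<and>\<^sub>w grade_inv (Z b) \<and>\<^sub>w \<gamma> = 0" for \<gamma>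
      using Z_wedge_Z[OF assms a b] by (simp add: par flip: wedge_assoc)
    then show ?thesis
      unfolding contract_wedge 1 by (simp add: wedge_add_right tscale_add_right)
  qed
  then show "Z a \<and>\<^sub>w (contract_vec (E (2 * a)) V + \<i> *\<^sub>t contract_vec (E (2 * a + 1)) V) = 0"
    unfolding V_def contract_sum tscale_sum_right sum.distrib[symmetric] wedge_sum_right
    by (intro sum.neutral) auto
qed

text \<open>
  The operator \<open>\<partial>/\<partial>z\<^sub>a\<close> annihilates \<open>\<beta>\<close>, so it can be used to strip off the factors \<open>dz\<^sub>a\<close> one by one.
\<close>
lemma wedge_of_complex_type_cancel:
  assumes "distinct as" "set as \<subseteq> {..<n}" "of_complex_type (- \<i>) \<beta>"
    "wedge_list (map dz as) \<and>\<^sub>w \<beta> = 0"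
  shows "\<beta> = 0"
  using assms(1,2,4)
proof (induction as)
  case Nil
  then show ?case by simp
next
  case (Cons a as)
  define Y where "Y = wedge_list (map dz as) \<and>\<^sub>w \<beta>"
  have a: "a < n" "a \<notin> set as" "set as \<subseteq> {..<n}" using Cons.prems by auto
  have "Complex (e (2 * b) (E (2 * a))) (e (2 * b + 1) (E (2 * a))) = 0"
    "Complex (e (2 * b) (E (2 * a + 1))) (e (2 * b + 1) (E (2 * a + 1))) = 0" if "b \<in> set as" for b
    using dual2[of b a] that a by (auto simp: complex_eq_iff)
  then have "contract_vec (E (2 * a)) (wedge_list (map dz as)) = 0"
    "contract_vec (E (2 * a + 1)) (wedge_list (map dz as)) = 0"
    unfolding dz_def by (intro contract_wedge_list_eq_0, blast)+
  then have Y: "contract_vec (E (2 * a + 1)) Y = (- \<i>) *\<^sub>t contract_vec (E (2 * a)) Y"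
    using assms(3) a(1) unfolding Y_def contract_wedge by (simp add: of_complex_type_def)
  \<comment> \<open>Contracting \<open>dz\<^sub>a \<and> Y = 0\<close> with \<open>E (2 a)\<close> and \<open>E (2 a + 1)\<close> gives two values for \<open>Y\<close>, which
    differ by a sign as \<open>Y\<close> is of type \<open>- \<i>\<close> in this direction.\<close>
  have "dz a \<and>\<^sub>w Y = 0" using Cons.prems(3) by (simp add: Y_def wedge_assoc)
  then have "Y - dz a \<and>\<^sub>w contract_vec (E (2 * a)) Y = 0"
    "\<i> *\<^sub>t Y - dz a \<and>\<^sub>w contract_vec (E (2 * a + 1)) Y = 0"
    using contract_dz_wedge[OF a(1) a(1), of Y] by simp_all
  then have "Y = dz a \<and>\<^sub>w contract_vec (E (2 * a)) Y" "\<i> *\<^sub>t Y = - (\<i> *\<^sub>t (dz a \<and>\<^sub>w contract_vec (E (2 * a)) Y))"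
    by (simp_all add: Y del: One_nat_def add_Suc_right)
  then have "\<i> *\<^sub>t Y = - (\<i> *\<^sub>t Y)" by simp
  then have "Y = 0" by (simp add: fun_eq_iff pointwise tscale_def eq_neg_iff_add_eq_0)
  with Cons.IH Cons.prems show ?case by (simp add: Y_def)
qed

text \<open>
  Rotating one argument from \<open>\<partial>/\<partial>x\<^sub>0\<close> to \<open>\<partial>/\<partial>y\<^sub>0\<close> multiplies the value by \<open>\<i>\<close>; this separates the real from
  the imaginary part of \<open>\<Omega>\<close>.
\<close>
lemma \<Omega>_eval:
  assumes "0 < n"
  shows "\<Omega> (map (\<lambda>a. E (2 * a)) [0..<n]) = 1"
    "\<Omega> (map (\<lambda>a. if a = 0 then E 1 else E (2 * a)) [0..<n]) = \<i>"
proof -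
  have *: "\<Omega> (map v [0..<n]) = (\<Prod>a<n. Complex (e (2 * a) (v a)) (e (2 * a + 1) (v a)))"
    if "\<And>a. a < n \<Longrightarrow> v a = E (2 * a) \<or> v a = E (2 * a + 1)" for v
  proof -
    have "Complex (e (2 * a) (v b)) (e (2 * a + 1) (v b)) = 0" if "a < n" "b < n" "a \<noteq> b" for a b
      using \<open>\<And>a. a < n \<Longrightarrow> v a = E (2 * a) \<or> v a = E (2 * a + 1)\<close>[OF that(2)] dual2[OF that(1,2)] that(3)
      by (auto simp: complex_eq_iff)
    then show ?thesis
      unfolding \<Omega>_eq dz_def by (subst wedge_list_dual_vectors) (auto simp: lessThan_atLeast0)
  qed
  have "\<Omega> (map (\<lambda>a. E (2 * a)) [0..<n]) = (\<Prod>a<n. 1)"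
    by (subst *, simp, rule prod.cong) (auto simp: complex_eq_iff dual2[unfolded One_nat_def add_Suc_right add_0_right])
  then show "\<Omega> (map (\<lambda>a. E (2 * a)) [0..<n]) = 1" by simp
  have "\<Omega> (map (\<lambda>a. if a = 0 then E 1 else E (2 * a)) [0..<n]) = (\<Prod>a<n. if a = 0 then \<i> else 1)"
    using dual2[of 0 0] assms
    by (subst *, simp, intro prod.cong)
       (auto simp: complex_eq_iff dual2[unfolded One_nat_def add_Suc_right add_0_right])
  also have "\<dots> = \<i>" using assms by (simp add: prod.delta)
  finally show "\<Omega> (map (\<lambda>a. if a = 0 then E 1 else E (2 * a)) [0..<n]) = \<i>" .
qed

text \<open>
  Multiplication with \<open>dz\<^sub>0\<close> and its conjugate singles out the summand of \<open>V\<close> with index \<open>0\<close> and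
  completes it to \<open>\<plusminus> \<Omega> \<and> cnj \<Omega>\<close>, from which the factors of \<open>\<Omega>\<close> can be cancelled.
\<close>
lemma V_neq_0:
  assumes "0 < n"
  shows "V \<noteq> 0"
proof
  assume "V = 0"
  have "dz 0 \<and>\<^sub>w V = (\<Sum>a<n. if 0 = a then \<Omega> \<and>\<^sub>w tcnj (Z a) else 0)"
    unfolding V_def wedge_sum_right
    by (rule sum.cong[OF HOL.refl]) (use assms in \<open>auto simp: dz_wedge_Z simp flip: wedge_assoc\<close>)
  then have "\<Omega> \<and>\<^sub>w tcnj (Z 0) = 0"
    unfolding sum_if_eq(1)[OF assms] by (simp add: \<open>V = 0\<close>)
  then have "0 = (\<Omega> \<and>\<^sub>w tcnj (Z 0)) \<and>\<^sub>w tcnj (dz 0)" by simp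
  also have "tcnj (dz 0) = covector (\<lambda>v. cnj (Complex (e (2 * 0) v) (e (2 * 0 + 1) v)))"
    by (auto simp: tcnj_def dz_def covector_def fun_eq_iff)
  also have "(\<Omega> \<and>\<^sub>w tcnj (Z 0)) \<and>\<^sub>w \<dots> = \<Omega> \<and>\<^sub>w \<dots> \<and>\<^sub>w grade_inv (tcnj (Z 0))"
    by (simp only: wedge_assoc wedge_covector_right[of "tcnj (Z 0)"])
  also have "grade_inv (tcnj (Z 0)) = (- 1) ^ Suc n *\<^sub>t tcnj (Z 0)"
  proof -
    have "has_degree n (tcnj \<Omega>)" using has_degree_\<Omega> by (simp add: has_degree_def tcnj_def)
    then show ?thesis
      using has_parity_contract[OF has_parity_if_has_degree] by (auto simp: has_parity_def Z_def tcnj_contract)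
  qed
  also have "covector (\<lambda>v. cnj (Complex (e (2 * 0) v) (e (2 * 0 + 1) v))) = tcnj (dz 0)"
    by (auto simp: tcnj_def dz_def covector_def fun_eq_iff)
  also have "\<Omega> \<and>\<^sub>w tcnj (dz 0) \<and>\<^sub>w (- 1) ^ Suc n *\<^sub>t tcnj (Z 0) = (- 1) ^ Suc n *\<^sub>t (\<Omega> \<and>\<^sub>w tcnj \<Omega>)"
    using dz_wedge_Z[OF assms assms] by (simp flip: tcnj_wedge)
  finally have "\<Omega> \<and>\<^sub>w tcnj \<Omega> = 0"
    by (auto simp: fun_eq_iff pointwise tscale_def)
  then have "tcnj \<Omega> = 0"
    using wedge_of_complex_type_cancel[of "[0..<n]" "tcnj \<Omega>"] of_complex_type_tcnj[OF of_complex_type_\<Omega>]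
    by (auto simp: \<Omega>_eq atLeast0LessThan)
  then have "cnj (\<Omega> (map (\<lambda>a. E (2 * a)) [0..<n])) = 0"
    by (auto simp: tcnj_def fun_eq_iff pointwise)
  then show False by (simp add: \<Omega>_eval[OF assms])
qed

end


section \<open>Products of the special unitary forms\<close>

lemma cplx_zero: "cplx 0 = 0"
  by (simp add: cplx_eq_0_iff)

context complex_dual_frame
begin

definition \<chi>1 :: "('e, real) tensor" where "\<chi>1 = (\<lambda>vs. Re (\<Omega> vs))"
definition \<chi>2 :: "('e, real) tensor" where "\<chi>2 = (\<lambda>vs. Im (\<Omega> vs))"

abbreviation \<omega>\<^sub>R :: "('e, real) tensor" where "\<omega>\<^sub>R \<equiv> kahler_form n e"

lemma \<Omega>_split: "\<Omega> = cplx \<chi>1 + \<i> *\<^sub>t cplx \<chi>2"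
  unfolding \<chi>1_def \<chi>2_def by (rule Re_Im_split)

lemma tcnj_\<Omega>_split: "tcnj \<Omega> = cplx \<chi>1 - \<i> *\<^sub>t cplx \<chi>2"
  unfolding \<chi>1_def \<chi>2_def by (rule tcnj_split)

lemma transverse_\<chi>: "transverse p e \<chi>1" "transverse p e \<chi>2"
  unfolding \<chi>1_def \<chi>2_def by (rule transverse_Re_Im[OF transverse_\<Omega>])+

lemma has_degree_\<chi>: "has_degree n \<chi>1" "has_degree n \<chi>2"
  using has_degree_\<Omega> by (simp_all add: has_degree_def \<chi>1_def \<chi>2_def)

lemma cplx_kahler_form: "cplx \<omega>\<^sub>R = \<omega>"
  by (simp add: kahler_form_def cplx_sum cplx_wedge cplx_covector)

lemma frame_contraction_\<omega>_\<chi>: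
  "C \<omega>\<^sub>R \<chi>1 = of_nat n *\<^sub>t \<chi>2" "C \<omega>\<^sub>R \<chi>2 = - (of_nat n *\<^sub>t \<chi>1)"
proof -
  have "cplx (C \<omega>\<^sub>R \<chi>1) + \<i> *\<^sub>t cplx (C \<omega>\<^sub>R \<chi>2) = C \<omega> \<Omega>"
    by (simp add: \<Omega>_split frame_contraction_add_right cplx_frame_contraction cplx_kahler_form)
  also have "\<dots> = cplx (of_nat n *\<^sub>t \<chi>2) + \<i> *\<^sub>t cplx (- (of_nat n *\<^sub>t \<chi>1))"
    unfolding frame_contraction_\<omega>_\<Omega> by (subst \<Omega>_split)
      (simp add: cplx_def fun_eq_iff pointwise tscale_def complex_eq_iff)
  finally show "C \<omega>\<^sub>R \<chi>1 = of_nat n *\<^sub>t \<chi>2" "C \<omega>\<^sub>R \<chi>2 = - (of_nat n *\<^sub>t \<chi>1)"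
    unfolding cplx_eq_iff by auto
qed

text \<open>
  The real and the imaginary part of \<open>C \<Omega> \<Omega> = 0\<close>.
\<close>
lemma frame_contraction_\<chi>_\<chi>:
  "C \<chi>2 \<chi>2 = C \<chi>1 \<chi>1" "C \<chi>2 \<chi>1 = - C \<chi>1 \<chi>2"
proof -
  have "cplx (C \<chi>1 \<chi>1 - C \<chi>2 \<chi>2) + \<i> *\<^sub>t cplx (C \<chi>1 \<chi>2 + C \<chi>2 \<chi>1) = C \<Omega> \<Omega>"
    unfolding \<Omega>_split frame_contraction_add_right frame_contraction_add_left
      frame_contraction_scale_left frame_contraction_scale_right
    by (simp add: fun_eq_iff pointwise tscale_def complex_eq_iff cplx_def flip: cplx_frame_contraction)
  also have "\<dots> = cplx 0 + \<i> *\<^sub>t cplx 0"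
    by (simp add: frame_contraction_\<Omega>_\<Omega> cplx_zero)
  finally show "C \<chi>2 \<chi>2 = C \<chi>1 \<chi>1" "C \<chi>2 \<chi>1 = - C \<chi>1 \<chi>2"
    unfolding cplx_eq_iff by (auto simp: eq_neg_iff_add_eq_0 add.commute)
qed

text \<open>
  The contraction of \<open>\<Omega>\<close> with its conjugate, in terms of real and imaginary parts.  Either the first or
  the second term is zero, according to the parity of \<open>n\<close>.
\<close>
lemma V_eq: "V = cplx (C \<chi>1 \<chi>1) - \<i> *\<^sub>t cplx (C \<chi>1 \<chi>2)"
proof -
  have "2 *\<^sub>t V = 2 *\<^sub>t (cplx (C \<chi>1 \<chi>1) - \<i> *\<^sub>t cplx (C \<chi>1 \<chi>2))"
    unfolding frame_contraction_\<Omega>_tcnj_\<Omega>[symmetric] tcnj_\<Omega>_split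
    unfolding \<Omega>_split frame_contraction_diff_right frame_contraction_add_left
      frame_contraction_scale_left frame_contraction_scale_right cplx_frame_contraction[symmetric]
      frame_contraction_\<chi>_\<chi>
    by (simp add: fun_eq_iff pointwise tscale_def complex_eq_iff cplx_def)
  then show ?thesis by (simp add: fun_eq_iff tscale_def)
qed

lemma frame_contraction_multiple_V:
  assumes "n \<ge> 3" "cplx W = c *\<^sub>t V" "c \<noteq> 0"
  shows "W \<noteq> 0" "C \<omega>\<^sub>R W = 0" "C \<chi>1 W = 0" "C \<chi>2 W = 0"
proof -
  show "W \<noteq> 0"
  proof
    assume "W = 0"
    then have "c *\<^sub>t V = 0" using assms(2) cplx_eq_0_iff by metis
    then have "V = 0" using assms(3) by (simp add: fun_eq_iff tscale_def pointwise)
    then show False using V_neq_0 assms(1) by simp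
  qed
  have "cplx (C \<omega>\<^sub>R W) = 0"
    unfolding cplx_frame_contraction cplx_kahler_form assms(2) by (simp add: frame_contraction_\<omega>_V)
  then show "C \<omega>\<^sub>R W = 0" by (simp add: cplx_eq_0_iff)
  have "cplx (C \<chi>1 W) + \<i> *\<^sub>t cplx (C \<chi>2 W) = C \<Omega> (cplx W)"
    by (simp add: \<Omega>_split frame_contraction_add_left cplx_frame_contraction)
  also have "\<dots> = cplx 0 + \<i> *\<^sub>t cplx 0"
    unfolding assms(2) using frame_contraction_\<Omega>_V[OF assms(1)] by (simp add: cplx_zero)
  finally show "C \<chi>1 W = 0" "C \<chi>2 W = 0"
    unfolding cplx_eq_iff by auto
qed

text \<open>
  The central element.  The sign in the odd case comes from that of the bracket of two odd
  elements.
\<close>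
definition W :: "('e, real) tensor" where
  "W = (if even n then C \<chi>1 \<chi>2 else - C \<chi>1 \<chi>1)"

lemma transverse_W: "transverse p e W"
  by (simp add: W_def transverse_frame_contraction transverse_\<chi> transverse_minus)

lemma frame_contraction_\<chi>_even:
  assumes "even n"
  shows "C \<chi>1 \<chi>1 = 0" "C \<chi>2 \<chi>2 = 0" "C \<chi>1 \<chi>2 = W" "C \<chi>2 \<chi>1 = - W"
  using frame_contraction_\<chi>_\<chi> assms
    frame_contraction_self_even[OF has_parity_if_has_degree[OF has_degree_\<chi>(1)] assms]
    frame_contraction_self_even[OF has_parity_if_has_degree[OF has_degree_\<chi>(2)] assms]
  by (auto simp: W_def)

text \<open>
  The contractions of \<open>\<chi>1\<close> and \<open>\<chi>2\<close> are of even degree and commute, which makes the mixed product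
  symmetric; as it is antisymmetric by \<open>frame_contraction_\<chi>_\<chi>\<close>, it is zero.
\<close>
lemma frame_contraction_\<chi>_odd:
  assumes "odd n"
  shows "C \<chi>1 \<chi>1 = - W" "C \<chi>2 \<chi>2 = - W" "C \<chi>1 \<chi>2 = 0" "C \<chi>2 \<chi>1 = 0"
proof -
  have "C \<chi>2 \<chi>1 = C \<chi>1 \<chi>2"
    using frame_contraction_commute[OF has_parity_if_has_degree[OF has_degree_\<chi>(1)]
        has_parity_if_has_degree[OF has_degree_\<chi>(2)]] assms by simp
  then have "C \<chi>1 \<chi>2 = - C \<chi>1 \<chi>2" using frame_contraction_\<chi>_\<chi> by simp
  then show "C \<chi>1 \<chi>2 = 0" by (simp add: fun_eq_iff pointwise)
  with frame_contraction_\<chi>_\<chi> assms show "C \<chi>1 \<chi>1 = - W" "C \<chi>2 \<chi>2 = - W" "C \<chi>2 \<chi>1 = 0"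
    by (auto simp: W_def)
qed

lemma has_degree_W:
  assumes "n \<ge> 1"
  shows "has_degree (2 * (n - 1)) W"
proof -
  have "has_degree (Suc (n - 1)) \<chi>1" "has_degree (Suc (n - 1)) \<chi>2"
    using has_degree_\<chi> assms by simp_all
  then have "has_degree (2 * (n - 1)) (C \<chi>1 \<alpha>)" if "\<alpha> = \<chi>1 \<or> \<alpha> = \<chi>2" for \<alpha>
    using has_degree_frame_contraction[of "n - 1" \<chi>1 "n - 1" \<alpha>] that by (auto simp: mult_2)
  then show ?thesis
    using has_degree_scale[of "2 * (n - 1)" "C \<chi>1 \<chi>1" "- 1"] by (simp add: W_def)
qed

lemma frame_contraction_W:
  assumes "n \<ge> 3"
  shows "W \<noteq> 0" "C \<omega>\<^sub>R W = 0" "C \<chi>1 W = 0" "C \<chi>2 W = 0"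
    "C W \<omega>\<^sub>R = 0" "C W \<chi>1 = 0" "C W \<chi>2 = 0" "C W W = 0"
proof -
  \<comment> \<open>For even \<open>n\<close>, \<open>V\<close> is \<open>- \<i> W\<close>; for odd \<open>n\<close>, it is \<open>- W\<close>.\<close>
  have "cplx W = (if even n then \<i> else - 1) *\<^sub>t V"
    unfolding V_eq using frame_contraction_\<chi>_even frame_contraction_\<chi>_odd
    by (auto simp: fun_eq_iff pointwise tscale_def complex_eq_iff cplx_def)
  from frame_contraction_multiple_V[OF assms this]
  show *: "W \<noteq> 0" "C \<omega>\<^sub>R W = 0" "C \<chi>1 W = 0" "C \<chi>2 W = 0" by simp_all
  have par: "has_parity (2 * (n - 1)) W"
    using has_degree_W assms by (intro has_parity_if_has_degree) simp
  show "C W \<omega>\<^sub>R = 0" "C W \<chi>1 = 0" "C W \<chi>2 = 0"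
    using frame_contraction_commute[OF has_parity_if_has_degree[OF has_degree_kahler_form] par]
      frame_contraction_commute[OF has_parity_if_has_degree[OF has_degree_\<chi>(1)] par]
      frame_contraction_commute[OF has_parity_if_has_degree[OF has_degree_\<chi>(2)] par] *
    by simp_all
  show "C W W = 0"
    by (rule frame_contraction_self_even[OF par]) simp
qed

lemma frame_contraction_\<chi>_\<omega>:
  "C \<chi>1 \<omega>\<^sub>R = (if even n then - (of_nat n *\<^sub>t \<chi>2) else of_nat n *\<^sub>t \<chi>2)"
  "C \<chi>2 \<omega>\<^sub>R = (if even n then of_nat n *\<^sub>t \<chi>1 else - (of_nat n *\<^sub>t \<chi>1))"
  using frame_contraction_commute[OF has_parity_if_has_degree[OF has_degree_kahler_form]
      has_parity_if_has_degree[OF has_degree_\<chi>(1)]]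
    frame_contraction_commute[OF has_parity_if_has_degree[OF has_degree_kahler_form]
      has_parity_if_has_degree[OF has_degree_\<chi>(2)]]
  by (simp_all add: frame_contraction_\<omega>_\<chi>)

text \<open>
  The degrees \<open>2\<close>, \<open>n\<close> and \<open>2 (n - 1)\<close> are distinct for \<open>n \<ge> 3\<close>, so only \<open>\<chi>1\<close> and \<open>\<chi>2\<close> have to
  be separated by their values.
\<close>
lemma special_unitary_independent:
  assumes "n \<ge> 3" "r *\<^sub>t \<omega>\<^sub>R + a *\<^sub>t \<chi>1 + b *\<^sub>t \<chi>2 + c *\<^sub>t W = 0"
  shows "r = 0" "a = 0" "b = 0" "c = 0"
proof -
  have eq: "r * \<omega>\<^sub>R vs + a * \<chi>1 vs + b * \<chi>2 vs + c * W vs = 0" for vs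
    using fun_cong[OF assms(2), of vs] by (simp add: pointwise tscale_def)
  have \<omega>: "length vs \<noteq> 2 \<Longrightarrow> \<omega>\<^sub>R vs = 0" for vs
    by (rule has_degree_kahler_form[unfolded has_degree_def, rule_format])
  have \<chi>: "length vs \<noteq> n \<Longrightarrow> \<chi>1 vs = 0" "length vs \<noteq> n \<Longrightarrow> \<chi>2 vs = 0" for vs
    using has_degree_\<chi> by (simp_all add: has_degree_def)
  have W: "length vs \<noteq> 2 * (n - 1) \<Longrightarrow> W vs = 0" for vs
    using has_degree_W assms(1) by (simp add: has_degree_def)
  have "\<omega>\<^sub>R [E 0, E 1] = 1" using kahler_form_eval p_eq assms(1) by simp
  then show "r = 0" using eq[of "[E 0, E 1]"] \<chi>[of "[E 0, E 1]"] W[of "[E 0, E 1]"] assms(1) by simp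
  define us where "us = map (\<lambda>a. E (2 * a)) [0..<n]"
  define us' where "us' = map (\<lambda>a. if a = 0 then E 1 else E (2 * a)) [0..<n]"
  have "\<chi>1 us = 1" "\<chi>2 us = 0" "\<chi>1 us' = 0" "\<chi>2 us' = 1" "length us = n" "length us' = n"
    using \<Omega>_eval assms(1) by (simp_all add: \<chi>1_def \<chi>2_def us_def us'_def)
  then show "a = 0" "b = 0"
    using eq[of us] eq[of us'] \<omega>[of us] \<omega>[of us'] W[of us] W[of us'] assms(1) by auto
  obtain vs where "W vs \<noteq> 0"
    using frame_contraction_W(1)[OF assms(1)] by (auto simp: fun_eq_iff pointwise)
  moreover from this have "length vs = 2 * (n - 1)" using W by blast
  ultimately show "c = 0" using eq[of vs] \<omega>[of vs] \<chi>[of vs] assms(1) by auto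
qed

end

section \<open>Quaternionic forms\<close>

text \<open>
  The index of the coordinate \<open>q\<close> of the quaternion \<open>a\<close>.  The name keeps arithmetic simplification
  from rearranging indices.
\<close>
definition qidx :: "nat \<Rightarrow> nat \<Rightarrow> nat" where "qidx a q = 4 * a + q"

lemma sum_qidx:
  "(\<Sum>i<4 * n. f i) = (\<Sum>a<n. f (qidx a 0) + f (qidx a 1) + f (qidx a 2) + f (qidx a 3))"
  for f :: "nat \<Rightarrow> 'b::comm_monoid_add"
  by (simp add: sum_lessThan_quadruple qidx_def)

text \<open>
  For a cyclic permutation \<open>(q1, q2, q3)\<close> of \<open>(1, 2, 3)\<close>, the Hermitian form of the left multiplication
  with the imaginary unit number \<open>q1\<close>.  With the indices as parameters the three products are instances
  of one identity.
\<close>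
definition hyper_form :: "nat \<Rightarrow> nat \<Rightarrow> nat \<Rightarrow> nat \<Rightarrow> (nat \<Rightarrow> 'e \<Rightarrow> real) \<Rightarrow> ('e, real) tensor" where
  "hyper_form n q1 q2 q3 e =
     (\<Sum>a<n. covector (e (qidx a 0)) \<and>\<^sub>w covector (e (qidx a q1)) +
        covector (e (qidx a q2)) \<and>\<^sub>w covector (e (qidx a q3)))"

lemma hermitian_form_hyper:
  "hermitian_form (hyper n 0) e = hyper_form n 1 2 3 e"
  "hermitian_form (hyper n 1) e = hyper_form n 2 3 1 e"
  "hermitian_form (hyper n 2) e = hyper_form n 3 1 2 e"
proof -
  have entries: "hyper n r $$ (qidx a q, qidx b q') = (if a = b then quaternion_unit r ! q ! q' else 0)"
    if "a < n" "b < n" "q < 4" "q' < 4" for a b q q' r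
    using that by (auto simp: hyper_def qidx_def)
  have inner: "(\<Sum>j<4 * n. hyper n r $$ (qidx a q, j) * e j v * c) =
      quaternion_unit r ! q ! 0 * e (qidx a 0) v * c + quaternion_unit r ! q ! 1 * e (qidx a 1) v * c +
      quaternion_unit r ! q ! 2 * e (qidx a 2) v * c + quaternion_unit r ! q ! 3 * e (qidx a 3) v * c"
    if "a < n" "q < 4" for a q r v and c :: real
  proof -
    have "(\<Sum>j<4 * n. hyper n r $$ (qidx a q, j) * e j v * c) = (\<Sum>b<n. if a = b then
      quaternion_unit r ! q ! 0 * e (qidx b 0) v * c + quaternion_unit r ! q ! 1 * e (qidx b 1) v * c +
      quaternion_unit r ! q ! 2 * e (qidx b 2) v * c + quaternion_unit r ! q ! 3 * e (qidx b 3) v * c else 0)"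
      unfolding sum_qidx by (rule sum.cong[OF HOL.refl]) (use that in \<open>simp add: entries\<close>)
    then show ?thesis by (simp only: sum_if_eq(1)[OF that(1)])
  qed
  have dim: "dim_row (hyper n r) = 4 * n" for r by (simp add: hyper_def)
  have outer: "(\<Sum>i<4 * n. \<Sum>j<4 * n. hyper n r $$ (i, j) * e j v * e i w) = (\<Sum>a<n. G a)"
    if "\<And>a. a < n \<Longrightarrow> G a = (\<Sum>q\<leftarrow>[0, 1, 2, 3]. \<Sum>q'\<leftarrow>[0, 1, 2, 3].
        quaternion_unit r ! q ! q' * e (qidx a q') v * e (qidx a q) w)" for r v w G
    by (subst sum_qidx, rule sum.cong[OF HOL.refl]) (simp add: inner that add.assoc)
  have ev: "hermitian_form (hyper n r) e vs = hyper_form n q1 q2 q3 e vs"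
    if "\<And>v w a. e (qidx a 0) v * e (qidx a q1) w - e (qidx a 0) w * e (qidx a q1) v +
          (e (qidx a q2) v * e (qidx a q3) w - e (qidx a q2) w * e (qidx a q3) v) =
        (\<Sum>q\<leftarrow>[0, 1, 2, 3]. \<Sum>q'\<leftarrow>[0, 1, 2, 3].
          quaternion_unit r ! q ! q' * e (qidx a q') v * e (qidx a q) w)" for r q1 q2 q3 vs
    unfolding hermitian_form_def bilin_def dim hyper_form_def sum_fun_apply wedge_covector_covector
      pointwise
    by (cases "length vs = 2") (simp_all only: if_True if_False outer[OF that], simp_all)
  show "hermitian_form (hyper n 0) e = hyper_form n 1 2 3 e"
    "hermitian_form (hyper n 1) e = hyper_form n 2 3 1 e"
    "hermitian_form (hyper n 2) e = hyper_form n 3 1 2 e"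
    by (rule ext, rule ev, simp add: quaternion_unit_def)+
qed

lemma has_degree_hyper_form: "has_degree 2 (hyper_form n q1 q2 q3 e)"
proof -
  have "has_degree 2 (covector a \<and>\<^sub>w covector b)" for a b :: "'a \<Rightarrow> real"
    using has_degree_wedge[OF has_degree_covector has_degree_covector, of a b]
    by (simp add: numeral_2_eq_2)
  then show ?thesis
    unfolding hyper_form_def by (intro has_degree_sum) (auto simp: has_degree_def pointwise)
qed

lemma transverse_hyper_form:
  assumes "q1 < 4" "q2 < 4" "q3 < 4"
  shows "transverse (4 * n) e (hyper_form n q1 q2 q3 e)"
  unfolding hyper_form_def
  by (intro transverse_sum transverse.add transverse_wedge transverse_covector_real)
     (use assms in \<open>auto simp: qidx_def\<close>)

lemma covector_anticommute: "covector a \<and>\<^sub>w covector b = - (covector b \<and>\<^sub>w covector a)"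
  by (simp add: wedge_covector_right[of "covector a"])

definition quaternion_cycle :: "nat \<Rightarrow> nat \<Rightarrow> nat \<Rightarrow> bool" where
  "quaternion_cycle q1 q2 q3 \<longleftrightarrow> (q1, q2, q3) \<in> {(1, 2, 3), (2, 3, 1), (3, 1, 2)}"

locale quaternionic_dual_frame = dual_frame p e E
  for p e and E :: "nat \<Rightarrow> 'e" +
  fixes n :: nat
  assumes p_eq: "p = 4 * n"
begin

abbreviation x :: "nat \<Rightarrow> nat \<Rightarrow> ('e, real) tensor" where
  "x a q \<equiv> covector (e (qidx a q))"

lemma dual_qidx:
  assumes "a < n" "b < n" "q < 4" "q' < 4"
  shows "e (qidx a q) (E (qidx b q')) = (if a = b \<and> q = q' then 1 else 0)"
proof -
  have "4 * a + q = 4 * b + q' \<longleftrightarrow> a = b \<and> q = q'" using assms by presburger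
  then show ?thesis using assms p_eq by (simp add: dual qidx_def)
qed

lemma quaternion_cycle_facts:
  assumes "quaternion_cycle q1 q2 q3"
  shows "quaternion_cycle q2 q3 q1" "q1 < 4" "q2 < 4" "q3 < 4"
    "q1 \<noteq> 0" "q2 \<noteq> 0" "q3 \<noteq> 0" "q1 \<noteq> q2" "q2 \<noteq> q3" "q1 \<noteq> q3"
    "q < 4 \<Longrightarrow> q = 0 \<or> q = q1 \<or> q = q2 \<or> q = q3"
  using assms by (auto simp: quaternion_cycle_def)

lemma sum_quaternion_cycle:
  fixes f :: "nat \<Rightarrow> 'b::ab_semigroup_add"
  assumes "quaternion_cycle q1 q2 q3"
  shows "f 0 + f 1 + f 2 + f 3 = f 0 + f q1 + f q2 + f q3"
  using assms by (auto simp: quaternion_cycle_def add_ac)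

lemma contract_hyper_form:
  assumes "a < n" "quaternion_cycle q1 q2 q3"
  shows "contract_vec (E (qidx a 0)) (hyper_form n q1 q2 q3 e) = x a q1"
    and "contract_vec (E (qidx a q1)) (hyper_form n q1 q2 q3 e) = - x a 0"
    and "contract_vec (E (qidx a q2)) (hyper_form n q1 q2 q3 e) = x a q3"
    and "contract_vec (E (qidx a q3)) (hyper_form n q1 q2 q3 e) = - x a q2"
proof -
  note q = quaternion_cycle_facts(2-10)[OF assms(2)]
  define R where "R q b = (if 0 = q then 1 else 0) *\<^sub>t x b q1 - (if q1 = q then 1 else 0) *\<^sub>t x b 0 +
    ((if q2 = q then 1 else 0) *\<^sub>t x b q3 - (if q3 = q then 1 else 0) *\<^sub>t x b q2)" for q b
  have "contract_vec (E (qidx a q)) (hyper_form n q1 q2 q3 e) = R q a" if "q < 4" for q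
  proof -
    have "contract_vec (E (qidx a q)) (x b 0 \<and>\<^sub>w x b q1 + x b q2 \<and>\<^sub>w x b q3) =
      (if a = b then R q b else 0)" if "b < n" for b
      unfolding contract_add contract_covector_wedge contract_covector R_def
      using that \<open>q < 4\<close> assms(1) q by (cases "a = b") (simp_all add: dual_qidx)
    then have "contract_vec (E (qidx a q)) (hyper_form n q1 q2 q3 e) = (\<Sum>b<n. if a = b then R q b else 0)"
      unfolding hyper_form_def contract_sum by (intro sum.cong HOL.refl) auto
    then show ?thesis by (simp only: sum_if_eq(1)[OF assms(1)])
  qed
  then show "contract_vec (E (qidx a 0)) (hyper_form n q1 q2 q3 e) = x a q1"
    "contract_vec (E (qidx a q1)) (hyper_form n q1 q2 q3 e) = - x a 0"
    "contract_vec (E (qidx a q2)) (hyper_form n q1 q2 q3 e) = x a q3"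
    "contract_vec (E (qidx a q3)) (hyper_form n q1 q2 q3 e) = - x a q2"
    using q q(4-9)[symmetric] by (simp_all add: R_def)
qed

text \<open>
  This is the rule that the product of two imaginary units is the third.
\<close>
lemma frame_contraction_hyper_form:
  assumes "quaternion_cycle q1 q2 q3"
  shows "C (hyper_form n q1 q2 q3 e) (hyper_form n q2 q3 q1 e) = 2 *\<^sub>t hyper_form n q3 q1 q2 e"
proof -
  let ?f = "\<lambda>a q. contract_vec (E (qidx a q)) (hyper_form n q1 q2 q3 e) \<and>\<^sub>w
    contract_vec (E (qidx a q)) (hyper_form n q2 q3 q1 e)"
  have "?f a 0 + ?f a 1 + ?f a 2 + ?f a 3 = 2 *\<^sub>t (x a 0 \<and>\<^sub>w x a q3 + x a q1 \<and>\<^sub>w x a q2)"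
    if "a < n" for a
  proof -
    have "?f a 0 + ?f a 1 + ?f a 2 + ?f a 3 =
      ?f a 0 + ?f a q1 + ?f a q2 + ?f a q3"
      by (rule sum_quaternion_cycle[OF assms, of "?f a"])
    also have "\<dots> =
      x a q1 \<and>\<^sub>w x a q2 + x a 0 \<and>\<^sub>w x a q3 - x a q3 \<and>\<^sub>w x a 0 - x a q2 \<and>\<^sub>w x a q1"
      unfolding contract_hyper_form[OF that assms]
        contract_hyper_form[OF that quaternion_cycle_facts(1)[OF assms]] by simp
    finally show ?thesis
      unfolding covector_anticommute[of "e (qidx a q3)" "e (qidx a 0)"]
        covector_anticommute[of "e (qidx a q2)" "e (qidx a q1)"]
      by (simp add: fun_eq_iff pointwise tscale_def)
  qed
  then show ?thesis
    unfolding frame_contraction_def p_eq sum_qidx hyper_form_def[of n q3] tscale_sum_right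
    by (intro sum.cong HOL.refl) simp
qed

lemma frame_contraction_hyper_form_self:
  "C (hyper_form n q1 q2 q3 e) (hyper_form n q1 q2 q3 e) = 0"
  by (rule frame_contraction_self_even[OF has_parity_if_has_degree[OF has_degree_hyper_form]]) simp

lemma frame_contraction_hyper_form_flip:
  assumes "quaternion_cycle q1 q2 q3"
  shows "C (hyper_form n q2 q3 q1 e) (hyper_form n q1 q2 q3 e) = - (2 *\<^sub>t hyper_form n q3 q1 q2 e)"
  using frame_contraction_commute[OF has_parity_if_has_degree[OF has_degree_hyper_form]
      has_parity_if_has_degree[OF has_degree_hyper_form], of p E n q2 q3 q1 e n q1 q2 q3 e]
  by (simp add: frame_contraction_hyper_form[OF assms])

lemma hyper_form_eval:
  assumes "0 < n" "quaternion_cycle q1 q2 q3" "q < 4"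
  shows "hyper_form n q1 q2 q3 e [E (qidx 0 0), E (qidx 0 q)] = (if q = q1 then 1 else 0)"
    and "hyper_form n q1 q2 q3 e [E (qidx 0 q1), E (qidx 0 q)] = (if q = 0 then - 1 else 0)"
    and "hyper_form n q1 q2 q3 e [E (qidx 0 q2), E (qidx 0 q)] = (if q = q3 then 1 else 0)"
    and "hyper_form n q1 q2 q3 e [E (qidx 0 q3), E (qidx 0 q)] = (if q = q2 then - 1 else 0)"
proof -
  have "hyper_form n q1 q2 q3 e [u, v] = contract_vec u (hyper_form n q1 q2 q3 e) [v]" for u v
    by (simp add: contract_vec_def)
  then show "hyper_form n q1 q2 q3 e [E (qidx 0 0), E (qidx 0 q)] = (if q = q1 then 1 else 0)"
    "hyper_form n q1 q2 q3 e [E (qidx 0 q1), E (qidx 0 q)] = (if q = 0 then - 1 else 0)"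
    "hyper_form n q1 q2 q3 e [E (qidx 0 q2), E (qidx 0 q)] = (if q = q3 then 1 else 0)"
    "hyper_form n q1 q2 q3 e [E (qidx 0 q3), E (qidx 0 q)] = (if q = q2 then - 1 else 0)"
    using quaternion_cycle_facts(2-4)[OF assms(2)] assms(1,3)
    by (simp_all add: contract_hyper_form[OF assms(1,2)] covector_def pointwise dual_qidx)
qed

end

text \<open>
  The three partitions of the four arguments into pairs, each counted twice.
\<close>
lemma wedge_two_forms_eval:
  fixes \<alpha> :: "('e, 'f::comm_ring_1) tensor"
  assumes "has_degree 2 \<alpha>"
  shows "(\<alpha> \<and>\<^sub>w \<alpha>) [t, u, v, w] =
    2 * (\<alpha> [t, u] * \<alpha> [v, w] - \<alpha> [t, v] * \<alpha> [u, w] + \<alpha> [t, w] * \<alpha> [u, v])"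
proof -
  have "\<alpha> [] = 0" "\<alpha> [a] = 0" "\<alpha> [a, b, c] = 0" "\<alpha> [a, b, c, d] = 0" for a b c d
    using assms by (simp_all add: has_degree_def)
  then show ?thesis
    by (simp add: wedge_Cons wedge_Nil pointwise contract_vec_def grade_inv_def algebra_simps)
qed

context quaternionic_dual_frame
begin

definition four_form :: "('e, real) tensor" where
  "four_form = (\<lambda>vs. \<Sum>r<3. (hermitian_form (hyper n r) e \<and>\<^sub>w hermitian_form (hyper n r) e) vs)"

lemma four_form_eq: "four_form =
    hyper_form n 1 2 3 e \<and>\<^sub>w hyper_form n 1 2 3 e + hyper_form n 2 3 1 e \<and>\<^sub>w hyper_form n 2 3 1 e +
    hyper_form n 3 1 2 e \<and>\<^sub>w hyper_form n 3 1 2 e"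
proof -
  have "{..<3} = {0, 1, 2 :: nat}" by auto
  then show ?thesis
    by (simp add: four_form_def fun_eq_iff pointwise hermitian_form_hyper hermitian_form_hyper[unfolded One_nat_def])
qed

lemma transverse_four_form: "transverse p e four_form"
  unfolding four_form_eq p_eq
  by (intro transverse.add transverse_wedge transverse_hyper_form) simp_all

lemma has_degree_four_form: "has_degree 4 four_form"
proof -
  have "has_degree (2 + 2) (hyper_form n q1 q2 q3 e \<and>\<^sub>w hyper_form n q1 q2 q3 e)" for q1 q2 q3
    by (intro has_degree_wedge has_degree_hyper_form)
  then show ?thesis
    unfolding four_form_eq by (simp add: has_degree_def pointwise)
qed

text \<open>
  The three two-forms are self-dual for the same orientation of the quaternions, so that their
  squares add up with equal signs.
\<close>
lemma four_form_eval:
  assumes "0 < n"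
  shows "four_form [E (qidx 0 0), E (qidx 0 1), E (qidx 0 2), E (qidx 0 3)] = 6"
proof -
  have cyc: "quaternion_cycle 1 2 3" "quaternion_cycle 2 3 1" "quaternion_cycle 3 1 2"
    by (simp_all add: quaternion_cycle_def)
  show ?thesis
    unfolding four_form_eq plus_fun_apply wedge_two_forms_eval[OF has_degree_hyper_form]
    by (simp add: hyper_form_eval[OF assms cyc(1)] hyper_form_eval[OF assms cyc(2)]
        hyper_form_eval[OF assms cyc(3)] hyper_form_eval[OF assms cyc(1), unfolded One_nat_def]
        hyper_form_eval[OF assms cyc(2), unfolded One_nat_def] hyper_form_eval[OF assms cyc(3), unfolded One_nat_def])
qed

end

section \<open>The Lie algebra of the unit quaternions\<close>

text \<open>
  The map \<open>x \<mapsto> x \<cdot> cnj (a i + b j + c k)\<close> of the quaternions, in the basis \<open>1, i, j, k\<close>.  The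
  conjugate gives the commutators the sign of the products of the Hermitian forms.
\<close>
definition quat_mat :: "real \<Rightarrow> real \<Rightarrow> real \<Rightarrow> real mat" where
  "quat_mat a b c = mat 4 4 (\<lambda>(i, j).
     [[0, a, b, c], [- a, 0, - c, b], [- b, c, 0, - a], [- c, - b, a, 0]] ! i ! j)"

lemma less_4_cases: "(\<forall>i<4. P i) \<longleftrightarrow> P 0 \<and> P 1 \<and> P 2 \<and> P (3 :: nat)"
  by (auto simp: less_Suc_eq numeral_eq_Suc)

lemma mat_4_mult: "mat 4 4 f * mat 4 4 g =
    mat 4 4 (\<lambda>(i, j). f (i, 0) * g (0, j) + f (i, 1) * g (1, j) + f (i, 2) * g (2, j) + f (i, 3) * g (3, j))"
  by (rule eq_matI) (auto simp: scalar_prod_def eval_nat_numeral)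

lemma mat_4_eq_iff: "mat 4 4 f = mat 4 4 g \<longleftrightarrow> (\<forall>i<4. \<forall>j<4. f (i, j) = g (i, j))"
  by (auto simp: mat_eq_iff)

lemma hyper_1: "hyper 1 r = mat 4 4 (\<lambda>(i, j). quaternion_unit r ! i ! j)"
  unfolding hyper_def by (rule cong_mat) auto

lemma quat_mat_add: "quat_mat a b c + quat_mat a' b' c' = quat_mat (a + a') (b + b') (c + c')"
  by (rule eq_matI) (auto simp: quat_mat_def less_Suc_eq numeral_eq_Suc)

lemma quat_mat_scale: "s \<cdot>\<^sub>m quat_mat a b c = quat_mat (s * a) (s * b) (s * c)"
  by (rule eq_matI) (auto simp: quat_mat_def less_Suc_eq numeral_eq_Suc)

lemma quat_mat_bracket:
  "quat_mat a b c * quat_mat a' b' c' - quat_mat a' b' c' * quat_mat a b c =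
    quat_mat (2 * (b * c' - c * b')) (2 * (c * a' - a * c')) (2 * (a * b' - b * a'))"
  unfolding quat_mat_def mat_4_mult
  by (rule eq_matI) (auto simp: less_Suc_eq numeral_eq_Suc algebra_simps)

text \<open>
  The matrices that commute with all left multiplications are the right multiplications, which are
  determined by the image of \<open>1\<close>; antisymmetry makes this image imaginary.
\<close>
lemma sp_alg_1_carrier: "lsa_carrier (sp_alg 1) = {quat_mat a b c | a b c. True}"
proof
  show "{quat_mat a b c | a b c. True} \<subseteq> lsa_carrier (sp_alg 1)"
  proof safe
    fix a b c
    have "quat_mat a b c * hyper 1 r = hyper 1 r * quat_mat a b c" if "r < 3" for r
    proof -
      have "r = 0 \<or> r = 1 \<or> r = 2" using that by auto
      then show ?thesis
        unfolding quat_mat_def hyper_1 mat_4_mult mat_4_eq_iff less_4_cases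
        by (auto simp: quaternion_unit_def)
    qed
    moreover have "transpose_mat (quat_mat a b c) = - quat_mat a b c"
      by (rule eq_matI) (auto simp: quat_mat_def less_Suc_eq numeral_eq_Suc)
    moreover have "quat_mat a b c \<in> carrier_mat 4 4" by (simp add: quat_mat_def)
    ultimately show "quat_mat a b c \<in> lsa_carrier (sp_alg 1)"
      by (simp add: sp_alg_def Let_def)
  qed
  show "lsa_carrier (sp_alg 1) \<subseteq> {quat_mat a b c | a b c. True}"
  proof
    fix M :: "real mat"
    assume "M \<in> lsa_carrier (sp_alg 1)"
    then have M: "M \<in> carrier_mat 4 4" "transpose_mat M = - M"
      "\<forall>r<3. M * hyper 1 r = hyper 1 r * M" by (auto simp: sp_alg_def Let_def)
    define f where "f i j = M $$ (i, j)" for i j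
    have M_eq: "M = mat 4 4 (\<lambda>(i, j). f i j)"
      using M(1) by (intro eq_matI) (auto simp: f_def)
    have anti: "f j i = - f i j" if "i < 4" "j < 4" for i j
      using arg_cong[OF M(2), of "\<lambda>M. M $$ (i, j)"] M(1) that by (auto simp: f_def)
    have "(M * hyper 1 r) $$ (i, j) = (hyper 1 r * M) $$ (i, j)" if "r < 3" for r i j
      using M(3) that by simp
    from this[of 0 0 2] this[of 0 0 3] this[of 1 0 3]
    have comm: "f 1 2 = - f 0 3" "f 1 3 = f 0 2" "f 2 3 = - f 0 1"
      unfolding M_eq hyper_1 mat_4_mult by (simp_all add: quaternion_unit_def)
    have "M = quat_mat (f 0 1) (f 0 2) (f 0 3)"
      unfolding M_eq quat_mat_def mat_4_eq_iff less_4_cases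
      using anti[of 0 0] anti[of 1 1] anti[of 2 2] anti[of 3 3] anti[of 0 1] anti[of 0 2] anti[of 0 3]
        anti[of 1 2] anti[of 1 3] anti[of 2 3] comm by simp
    then show "M \<in> {quat_mat a b c | a b c. True}" by blast
  qed
qed


section \<open>Adapted coframes and the product of null forms\<close>

text \<open>
  An injective system of as many linear functionals as the dimension is a system of coordinates.
\<close>
lemma ex_coordinates:
  fixes c :: "nat \<Rightarrow> 'e::euclidean_space \<Rightarrow> real"
  assumes linear: "\<And>i. i < DIM('e) \<Longrightarrow> linear (c i)"
    and inj: "\<And>v. (\<And>i. i < DIM('e) \<Longrightarrow> c i v = 0) \<Longrightarrow> v = 0"
  shows "\<exists>v. \<forall>i<DIM('e). c i v = y i"
proof -
  obtain h :: "nat \<Rightarrow> 'e" where h: "bij_betw h {..<DIM('e)} Basis"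
    using ex_bij_betw_nat_finite[OF finite_Basis] by (auto simp: lessThan_atLeast0)
  define T where "T v = (\<Sum>i<DIM('e). c i v *\<^sub>R h i)" for v
  have inner: "(\<Sum>i<DIM('e). x i *\<^sub>R h i) \<bullet> h j = x j" if "j < DIM('e)" for x j
  proof -
    have "h i \<bullet> h j = (if i = j then 1 else 0)" if "i < DIM('e)" for i
      using h that \<open>j < DIM('e)\<close> bij_betwE[OF h]
      by (auto simp: inner_Basis bij_betw_def inj_on_eq_iff)
    then have "(\<Sum>i<DIM('e). x i *\<^sub>R h i) \<bullet> h j = (\<Sum>i<DIM('e). if i = j then x i else 0)"
      unfolding inner_sum_left by (intro sum.cong HOL.refl) simp
    then show ?thesis using that by simp
  qed
  have "linear T"
    unfolding T_def
    by (intro linear_compose_sum ballI linearI)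
       (simp_all add: linear_add[OF linear] linear_cmul[OF linear] scaleR_add_left)
  moreover have "inj T"
  proof (subst linear_injective_0[OF \<open>linear T\<close>], intro allI impI inj)
    fix v i assume "T v = 0" "i < DIM('e)"
    then show "c i v = 0" using inner[of i "\<lambda>i. c i v"] by (simp add: T_def)
  qed
  ultimately have "surj T" using linear_injective_imp_surjective by blast
  then obtain v where "T v = (\<Sum>i<DIM('e). y i *\<^sub>R h i)" by (metis surjD)
  then have "c i v = y i" if "i < DIM('e)" for i
    using inner[OF that, of "\<lambda>i. c i v"] inner[OF that, of y] by (simp add: T_def)
  then show ?thesis by blast
qed

text \<open>
  The map that sends a vector of coordinates to the corresponding combination of frame vectors is
  injective, hence surjective, so \<open>v\<close> is such a combination; its coefficients are read off from the
  products with the frame vectors.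
\<close>
lemma lorentz_frame_nondegenerate:
  fixes b :: "'e::euclidean_space \<Rightarrow> 'e \<Rightarrow> real"
  assumes b: "bilinear b" and f: "lorentz_frame b f" and v: "\<And>w. b v w = 0"
  shows "v = 0"
proof -
  obtain h :: "nat \<Rightarrow> 'e" where h: "bij_betw h {..<DIM('e)} Basis"
    using ex_bij_betw_nat_finite[OF finite_Basis] by (auto simp: lessThan_atLeast0)
  define T where "T u = (\<Sum>i<DIM('e). (u \<bullet> h i) *\<^sub>R f i)" for u
  have lin: "linear (\<lambda>x. b x w)" for w using b by (simp add: bilinear_def)
  have T: "b (T u) (f j) = (u \<bullet> h j) * b (f j) (f j)" if "j < DIM('e)" for u j
  proof -
    have "b (T u) (f j) = (\<Sum>i<DIM('e). (u \<bullet> h i) * b (f i) (f j))"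
      unfolding T_def linear_sum[OF lin] linear_cmul[OF lin] by simp
    also have "\<dots> = (\<Sum>i<DIM('e). if i = j then (u \<bullet> h j) * b (f j) (f j) else 0)"
      using f that by (intro sum.cong HOL.refl) (auto simp: lorentz_frame_def)
    finally show ?thesis using that by simp
  qed
  have nz: "b (f j) (f j) \<noteq> 0" if "j < DIM('e)" for j
    using f that by (auto simp: lorentz_frame_def)
  have eq_0: "u = 0" if "\<And>w. b (T u) w = 0" for u
  proof (rule euclidean_eqI)
    fix i :: 'e assume "i \<in> Basis"
    then obtain j where "j < DIM('e)" "i = h j"
      using h by (auto simp: bij_betw_def)
    then show "u \<bullet> i = 0 \<bullet> i" using T[of j u] nz[of j] that by simp
  qed
  have "linear T"
    unfolding T_def
    by (intro linear_compose_sum ballI linearI) (simp_all add: inner_add_left scaleR_add_left)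
  moreover have "inj T"
  proof (subst linear_injective_0[OF \<open>linear T\<close>], intro allI impI eq_0)
    show "b (T u) w = 0" if "T u = 0" for u w using linear_0[OF lin] that by simp
  qed
  ultimately obtain u where "v = T u"
    using linear_injective_imp_surjective by (metis surjD)
  then show ?thesis using eq_0 v \<open>linear T\<close> linear_0 by metis
qed

locale null_frame =
  fixes b :: "'e::euclidean_space \<Rightarrow> 'e \<Rightarrow> real" and k ep :: "'e \<Rightarrow> real"
    and e :: "nat \<Rightarrow> 'e \<Rightarrow> real"
  assumes nondegenerate: "(\<And>w. b v w = 0) \<Longrightarrow> v = 0"
    and adapted: "adapted_coframe b k ep e"
    and dim: "DIM('e) \<ge> 2"
begin

lemma linear_coframe: "linear k" "linear ep" "i < DIM('e) - 2 \<Longrightarrow> linear (e i)"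
  using adapted by (auto simp: adapted_coframe_def)

lemma b_eq: "b v w = k v * ep w + ep v * k w + (\<Sum>i<DIM('e) - 2. e i v * e i w)"
  using adapted by (auto simp: adapted_coframe_def)

lemma b_commute: "b v w = b w v"
  by (simp add: b_eq mult.commute)

lemma b_diff: "b (u - v) w = b u w - b v w"
  using linear_coframe
  by (simp add: b_eq linear_diff left_diff_distrib sum_subtractf algebra_simps)

lemma sharp_eqI:
  assumes "\<And>w. b v w = \<alpha> w"
  shows "sharp b \<alpha> = v"
  unfolding sharp_def
proof (rule the_equality)
  fix u assume "\<forall>w. b u w = \<alpha> w"
  then have "u - v = 0" using assms by (intro nondegenerate) (simp add: b_diff)
  then show "u = v" by simp
qed (use assms in simp)

lemma ex_frame_coordinates:
  "\<exists>v. k v = s \<and> ep v = t \<and> (\<forall>i<DIM('e) - 2. e i v = y i)"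
proof -
  let ?p = "DIM('e) - 2"
  have "\<exists>v. \<forall>i<DIM('e). (if i < ?p then e i else if i = ?p then k else ep) v =
    (if i < ?p then y i else if i = ?p then s else t)"
  proof (rule ex_coordinates)
    fix v assume *: "\<And>i. i < DIM('e) \<Longrightarrow> (if i < ?p then e i else if i = ?p then k else ep) v = 0"
    have "e i v = 0" if "i < ?p" for i using *[of i] that by simp
    moreover have "k v = 0" using *[of ?p] dim by simp
    moreover have "ep v = 0" using *[of "Suc ?p"] dim by simp
    ultimately show "v = 0" by (intro nondegenerate) (simp add: b_eq)
  qed (use linear_coframe in auto)
  then obtain v where v: "\<forall>i<DIM('e). (if i < ?p then e i else if i = ?p then k else ep) v =
    (if i < ?p then y i else if i = ?p then s else t)" ..
  have "e i v = y i" if "i < ?p" for i using spec[OF v, of i] that by simp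
  moreover have "k v = s" using spec[OF v, of ?p] dim by simp
  moreover have "ep v = t" using spec[OF v, of "Suc ?p"] dim by simp
  ultimately show ?thesis by blast
qed

abbreviation E :: "nat \<Rightarrow> 'e" where "E i \<equiv> sharp b (e i)"

lemma sharp_e:
  assumes "i < DIM('e) - 2"
  shows "b (E i) w = e i w" "k (E i) = 0" "ep (E i) = 0"
    "j < DIM('e) - 2 \<Longrightarrow> e j (E i) = (if j = i then 1 else 0)"
proof -
  obtain v where v: "k v = 0" "ep v = 0" "\<forall>j<DIM('e) - 2. e j v = (if j = i then 1 else 0)"
    using ex_frame_coordinates[of 0 0 "\<lambda>j. if j = i then 1 else 0"] by blast
  have "b v w = e i w" for w
  proof -
    have "(\<Sum>j<DIM('e) - 2. e j v * e j w) = (\<Sum>j<DIM('e) - 2. if j = i then e j w else 0)"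
      by (intro sum.cong HOL.refl) (use v in auto)
    then show ?thesis using assms v by (simp add: b_eq)
  qed
  then have "E i = v" and *: "\<And>w. b v w = e i w" by (auto intro: sharp_eqI)
  then show "b (E i) w = e i w" "k (E i) = 0" "ep (E i) = 0"
    "j < DIM('e) - 2 \<Longrightarrow> e j (E i) = (if j = i then 1 else 0)"
    using v by auto
qed

lemma sharp_ep: "k (sharp b ep) = 1" "i < DIM('e) - 2 \<Longrightarrow> e i (sharp b ep) = 0"
proof -
  obtain v where v: "k v = 1" "ep v = 0" "\<forall>j<DIM('e) - 2. e j v = 0"
    using ex_frame_coordinates[of 1 0 "\<lambda>_. 0"] by blast
  then have "sharp b ep = v" by (intro sharp_eqI) (simp add: b_eq)
  then show "k (sharp b ep) = 1" "i < DIM('e) - 2 \<Longrightarrow> e i (sharp b ep) = 0"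
    using v by auto
qed

sublocale dual_frame "DIM('e) - 2" e E
  by unfold_locales (simp add: sharp_e)

text \<open>
  The contraction with the vector dual to \<open>ep\<close> undoes the multiplication with \<open>k\<close>.
\<close>
lemma covector_wedge_inject:
  assumes "transverse (DIM('e) - 2) e \<alpha>" "transverse (DIM('e) - 2) e \<beta>"
    "covector k \<and>\<^sub>w \<alpha> = covector k \<and>\<^sub>w \<beta>"
  shows "\<alpha> = \<beta>"
proof -
  have "contract_vec (sharp b ep) (covector k \<and>\<^sub>w \<gamma>) = \<gamma>" if "transverse (DIM('e) - 2) e \<gamma>" for \<gamma>
    using contract_eq_0[OF that sharp_ep(2)] by (simp add: contract_covector_wedge sharp_ep)
  then show ?thesis using assms by metis
qed

text \<open>
  On transverse forms, the frame vectors of another adapted coframe act through their components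
  in \<open>E\<close>, and the matrix of these components is orthogonal.
\<close>
lemma frame_contraction_independent:
  fixes \<alpha> \<beta> :: "('e, real) tensor"
  assumes "null_frame b k ep' e'"
    and "transverse (DIM('e) - 2) e \<alpha>" "transverse (DIM('e) - 2) e \<beta>"
  shows "frame_contraction (DIM('e) - 2) (\<lambda>i. sharp b (e' i)) \<alpha> \<beta> = C \<alpha> \<beta>"
proof -
  interpret other: null_frame b k ep' e' by fact
  let ?p = "DIM('e) - 2"
  define c where "c i j = e j (other.E i)" for i j
  have orth: "(\<Sum>i<?p. c i j * c i l) = (if j = l then 1 else 0)" if "j < ?p" "l < ?p" for j l
  proof -
    have c: "c i j = e' i (E j)" if "i < ?p" "j < ?p" for i j
      using other.sharp_e(1)[OF that(1), of "E j"] sharp_e(1)[OF that(2), of "other.E i"]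
      by (simp add: c_def b_commute)
    have "(\<Sum>i<?p. c i j * c i l) = b (E j) (E l)"
      by (subst other.b_eq) (simp add: c that sharp_e(2))
    then show ?thesis using that by (simp add: sharp_e)
  qed
  have "frame_contraction ?p other.E \<alpha> \<beta> =
    (\<Sum>i<?p. \<Sum>j<?p. \<Sum>l<?p. (c i j * c i l) *\<^sub>t (contract_vec (E j) \<alpha> \<and>\<^sub>w contract_vec (E l) \<beta>))"
    unfolding frame_contraction_def contract_expand[OF assms(2), of "other.E _"]
      contract_expand[OF assms(3), of "other.E _"] wedge_sum_left
    unfolding wedge_sum_right by (simp add: c_def mult.commute)
  also have "\<dots> = (\<Sum>j<?p. \<Sum>l<?p. (\<Sum>i<?p. c i j * c i l) *\<^sub>t
      (contract_vec (E j) \<alpha> \<and>\<^sub>w contract_vec (E l) \<beta>))"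
  proof -
    have "(\<Sum>i<?p. \<Sum>j<?p. \<Sum>l<?p. G i j l) = (\<Sum>j<?p. \<Sum>l<?p. \<Sum>i<?p. G i j l)"
      for G :: "nat \<Rightarrow> nat \<Rightarrow> nat \<Rightarrow> ('e, real) tensor"
      by (rule HOL.trans[OF sum.swap], rule sum.cong[OF HOL.refl], rule sum.swap)
    moreover have "(\<Sum>i<?p. c i j * c i l) *\<^sub>t \<gamma> = (\<Sum>i<?p. (c i j * c i l) *\<^sub>t \<gamma>)"
      for j l and \<gamma> :: "('e, real) tensor"
      by (simp add: fun_eq_iff tscale_def sum_fun_apply sum_distrib_right)
    ultimately show ?thesis by simp
  qed
  also have "\<dots> = (\<Sum>j<?p. \<Sum>l<?p. if l = j then contract_vec (E j) \<alpha> \<and>\<^sub>w contract_vec (E j) \<beta> else 0)"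
    by (intro sum.cong HOL.refl) (simp add: orth)
  also have "\<dots> = C \<alpha> \<beta>"
    unfolding frame_contraction_def by (intro sum.cong HOL.refl) (simp add: sum_if_eq)
  finally show ?thesis .
qed

text \<open>
  The definition of the product refers to an unspecified adapted coframe.  In it, the transverse
  parts of the factors are \<open>\<alpha>\<close> and \<open>\<beta>\<close> up to multiples of \<open>k\<close>; these do not survive the
  multiplication with \<open>k\<close>, because the vectors of the transverse frame are annihilated by \<open>k\<close>.
\<close>
lemma null_prod_at_covector_wedge:
  assumes "transverse (DIM('e) - 2) e \<alpha>" "transverse (DIM('e) - 2) e \<beta>"
  shows "null_prod_at b k (covector k \<and>\<^sub>w \<alpha>) (covector k \<and>\<^sub>w \<beta>) = covector k \<and>\<^sub>w C \<alpha> \<beta>"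
proof -
  obtain ep' e' where eq: "(SOME (ep, e). adapted_coframe b k ep e) = (ep', e')"
    by fastforce
  have "adapted_coframe b k ep' e'"
    using someI[of "\<lambda>(ep, e). adapted_coframe b k ep e" "(ep, e)"] adapted by (simp add: eq)
  then interpret other: null_frame b k ep' e'
  proof unfold_locales
    show "v = 0" if "\<And>w. b v w = 0" for v using that by (rule nondegenerate)
  qed (use dim in simp_all)
  let ?p = "DIM('e) - 2" and ?k = "covector k"
  have part: "transverse_part b ep' (?k \<and>\<^sub>w \<gamma>) = \<gamma> - ?k \<and>\<^sub>w contract_vec (sharp b ep') \<gamma>" for \<gamma>
    by (simp add: transverse_part_def contract_covector_wedge other.sharp_ep)
  have contr: "contract_vec (other.E i) (\<gamma> - ?k \<and>\<^sub>w \<delta>) =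
    contract_vec (other.E i) \<gamma> + ?k \<and>\<^sub>w contract_vec (other.E i) \<delta>" if "i < ?p" for i \<gamma> \<delta>
    by (simp add: contract_covector_wedge other.sharp_e[OF that])
  have drop: "?k \<and>\<^sub>w (\<gamma> + ?k \<and>\<^sub>w \<gamma>') \<and>\<^sub>w (\<delta> + ?k \<and>\<^sub>w \<delta>') = ?k \<and>\<^sub>w \<gamma> \<and>\<^sub>w \<delta>" for \<gamma> \<gamma>' \<delta> \<delta>'
    by (simp add: wedge_add_left wedge_add_right wedge_assoc covector_wedge_wedge_self
        covector_wedge_swap[of \<gamma>])
  have "null_prod_at b k (?k \<and>\<^sub>w \<alpha>) (?k \<and>\<^sub>w \<beta>) = ?k \<and>\<^sub>w frame_contraction ?p other.E
      (\<alpha> - ?k \<and>\<^sub>w contract_vec (sharp b ep') \<alpha>) (\<beta> - ?k \<and>\<^sub>w contract_vec (sharp b ep') \<beta>)"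
  proof -
    have "transverse_contraction b e' \<gamma> \<delta> = frame_contraction ?p other.E \<gamma> \<delta>" for \<gamma> \<delta> :: "('e, real) tensor"
      by (simp add: fun_eq_iff transverse_contraction_def frame_contraction_def sum_fun_apply)
    then show ?thesis by (simp add: null_prod_at_def eq part)
  qed
  also have "\<dots> = ?k \<and>\<^sub>w frame_contraction ?p other.E \<alpha> \<beta>"
    unfolding frame_contraction_def wedge_sum_right
    by (intro sum.cong HOL.refl) (simp only: lessThan_iff contr drop)
  also have "\<dots> = ?k \<and>\<^sub>w C \<alpha> \<beta>"
    using frame_contraction_independent[OF other.null_frame_axioms assms] by simp
  finally show ?thesis .
qed

end

section \<open>Algebras of null forms\<close>

locale null_frame_field =
  fixes g :: "'m \<Rightarrow> 'e::euclidean_space \<Rightarrow> 'e \<Rightarrow> real" and \<kappa> :: "'m \<Rightarrow> 'e \<Rightarrow> real"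
    and ep :: "'m \<Rightarrow> 'e \<Rightarrow> real" and e :: "'m \<Rightarrow> nat \<Rightarrow> 'e \<Rightarrow> real"
  assumes null_frames: "null_frame (g x) (\<kappa> x) (ep x) (e x)"
begin

sublocale at: null_frame "g x" "\<kappa> x" "ep x" "e x" for x
  by (rule null_frames)

definition null_of :: "('m, 'e) tensor_field \<Rightarrow> ('m, 'e) tensor_field" where
  "null_of \<tau> = (\<lambda>x. covector (\<kappa> x) \<and>\<^sub>w \<tau> x)"

lemma null_prod_null_of:
  assumes "\<And>x. transverse (DIM('e) - 2) (e x) (\<tau> x)" "\<And>x. transverse (DIM('e) - 2) (e x) (\<sigma> x)"
  shows "null_prod g \<kappa> (null_of \<tau>) (null_of \<sigma>) = null_of (\<lambda>x. at.C x (\<tau> x) (\<sigma> x))"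
  by (simp add: null_prod_def null_of_def at.null_prod_at_covector_wedge assms)

text \<open>
  The degree of a null form exceeds that of its representative by one, so the sign of the bracket is
  the grade involution on representatives.
\<close>
lemma null_bracket_null_of:
  assumes "\<And>x. transverse (DIM('e) - 2) (e x) (\<tau> x)" "\<And>x. transverse (DIM('e) - 2) (e x) (\<sigma> x)"
  shows "null_bracket g \<kappa> (null_of \<tau>) (null_of \<sigma>) = null_of (\<lambda>x. at.C x (grade_inv (\<tau> x)) (\<sigma> x))"
proof -
  have "(\<lambda>x vs. (- 1) ^ (length vs + 1) * null_of \<tau> x vs) = null_of (\<lambda>x. grade_inv (\<tau> x))"
  proof
    fix x
    have "(\<lambda>vs. (- 1) ^ (length vs + 1) * null_of \<tau> x vs) = - grade_inv (null_of \<tau> x)"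
      by (simp add: fun_eq_iff grade_inv_def pointwise)
    then show "(\<lambda>vs. (- 1) ^ (length vs + 1) * null_of \<tau> x vs) = null_of (\<lambda>x. grade_inv (\<tau> x)) x"
      by (simp add: null_of_def)
  qed
  then show ?thesis
    unfolding null_bracket_def by (simp add: null_prod_null_of assms transverse_grade_inv)
qed

lemma null_of_add: "(\<lambda>x vs. null_of \<tau> x vs + null_of \<sigma> x vs) = null_of (\<lambda>x. \<tau> x + \<sigma> x)"
  by (simp add: null_of_def wedge_add_right fun_eq_iff pointwise)

lemma null_of_scale: "(\<lambda>x vs. c * null_of \<tau> x vs) = null_of (\<lambda>x. c *\<^sub>t \<tau> x)"
  by (simp add: null_of_def fun_eq_iff tscale_def[symmetric])

lemma null_of_zero: "(\<lambda>x vs. 0) = null_of (\<lambda>x. 0)"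
  by (simp add: null_of_def fun_eq_iff pointwise)

lemma null_of_unit: "(\<lambda>x. covector (\<kappa> x)) = null_of (\<lambda>x. one_form_unit)"
  by (simp add: null_of_def)

lemma null_closure_add:
  "null_of \<tau> \<in> null_closure g \<kappa> S \<Longrightarrow> null_of \<sigma> \<in> null_closure g \<kappa> S
    \<Longrightarrow> null_of (\<lambda>x. \<tau> x + \<sigma> x) \<in> null_closure g \<kappa> S"
  using null_closure.add[of "null_of \<tau>" g \<kappa> S "null_of \<sigma>"] by (simp add: null_of_add)

lemma null_closure_scale:
  "null_of \<tau> \<in> null_closure g \<kappa> S \<Longrightarrow> null_of (\<lambda>x. c *\<^sub>t \<tau> x) \<in> null_closure g \<kappa> S"
  using null_closure.scale[of "null_of \<tau>" g \<kappa> S c] by (simp add: null_of_scale)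

lemma null_closure_contraction:
  "null_of \<tau> \<in> null_closure g \<kappa> S \<Longrightarrow> null_of \<sigma> \<in> null_closure g \<kappa> S
    \<Longrightarrow> (\<And>x. transverse (DIM('e) - 2) (e x) (\<tau> x)) \<Longrightarrow> (\<And>x. transverse (DIM('e) - 2) (e x) (\<sigma> x))
    \<Longrightarrow> null_of (\<lambda>x. at.C x (\<tau> x) (\<sigma> x)) \<in> null_closure g \<kappa> S"
  using null_closure.prod[of "null_of \<tau>" g \<kappa> S "null_of \<sigma>"] by (simp add: null_prod_null_of)

end

text \<open>
  The linear map \<open>T\<close> sends an element of \<open>M\<close> to a field of transverse forms; the assumptions say that it
  is an injective homomorphism for the bracket, compatible with parity, and that the corresponding null
  forms contain the generators \<open>S\<close> and are generated by them.  The value on the empty list is the component of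
  degree zero; as it vanishes, \<open>\<kappa>\<close> itself is not among the null forms.
\<close>
locale null_model = null_frame_field g \<kappa> ep e
  for g :: "'m \<Rightarrow> 'e::euclidean_space \<Rightarrow> 'e \<Rightarrow> real" and \<kappa> ep e +
  fixes S :: "('m, 'e) tensor_field set" and M :: "'b lie_superalgebra"
    and T :: "'b \<Rightarrow> ('m, 'e) tensor_field"
  assumes carrier_nonempty: "lsa_carrier M \<noteq> {}"
    and add_closed: "u \<in> lsa_carrier M \<Longrightarrow> v \<in> lsa_carrier M \<Longrightarrow> lsa_add M u v \<in> lsa_carrier M"
    and T_add: "u \<in> lsa_carrier M \<Longrightarrow> v \<in> lsa_carrier M \<Longrightarrow> T (lsa_add M u v) x = T u x + T v x"
    and scale_closed: "u \<in> lsa_carrier M \<Longrightarrow> lsa_scale M c u \<in> lsa_carrier M"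
    and T_scale: "u \<in> lsa_carrier M \<Longrightarrow> T (lsa_scale M c u) x = c *\<^sub>t T u x"
    and bracket_closed: "u \<in> lsa_carrier M \<Longrightarrow> v \<in> lsa_carrier M \<Longrightarrow> lsa_bracket M u v \<in> lsa_carrier M"
    and T_bracket: "u \<in> lsa_carrier M \<Longrightarrow> v \<in> lsa_carrier M
      \<Longrightarrow> T (lsa_bracket M u v) x = at.C x (grade_inv (T u x)) (T v x)"
    and T_transverse: "u \<in> lsa_carrier M \<Longrightarrow> transverse (DIM('e) - 2) (e x) (T u x)"
    and T_inject: "u \<in> lsa_carrier M \<Longrightarrow> v \<in> lsa_carrier M \<Longrightarrow> T u = T v \<Longrightarrow> u = v"
    and T_Nil: "u \<in> lsa_carrier M \<Longrightarrow> T u x [] = 0"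
    and even_carrier: "lsa_even M \<subseteq> lsa_carrier M"
    and odd_carrier: "lsa_odd M \<subseteq> lsa_carrier M"
    and T_even: "u \<in> lsa_even M \<Longrightarrow> grade_inv (T u x) = T u x"
    and T_odd: "u \<in> lsa_odd M \<Longrightarrow> grade_inv (T u x) = - T u x"
    and even_odd_split: "u \<in> lsa_carrier M \<Longrightarrow> \<exists>v\<in>lsa_even M. \<exists>w\<in>lsa_odd M. u = lsa_add M v w"
    and generators: "\<phi> \<in> S \<Longrightarrow> \<exists>u\<in>lsa_carrier M. \<phi> = null_of (T u)"
    and generated: "u \<in> lsa_carrier M \<Longrightarrow> null_of (T u) \<in> null_closure g \<kappa> S"
begin

lemma T_zero: "\<exists>u\<in>lsa_carrier M. \<forall>x. T u x = 0"
  using carrier_nonempty scale_closed[of _ 0] T_scale[of _ 0] by (metis all_not_in_conv tscale_zero(1))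

text \<open>
  The product differs from the bracket by the grade involution of the first factor, which is
  undone by changing the sign of the odd part.
\<close>
lemma T_contraction:
  assumes "u \<in> lsa_carrier M" "v \<in> lsa_carrier M"
  shows "\<exists>w\<in>lsa_carrier M. \<forall>x. at.C x (T u x) (T v x) = T w x"
proof -
  obtain u0 u1 where u: "u0 \<in> lsa_even M" "u1 \<in> lsa_odd M" "u = lsa_add M u0 u1"
    using even_odd_split[OF assms(1)] by blast
  define u' where "u' = lsa_add M u0 (lsa_scale M (- 1) u1)"
  have mem: "u0 \<in> lsa_carrier M" "u1 \<in> lsa_carrier M"
    using u even_carrier odd_carrier by auto
  then have u': "u' \<in> lsa_carrier M" unfolding u'_def by (intro add_closed scale_closed)
  have "grade_inv (T u' x) = T u x" for x
    using mem by (simp add: u u'_def T_add T_scale scale_closed T_even T_odd)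
  then show ?thesis using T_bracket[OF u' assms(2)] bracket_closed[OF u' assms(2)] by metis
qed

lemma null_closure_eq: "null_closure g \<kappa> S = (\<lambda>u. null_of (T u)) ` lsa_carrier M"
proof
  show "(\<lambda>u. null_of (T u)) ` lsa_carrier M \<subseteq> null_closure g \<kappa> S"
    using generated by blast
  have "\<exists>u\<in>lsa_carrier M. \<phi> = null_of (T u)" if "\<phi> \<in> null_closure g \<kappa> S" for \<phi>
    using that
  proof induction
    case (gen \<phi>)
    then show ?case by (rule generators)
  next
    case zero
    obtain u where "u \<in> lsa_carrier M" "\<forall>x. T u x = 0" using T_zero by blast
    then show ?case by (intro bexI[of _ u]) (auto simp: null_of_zero null_of_def)
  next
    case (add \<phi> \<psi>)
    then obtain u v where "u \<in> lsa_carrier M" "v \<in> lsa_carrier M" "\<phi> = null_of (T u)" "\<psi> = null_of (T v)"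
      by blast
    then show ?case
      by (intro bexI[of _ "lsa_add M u v"]) (simp_all only: null_of_add add_closed, simp add: null_of_def T_add)
  next
    case (scale \<phi> c)
    then obtain u where "u \<in> lsa_carrier M" "\<phi> = null_of (T u)" by blast
    then show ?case
      by (intro bexI[of _ "lsa_scale M c u"]) (simp_all only: null_of_scale scale_closed, simp add: null_of_def T_scale)
  next
    case (prod \<phi> \<psi>)
    then obtain u v where uv: "u \<in> lsa_carrier M" "v \<in> lsa_carrier M" "\<phi> = null_of (T u)" "\<psi> = null_of (T v)"
      by blast
    then obtain w where "w \<in> lsa_carrier M" "\<forall>x. at.C x (T u x) (T v x) = T w x"
      using T_contraction by blast
    with uv show ?case
      by (intro bexI[of _ w]) (simp_all add: null_prod_null_of T_transverse)
  qed
  then show "null_closure g \<kappa> S \<subseteq> (\<lambda>u. null_of (T u)) ` lsa_carrier M" by blast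
qed

lemma null_of_inject:
  assumes "u \<in> lsa_carrier M" "v \<in> lsa_carrier M" "null_of (T u) = null_of (T v)"
  shows "u = v"
proof (rule T_inject[OF assms(1,2)])
  show "T u = T v"
    using at.covector_wedge_inject[OF T_transverse[OF assms(1)] T_transverse[OF assms(2)]]
      fun_cong[OF assms(3)] by (auto simp: null_of_def)
qed

lemma bracket_null_of:
  assumes "u \<in> lsa_carrier M" "v \<in> lsa_carrier M"
  shows "null_bracket g \<kappa> (null_of (T u)) (null_of (T v)) = null_of (T (lsa_bracket M u v))"
proof -
  have "(\<lambda>x. at.C x (grade_inv (T u x)) (T v x)) = T (lsa_bracket M u v)"
    by (rule ext) (simp add: T_bracket assms)
  then show ?thesis by (simp add: null_bracket_null_of T_transverse assms)
qed

lemma covector_notin_null_closure: "(\<lambda>x. covector (\<kappa> x)) \<notin> null_closure g \<kappa> S"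
proof
  assume "(\<lambda>x. covector (\<kappa> x)) \<in> null_closure g \<kappa> S"
  then obtain u where u: "u \<in> lsa_carrier M" "(\<lambda>x. covector (\<kappa> x)) = null_of (T u)"
    unfolding null_closure_eq by blast
  fix x
  let ?v = "sharp (g x) (ep x)"
  have "covector (\<kappa> x) [?v] = (covector (\<kappa> x) \<and>\<^sub>w T u x) [?v]"
    using fun_cong[OF u(2), of x] by (simp add: null_of_def)
  also have "\<dots> = 0"
    by (simp add: wedge_Cons wedge_Nil tscale_def pointwise T_Nil u(1))
  finally show False by (simp add: covector_def at.sharp_ep)
qed

text \<open>
  The form \<open>\<kappa>\<close> is represented by the constant \<open>1\<close>, whose contractions are zero, so that its product with
  every null form vanishes.
\<close>
lemma null_closure_insert_covector:
  "null_closure g \<kappa> (insert (\<lambda>x. covector (\<kappa> x)) S) =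
     {(\<lambda>x vs. \<phi> x vs + c * covector (\<kappa> x) vs) | \<phi> c. \<phi> \<in> null_closure g \<kappa> S}" (is "?L = ?R")
proof
  have R: "\<phi> \<in> ?R \<longleftrightarrow> (\<exists>u\<in>lsa_carrier M. \<exists>c. \<phi> = null_of (\<lambda>x. T u x + c *\<^sub>t one_form_unit))" for \<phi>
  proof -
    have sum: "(\<lambda>x vs. null_of (T u) x vs + c * covector (\<kappa> x) vs) = null_of (\<lambda>x. T u x + c *\<^sub>t one_form_unit)" for u c
      by (simp add: null_of_def wedge_add_right fun_eq_iff pointwise tscale_def)
    show ?thesis
    proof
      assume "\<phi> \<in> ?R"
      then obtain \<psi> c where \<psi>: "\<psi> \<in> null_closure g \<kappa> S" "\<phi> = (\<lambda>x vs. \<psi> x vs + c * covector (\<kappa> x) vs)"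
        by blast
      then obtain u where "u \<in> lsa_carrier M" "\<psi> = null_of (T u)"
        unfolding null_closure_eq by blast
      with \<psi>(2) sum show "\<exists>u\<in>lsa_carrier M. \<exists>c. \<phi> = null_of (\<lambda>x. T u x + c *\<^sub>t one_form_unit)"
        by blast
    next
      assume "\<exists>u\<in>lsa_carrier M. \<exists>c. \<phi> = null_of (\<lambda>x. T u x + c *\<^sub>t one_form_unit)"
      then obtain u c where "u \<in> lsa_carrier M" "\<phi> = (\<lambda>x vs. null_of (T u) x vs + c * covector (\<kappa> x) vs)"
        unfolding sum by blast
      with generated show "\<phi> \<in> ?R" by blast
    qed
  qed
  show "?L \<subseteq> ?R"
  proof
    fix \<phi> assume "\<phi> \<in> ?L"
    then show "\<phi> \<in> ?R"
      unfolding R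
    proof induction
      case (gen \<phi>)
      then consider "\<phi> = null_of (\<lambda>x. one_form_unit)" | "\<phi> \<in> S" by (auto simp: null_of_unit)
      then show ?case
      proof cases
        case 1
        obtain u where "u \<in> lsa_carrier M" "\<forall>x. T u x = 0" using T_zero by blast
        with 1 show ?thesis by (intro bexI[of _ u] exI[of _ 1]) simp_all
      next
        case 2
        then obtain u where "u \<in> lsa_carrier M" "\<phi> = null_of (T u)" using generators by blast
        then show ?thesis by (intro bexI[of _ u] exI[of _ 0]) simp_all
      qed
    next
      case zero
      obtain u where "u \<in> lsa_carrier M" "\<forall>x. T u x = 0" using T_zero by blast
      then show ?case by (intro bexI[of _ u] exI[of _ 0]) (simp_all add: null_of_zero)
    next
      case (add \<phi> \<psi>)
      then obtain u c v d where "u \<in> lsa_carrier M" "v \<in> lsa_carrier M"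
        "\<phi> = null_of (\<lambda>x. T u x + c *\<^sub>t one_form_unit)" "\<psi> = null_of (\<lambda>x. T v x + d *\<^sub>t one_form_unit)"
        by blast
      then show ?case
        by (intro bexI[of _ "lsa_add M u v"] exI[of _ "c + d"])
           (simp_all only: null_of_add add_closed T_add tscale_add_left add.assoc add.left_commute)
    next
      case (scale \<phi> c)
      then obtain u d where "u \<in> lsa_carrier M" "\<phi> = null_of (\<lambda>x. T u x + d *\<^sub>t one_form_unit)" by blast
      then show ?case
        by (intro bexI[of _ "lsa_scale M c u"] exI[of _ "c * d"])
           (simp_all only: null_of_scale scale_closed T_scale tscale_add_right tscale_tscale)
    next
      case (prod \<phi> \<psi>)
      then obtain u c v d where uv: "u \<in> lsa_carrier M" "v \<in> lsa_carrier M"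
        "\<phi> = null_of (\<lambda>x. T u x + c *\<^sub>t one_form_unit)" "\<psi> = null_of (\<lambda>x. T v x + d *\<^sub>t one_form_unit)"
        by blast
      have unit: "at.C x one_form_unit \<beta> = 0" "at.C x \<beta> one_form_unit = 0" for x \<beta>
        by (simp_all add: frame_contraction_def)
      obtain w where "w \<in> lsa_carrier M" "\<forall>x. at.C x (T u x) (T v x) = T w x"
        using T_contraction[OF uv(1,2)] by blast
      with uv show ?case
        by (intro bexI[of _ w] exI[of _ 0])
           (simp_all add: null_prod_null_of T_transverse transverse.intros
             frame_contraction_add_left frame_contraction_add_right unit)
    qed
  qed
  show "?R \<subseteq> ?L"
  proof safe
    fix \<phi> c assume "\<phi> \<in> null_closure g \<kappa> S"
    then have "\<phi> \<in> ?L"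
      by induction (auto intro: null_closure.intros)
    moreover have "(\<lambda>x. covector (\<kappa> x)) \<in> ?L" by (auto intro: null_closure.gen)
    ultimately show "(\<lambda>x vs. \<phi> x vs + c * covector (\<kappa> x) vs) \<in> ?L"
      by (intro null_closure.add null_closure.scale)
  qed
qed

lemma null_of_parity:
  assumes "\<And>x. grade_inv (\<tau> x) = s *\<^sub>t \<tau> x" "s * (- 1) ^ (length vs + 1) \<noteq> 1"
  shows "null_of \<tau> x vs = 0"
proof -
  have "grade_inv (null_of \<tau> x) = - (s *\<^sub>t null_of \<tau> x)"
    by (simp add: null_of_def assms(1))
  then have "(- 1) ^ length vs * null_of \<tau> x vs = - s * null_of \<tau> x vs"
    by (auto simp: fun_eq_iff grade_inv_def tscale_def pointwise)
  then have "((- 1) ^ length vs + s) * null_of \<tau> x vs = 0" by (simp add: algebra_simps)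
  moreover have "(- 1) ^ length vs + s \<noteq> 0"
    using assms(2) by (cases "even (length vs)") (auto simp: add_eq_0_iff)
  ultimately show ?thesis by simp
qed

text \<open>
  If a null form vanishes on lists of even length, the odd part of its preimage is mapped to zero, so
  the form has the same preimage as its even part.
\<close>
lemma even_odd_null_of:
  assumes "u \<in> lsa_carrier M"
  shows "(\<forall>x vs. even (length vs) \<longrightarrow> null_of (T u) x vs = 0) \<longleftrightarrow> u \<in> lsa_even M"
    "(\<forall>x vs. odd (length vs) \<longrightarrow> null_of (T u) x vs = 0) \<longleftrightarrow> u \<in> lsa_odd M"
proof -
  obtain u0 u1 where u: "u0 \<in> lsa_even M" "u1 \<in> lsa_odd M" "u = lsa_add M u0 u1"
    using even_odd_split[OF assms] by blast
  have mem: "u0 \<in> lsa_carrier M" "u1 \<in> lsa_carrier M"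
    using u even_carrier odd_carrier by auto
  have even_0: "null_of (T v) x vs = 0" if "v \<in> lsa_even M" "even (length vs)" for v x vs
    by (rule null_of_parity[where s = 1]) (use that T_even in auto)
  have odd_0: "null_of (T v) x vs = 0" if "v \<in> lsa_odd M" "odd (length vs)" for v x vs
    by (rule null_of_parity[where s = "- 1"]) (use that T_odd in auto)
  have sum: "null_of (T u) x vs = null_of (T u0) x vs + null_of (T u1) x vs" for x vs
    unfolding u(3) by (simp add: null_of_def T_add mem wedge_add_right pointwise)
  show "(\<forall>x vs. even (length vs) \<longrightarrow> null_of (T u) x vs = 0) \<longleftrightarrow> u \<in> lsa_even M"
  proof
    assume *: "\<forall>x vs. even (length vs) \<longrightarrow> null_of (T u) x vs = 0"
    have "null_of (T u) = null_of (T u0)"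
    proof (intro ext)
      show "null_of (T u) x vs = null_of (T u0) x vs" for x vs
        using * even_0[OF u(1)] odd_0[OF u(2)] sum by (cases "even (length vs)") auto
    qed
    then show "u \<in> lsa_even M" using null_of_inject[OF assms mem(1)] u by simp
  qed (use even_0 in blast)
  show "(\<forall>x vs. odd (length vs) \<longrightarrow> null_of (T u) x vs = 0) \<longleftrightarrow> u \<in> lsa_odd M"
  proof
    assume *: "\<forall>x vs. odd (length vs) \<longrightarrow> null_of (T u) x vs = 0"
    have "null_of (T u) = null_of (T u1)"
    proof (intro ext)
      show "null_of (T u) x vs = null_of (T u1) x vs" for x vs
        using * even_0[OF u(1)] odd_0[OF u(2)] sum by (cases "even (length vs)") auto
    qed
    then show "u \<in> lsa_odd M" using null_of_inject[OF assms mem(2)] u by simp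
  qed (use odd_0 in blast)
qed

theorem null_algebra_iso: "null_algebra g \<kappa> S \<simeq>\<^sub>L M"
proof -
  define f where "f u = null_of (T u)" for u
  define h where "h = inv_into (lsa_carrier M) f"
  have inj: "inj_on f (lsa_carrier M)"
    unfolding f_def by (intro inj_onI null_of_inject)
  have carrier: "null_closure g \<kappa> S = f ` lsa_carrier M"
    unfolding f_def by (rule null_closure_eq)
  have h: "h (f u) = u" if "u \<in> lsa_carrier M" for u
    unfolding h_def by (rule inv_into_f_f[OF inj that])
  have bij: "bij_betw h (null_closure g \<kappa> S) (lsa_carrier M)"
    unfolding h_def carrier by (rule bij_betw_inv_into) (simp add: bij_betw_def inj)
  have add: "(\<lambda>x vs. f u x vs + f v x vs) = f (lsa_add M u v)"
    if "u \<in> lsa_carrier M" "v \<in> lsa_carrier M" for u v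
    unfolding f_def null_of_add by (simp add: null_of_def T_add that)
  have scale: "(\<lambda>x vs. c * f u x vs) = f (lsa_scale M c u)" if "u \<in> lsa_carrier M" for c u
    unfolding f_def null_of_scale by (simp add: null_of_def T_scale that)
  have even: "{\<phi> \<in> null_closure g \<kappa> S. \<forall>x vs. even (length vs) \<longrightarrow> \<phi> x vs = 0} = f ` lsa_even M"
    unfolding carrier using even_odd_null_of(1) even_carrier by (fastforce simp: f_def)
  have odd: "{\<phi> \<in> null_closure g \<kappa> S. \<forall>x vs. odd (length vs) \<longrightarrow> \<phi> x vs = 0} = f ` lsa_odd M"
    unfolding carrier using even_odd_null_of(2) odd_carrier by (fastforce simp: f_def)
  have image: "h ` f ` U = U" if "U \<subseteq> lsa_carrier M" for U
    using h that by (force simp: image_iff)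
  show ?thesis
    unfolding lsa_iso_def
  proof (rule exI[of _ h], intro conjI ballI allI)
    show "bij_betw h (lsa_carrier (null_algebra g \<kappa> S)) (lsa_carrier M)"
      using bij by (simp add: null_algebra_def)
    show "h ` lsa_even (null_algebra g \<kappa> S) = lsa_even M" "h ` lsa_odd (null_algebra g \<kappa> S) = lsa_odd M"
      using image even_carrier odd_carrier by (simp_all add: null_algebra_def even odd)
    fix \<phi> assume "\<phi> \<in> lsa_carrier (null_algebra g \<kappa> S)"
    then obtain u where u: "u \<in> lsa_carrier M" "\<phi> = f u"
      by (auto simp: null_algebra_def carrier)
    show "h (lsa_scale (null_algebra g \<kappa> S) c \<phi>) = lsa_scale M c (h \<phi>)" for c
      using u by (simp add: null_algebra_def scale h scale_closed)
    fix \<psi> assume "\<psi> \<in> lsa_carrier (null_algebra g \<kappa> S)"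
    then obtain v where v: "v \<in> lsa_carrier M" "\<psi> = f v"
      by (auto simp: null_algebra_def carrier)
    show "h (lsa_add (null_algebra g \<kappa> S) \<phi> \<psi>) = lsa_add M (h \<phi>) (h \<psi>)"
      using u v by (simp add: null_algebra_def add h add_closed)
    show "h (lsa_bracket (null_algebra g \<kappa> S) \<phi> \<psi>) = lsa_bracket M (h \<phi>) (h \<psi>)"
      using u v by (simp add: null_algebra_def h bracket_closed bracket_null_of f_def[symmetric]
          bracket_null_of[folded f_def])
  qed
qed

end


section \<open>The algebras of the fundamental forms\<close>

context null_frame_field
begin

text \<open>
  A single generator whose product with itself is zero.
\<close>
lemma line_model:
  assumes "\<And>x. transverse (DIM('e) - 2) (e x) (\<psi> x)" "\<And>x. has_degree d (\<psi> x)" "d > 0"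
    and "\<And>x. at.C x (\<psi> x) (\<psi> x) = 0" "\<And>x. \<psi> x \<noteq> 0"
  shows "null_model g \<kappa> ep e {null_of \<psi>} (line_alg (odd d)) (\<lambda>c x. c *\<^sub>t \<psi> x)"
proof -
  have grade: "grade_inv (\<psi> x) = (- 1) ^ d *\<^sub>t \<psi> x" for x
    using has_parity_if_has_degree[OF assms(2)] by (simp add: has_parity_def)
  have Nil: "\<psi> x [] = 0" for x
    using assms(2)[of x] assms(3) by (simp add: has_degree_def)
  have inj: "c = d" if "(\<lambda>x. c *\<^sub>t \<psi> x) = (\<lambda>x. d *\<^sub>t \<psi> x)" for c d
  proof -
    fix x
    obtain vs where "\<psi> x vs \<noteq> 0" using assms(5)[of x] by (auto simp: fun_eq_iff pointwise)
    then show "c = d" using fun_cong[OF fun_cong[OF that], of x vs] by (simp add: tscale_def)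
  qed
  show ?thesis
  proof (unfold_locales, goal_cases)
    case 7 then show ?case by (simp add: line_alg_def grade assms(4))
  next
    case (9 u v) then show ?case using inj by blast
  next
    case (10 u x) then show ?case by (simp add: tscale_def Nil)
  next
    case (15 u) then show ?case
      by (cases "odd d") (auto simp: line_alg_def)
  next
    case (16 \<phi>) then show ?case by (intro bexI[of _ 1]) (auto simp: line_alg_def)
  next
    case (17 u) then show ?case by (intro null_closure_scale null_closure.gen) simp
  qed (auto simp: line_alg_def tscale_add_left grade transverse.scale assms(1) split: if_splits)
qed

text \<open>
  The factor \<open>- 1 / n\<close> normalizes the rotation generator, as \<open>\<omega>\<close> rotates \<open>\<chi>1\<close> and \<open>\<chi>2\<close> with
  speed \<open>n\<close>.
\<close>
definition su_field :: "nat \<Rightarrow> real \<times> real \<times> real \<times> real \<Rightarrow> ('m, 'e) tensor_field" where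
  "su_field n = (\<lambda>(r, a, b, c) x. (- r / of_nat n) *\<^sub>t kahler_form n (e x) +
     a *\<^sub>t complex_dual_frame.\<chi>1 (e x) n + b *\<^sub>t complex_dual_frame.\<chi>2 (e x) n +
     c *\<^sub>t complex_dual_frame.W (DIM('e) - 2) (e x) (at.E x) n)"

text \<open>
  The parity of \<open>n\<close> decides whether \<open>\<chi>1\<close> and \<open>\<chi>2\<close> are even or odd and which of their products survive.
\<close>
lemma
  assumes dim: "DIM('e) - 2 = 2 * n" and n: "n \<ge> 3"
    and S: "S = {null_of (\<lambda>x. kahler_form n (e x)),
      null_of (\<lambda>x vs. Re (holomorphic_volume n (e x) vs)),
      null_of (\<lambda>x vs. Im (holomorphic_volume n (e x) vs))}"
  shows e2_hat_model: "even n \<Longrightarrow> null_model g \<kappa> ep e S e2_hat (su_field n)"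
    and s2_alg_model: "odd n \<Longrightarrow> null_model g \<kappa> ep e S s2_alg (su_field n)"
proof -
  interpret su: complex_dual_frame "DIM('e) - 2" "e x" "at.E x" n for x
    by unfold_locales (rule dim)
  have T: "su_field n (r, a, b, c) x = (- r / of_nat n) *\<^sub>t kahler_form n (e x) +
     a *\<^sub>t su.\<chi>1 x + b *\<^sub>t su.\<chi>2 x + c *\<^sub>t su.W x" for r a b c x
    by (simp add: su_field_def)
  have add: "su_field n (u + v) x = su_field n u x + su_field n v x" for u v x
    by (cases u; cases v)
       (simp add: T fun_eq_iff pointwise tscale_def add_divide_distrib diff_divide_distrib algebra_simps)
  have scale: "su_field n (c *\<^sub>R u) x = c *\<^sub>t su_field n u x" for c u x
    by (cases u) (simp add: T fun_eq_iff pointwise tscale_def algebra_simps)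
  have zero: "su_field n 0 x = 0" for x
    using scale[of 0 0 x] by simp
  have grade: "grade_inv (su_field n (r, a, b, c) x) = su_field n (r, (- 1) ^ n * a, (- 1) ^ n * b, c) x"
    for r a b c x
  proof -
    have "grade_inv (kahler_form n (e x) :: ('e, real) tensor) = kahler_form n (e x)"
      using has_parity_if_has_degree[OF has_degree_kahler_form, of n "e x"] by (simp add: has_parity_def)
    moreover have "grade_inv (su.\<chi>1 x) = (- 1) ^ n *\<^sub>t su.\<chi>1 x" "grade_inv (su.\<chi>2 x) = (- 1) ^ n *\<^sub>t su.\<chi>2 x"
      using has_parity_if_has_degree[OF su.has_degree_\<chi>(1)] has_parity_if_has_degree[OF su.has_degree_\<chi>(2)]
      by (simp_all add: has_parity_def)
    moreover have "grade_inv (su.W x) = su.W x"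
      using has_parity_if_has_degree[OF su.has_degree_W, of x] n by (simp add: has_parity_def)
    ultimately show ?thesis by (simp add: T mult.commute)
  qed
  have transverse: "transverse (DIM('e) - 2) (e x) (su_field n u x)" for u x
  proof (cases u)
    case (fields r a b c)
    show ?thesis
      unfolding fields T
      by (intro transverse.add transverse.scale su.transverse_\<chi> su.transverse_W transverse_kahler_form)
        (simp add: dim)
  qed
  have inj: "u = v" if "su_field n u = su_field n v" for u v
  proof -
    fix x
    obtain r a b c where uv: "u - v = (r, a, b, c)" by (cases "u - v")
    have "su_field n (u - v) x = su_field n u x - su_field n v x"
      using add[of "u - v" v x] by simp
    then have "(- r / of_nat n) *\<^sub>t kahler_form n (e x) + a *\<^sub>t su.\<chi>1 x + b *\<^sub>t su.\<chi>2 x + c *\<^sub>t su.W x = 0"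
      by (simp only: uv T that diff_self)
    from su.special_unitary_independent[OF n this] n have "u - v = 0"
      by (simp add: uv zero_prod_def)
    then show "u = v" by simp
  qed
  have Nil: "su_field n u x [] = 0" for u x
  proof -
    have "kahler_form n (e x) [] = (0 :: real)"
      by (rule has_degree_kahler_form[unfolded has_degree_def, rule_format]) simp
    moreover have "su.\<chi>1 x [] = 0" "su.\<chi>2 x [] = 0" "su.W x [] = 0"
      using su.has_degree_\<chi>[of x] su.has_degree_W[of x] n by (simp_all add: has_degree_def)
    ultimately show ?thesis by (cases u) (simp add: T pointwise tscale_def)
  qed
  have gens: "null_of (\<lambda>x. kahler_form n (e x)) = null_of (su_field n (- of_nat n, 0, 0, 0))"
    "null_of (\<lambda>x vs. Re (holomorphic_volume n (e x) vs)) = null_of (su_field n (0, 1, 0, 0))"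
    "null_of (\<lambda>x vs. Im (holomorphic_volume n (e x) vs)) = null_of (su_field n (0, 0, 1, 0))"
    using n by (simp_all add: null_of_def T su.\<chi>1_def su.\<chi>2_def)
  have mem: "null_of (\<lambda>x. kahler_form n (e x)) \<in> null_closure g \<kappa> S"
    "null_of su.\<chi>1 \<in> null_closure g \<kappa> S" "null_of su.\<chi>2 \<in> null_closure g \<kappa> S"
    unfolding S su.\<chi>1_def su.\<chi>2_def by (intro null_closure.gen; simp)+
  have "null_of (\<lambda>x. at.C x (su.\<chi>1 x) (su.\<chi>2 x)) \<in> null_closure g \<kappa> S"
    "null_of (\<lambda>x. (- 1) *\<^sub>t at.C x (su.\<chi>1 x) (su.\<chi>1 x)) \<in> null_closure g \<kappa> S"
    by (intro null_closure_contraction null_closure_scale mem su.transverse_\<chi>)+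
  then have W: "null_of su.W \<in> null_closure g \<kappa> S"
    by (cases "even n") (simp_all add: su.W_def[abs_def])
  have generated: "null_of (su_field n u) \<in> null_closure g \<kappa> S" for u
  proof (cases u)
    case (fields r a b c)
    show ?thesis
      unfolding fields su_field_def prod.case
      by (intro null_closure_add null_closure_scale mem W)
  qed
  note table = frame_contraction_add_left frame_contraction_add_right
    frame_contraction_scale_left frame_contraction_scale_right su.frame_contraction_W[OF n]
    su.frame_contraction_\<omega>_\<chi> su.frame_contraction_\<chi>_\<omega> at.frame_contraction_kahler_form_self
  have product_even: "at.C x (su_field n (r, a, b, c) x) (su_field n (r', a', b', c') x) =
      su_field n (0, r * b' - b * r', - (r * a' - a * r'), a * b' - b * a') x"
    if "even n" for r a b c r' a' b' c' x
    unfolding T table su.frame_contraction_\<chi>_even[OF that]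
    using that n by (simp add: fun_eq_iff pointwise tscale_def field_simps)
  have product_odd: "at.C x (su_field n (r, - a, - b, c) x) (su_field n (r', a', b', c') x) =
      su_field n (0, r * b' - b * r', - (r * a' - a * r'), a * a' + b * b') x"
    if "odd n" for r a b c r' a' b' c' x
    unfolding T table su.frame_contraction_\<chi>_odd[OF that]
    using that n by (simp add: fun_eq_iff pointwise tscale_def field_simps)
  show "null_model g \<kappa> ep e S e2_hat (su_field n)" if "even n"
  proof (unfold_locales, goal_cases)
    case (7 u v x)
    show ?case
      using that n
      by (cases u; cases v)
         (simp add: e2_hat_def grade product_even)
  next
    case (16 \<phi>)
    then show ?case using gens by (auto simp: S e2_hat_def)
  qed (use that in \<open>auto simp: e2_hat_def add scale zero transverse inj Nil grade generated
      simp del: split_paired_Ex\<close>)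
  show "null_model g \<kappa> ep e S s2_alg (su_field n)" if "odd n"
  proof (unfold_locales, goal_cases)
    case (7 u v x)
    show ?case
      using that n
      by (cases u; cases v)
         (simp add: s2_alg_def grade product_odd)
  next
    case (14 u x)
    then show ?case
      using that by (auto simp: s2_alg_def grade) (simp add: T)
  next
    case (15 u)
    obtain r a b c where "u = (r, a, b, c)" by (cases u)
    then show ?case
      by (intro bexI[of _ "(r, 0, 0, c)"] bexI[of _ "(0, a, b, 0)"]) (auto simp: s2_alg_def)
  next
    case (16 \<phi>)
    then show ?case using gens by (auto simp: S s2_alg_def)
  qed (use that in \<open>auto simp: s2_alg_def add scale transverse inj Nil grade generated\<close>)
qed

text \<open>
  The first row of \<open>quat_mat a b c\<close> consists of \<open>0, a, b, c\<close>.
\<close>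
definition sp_field :: "nat \<Rightarrow> real mat \<Rightarrow> ('m, 'e) tensor_field" where
  "sp_field n M x = (M $$ (0, 1)) *\<^sub>t hyper_form n 1 2 3 (e x) +
     (M $$ (0, 2)) *\<^sub>t hyper_form n 2 3 1 (e x) + (M $$ (0, 3)) *\<^sub>t hyper_form n 3 1 2 (e x)"

lemma sp_alg_model:
  assumes dim: "DIM('e) - 2 = 4 * n" and n: "n \<ge> 1"
    and S: "S = {null_of (\<lambda>x. hyper_form n 1 2 3 (e x)), null_of (\<lambda>x. hyper_form n 2 3 1 (e x)),
      null_of (\<lambda>x. hyper_form n 3 1 2 (e x))}"
  shows "null_model g \<kappa> ep e S (sp_alg 1) (sp_field n)"
proof -
  interpret sp: quaternionic_dual_frame "DIM('e) - 2" "e x" "at.E x" n for x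
    by unfold_locales (rule dim)
  have T: "sp_field n (quat_mat a b c) x = a *\<^sub>t hyper_form n 1 2 3 (e x) +
      b *\<^sub>t hyper_form n 2 3 1 (e x) + c *\<^sub>t hyper_form n 3 1 2 (e x)" for a b c x
    by (simp add: sp_field_def quat_mat_def)
  have cyc: "quaternion_cycle 1 2 3" "quaternion_cycle 2 3 1" "quaternion_cycle 3 1 2"
    by (simp_all add: quaternion_cycle_def)
  have grade_form: "grade_inv (hyper_form n q1 q2 q3 (e x)) = hyper_form n q1 q2 q3 (e x)" for q1 q2 q3 x
    using has_parity_if_has_degree[OF has_degree_hyper_form, of n q1 q2 q3 "e x"]
    by (simp add: has_parity_def)
  have grade: "grade_inv (sp_field n M x) = sp_field n M x" for M x
    by (simp add: sp_field_def grade_form)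
  have zero: "0\<^sub>m 4 4 = quat_mat 0 0 0"
    by (rule eq_matI) (auto simp: quat_mat_def less_Suc_eq numeral_eq_Suc)
  have transverse: "transverse (DIM('e) - 2) (e x) (sp_field n M x)" for M x
    unfolding sp_field_def dim
    by (intro transverse.add transverse.scale transverse_hyper_form) simp_all
  have Nil: "sp_field n M x [] = 0" for M x
  proof -
    have "hyper_form n q1 q2 q3 (e x) [] = 0" for q1 q2 q3
      using has_degree_hyper_form[of n q1 q2 q3 "e x"] by (simp add: has_degree_def)
    then show ?thesis by (simp add: sp_field_def pointwise tscale_def)
  qed
  have inj: "quat_mat a b c = quat_mat a' b' c'"
    if "sp_field n (quat_mat a b c) = sp_field n (quat_mat a' b' c')" for a b c a' b' c'
  proof -
    fix x
    have eval: "sp_field n (quat_mat a b c) x [at.E x (qidx 0 0), at.E x (qidx 0 q)] =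
      (if q = 1 then a else 0) + (if q = 2 then b else 0) + (if q = 3 then c else 0)" if "q < 4" for a b c q
      using that n sp.hyper_form_eval(1)[OF _ cyc(1) that, of x] sp.hyper_form_eval(1)[OF _ cyc(2) that, of x]
        sp.hyper_form_eval(1)[OF _ cyc(3) that, of x]
      unfolding T by (auto simp: pointwise tscale_def)
    show ?thesis
      using that eval[of 1 a b c] eval[of 1 a' b' c'] eval[of 2 a b c] eval[of 2 a' b' c']
        eval[of 3 a b c] eval[of 3 a' b' c']
      by simp
  qed
  have bracket: "at.C x (sp_field n (quat_mat a b c) x) (sp_field n (quat_mat a' b' c') x) =
      sp_field n (quat_mat (2 * (b * c' - c * b')) (2 * (c * a' - a * c')) (2 * (a * b' - b * a'))) x"
    for a b c a' b' c' x
    unfolding T frame_contraction_add_left frame_contraction_add_right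
      frame_contraction_scale_left frame_contraction_scale_right
      sp.frame_contraction_hyper_form_self
      sp.frame_contraction_hyper_form[OF cyc(1)] sp.frame_contraction_hyper_form[OF cyc(2)]
      sp.frame_contraction_hyper_form[OF cyc(3)] sp.frame_contraction_hyper_form_flip[OF cyc(1)]
      sp.frame_contraction_hyper_form_flip[OF cyc(2)] sp.frame_contraction_hyper_form_flip[OF cyc(3)]
    by (simp add: fun_eq_iff pointwise tscale_def algebra_simps)
  have carrier: "M \<in> lsa_carrier (sp_alg 1) \<longleftrightarrow> (\<exists>a b c. M = quat_mat a b c)" for M
    using sp_alg_1_carrier by auto
  have ops: "lsa_add (sp_alg 1) = (+)" "lsa_scale (sp_alg 1) = (\<cdot>\<^sub>m)"
    "lsa_bracket (sp_alg 1) = (\<lambda>X Y. X * Y - Y * X)"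
    "lsa_even (sp_alg 1) = lsa_carrier (sp_alg 1)" "lsa_odd (sp_alg 1) = {quat_mat 0 0 0}"
    by (simp_all add: sp_alg_def Let_def zero)
  have add: "sp_field n (quat_mat a b c + quat_mat a' b' c') x =
      sp_field n (quat_mat a b c) x + sp_field n (quat_mat a' b' c') x" for a b c a' b' c' x
    by (simp add: quat_mat_add T fun_eq_iff pointwise tscale_def algebra_simps)
  have scale: "sp_field n (s \<cdot>\<^sub>m quat_mat a b c) x = s *\<^sub>t sp_field n (quat_mat a b c) x" for s a b c x
    by (simp add: quat_mat_scale T fun_eq_iff pointwise tscale_def algebra_simps)
  have generated: "null_of (sp_field n M) \<in> null_closure g \<kappa> S" for M
    unfolding sp_field_def[abs_def] S
    by (intro null_closure_add null_closure_scale null_closure.gen) simp_all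
  have gens: "null_of (\<lambda>x. hyper_form n 1 2 3 (e x)) = null_of (sp_field n (quat_mat 1 0 0))"
    "null_of (\<lambda>x. hyper_form n 2 3 1 (e x)) = null_of (sp_field n (quat_mat 0 1 0))"
    "null_of (\<lambda>x. hyper_form n 3 1 2 (e x)) = null_of (sp_field n (quat_mat 0 0 1))"
    by (simp_all add: null_of_def T)
  show ?thesis
  proof (unfold_locales, goal_cases)
    case 1 then show ?case unfolding sp_alg_1_carrier by blast
  next
    case 2 then show ?case unfolding carrier ops by (metis quat_mat_add)
  next
    case 3 then show ?case using add unfolding carrier ops by auto
  next
    case 4 then show ?case unfolding carrier ops by (metis quat_mat_scale)
  next
    case 5 then show ?case using scale unfolding carrier ops by auto
  next
    case 6 then show ?case unfolding carrier ops by (metis quat_mat_bracket)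
  next
    case 7 then show ?case using bracket unfolding carrier ops by (auto simp: grade quat_mat_bracket)
  next
    case 8 show ?case by (rule transverse)
  next
    case 9 then show ?case using inj unfolding carrier by blast
  next
    case 10 show ?case by (rule Nil)
  next
    case 11 then show ?case unfolding ops by blast
  next
    case 12 show ?case unfolding ops using carrier by blast
  next
    case 13 show ?case by (rule grade)
  next
    case 14 then show ?case unfolding ops by (auto simp: T)
  next
    case (15 M) then obtain a b c where "M = quat_mat a b c" unfolding carrier by blast
    then have "M = M + quat_mat 0 0 0" by (simp add: quat_mat_add)
    with 15 show ?case unfolding ops by blast
  next
    case (16 \<phi>)
    then have "\<phi> = null_of (sp_field n (quat_mat 1 0 0)) \<or> \<phi> = null_of (sp_field n (quat_mat 0 1 0)) \<or>
      \<phi> = null_of (sp_field n (quat_mat 0 0 1))"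
      unfolding S gens by simp
    then show ?case using carrier by metis
  next
    case 17 show ?case by (rule generated)
  qed
qed

end

lemma (in null_model) null_model_conclusion:
  "null_closure g \<kappa> (insert (\<lambda>x. covector (\<kappa> x)) S) =
     {(\<lambda>x vs. \<phi> x vs + c * covector (\<kappa> x) vs) | \<phi> c. \<phi> \<in> null_closure g \<kappa> S} \<and>
   (\<lambda>x. covector (\<kappa> x)) \<notin> null_closure g \<kappa> S \<and> null_algebra g \<kappa> S \<simeq>\<^sub>L M"
  using null_closure_insert_covector covector_notin_null_closure null_algebra_iso by blast

theorem theorem5p4:
  fixes A :: "('m::{t2_space,second_countable_topology}, 'e::euclidean_space) chart set"
    and g :: "'m \<Rightarrow> 'e \<Rightarrow> 'e \<Rightarrow> real"
    and \<mu> :: "('m, 'e) tensor_field"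
    and X :: "'m \<Rightarrow> 'e"
    and Q :: "'q topology" and q :: "'q \<Rightarrow> 'm \<times> (nat \<Rightarrow> 'e)"
    and \<Gamma> :: "('m, 'e) conn"
    and \<kappa> :: "'m \<Rightarrow> 'e \<Rightarrow> real"
    and K :: structure_group
    and F :: "('m, 'e) tensor_field list"
  assumes manifold: "smooth_atlas A" "simply_connected (UNIV :: 'm set)"
    and lorentzian: "lorentzian_metric A g"
    and oriented: "orientation_form A \<mu>" "time_orientation A g X"
    and spin: "spin_structure A g \<mu> X Q q"
    and connection: "metric_connection A g \<Gamma>"
    and kappa: "parallel_null_one_form A g \<Gamma> \<kappa>"
    and range: "case K of SO n \<Rightarrow> n \<ge> 2 | U n \<Rightarrow> n \<ge> 1 | SU n \<Rightarrow> n \<ge> 3 | Sp n \<Rightarrow> n \<ge> 1 | SpSp1 n \<Rightarrow> n \<ge> 1"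
    and holonomy: "has_holonomy A g \<Gamma> \<kappa> K"
    and forms: "fundamental_forms A g \<Gamma> \<kappa> K F"
  shows
    "null_closure g \<kappa> (insert (\<lambda>x. covector (\<kappa> x)) (set F)) =
       {(\<lambda>x vs. \<phi> x vs + c * covector (\<kappa> x) vs) | \<phi> c. \<phi> \<in> null_closure g \<kappa> (set F)} \<and>
     (\<lambda>x. covector (\<kappa> x)) \<notin> null_closure g \<kappa> (set F) \<and>
     (\<forall>n. K = SO n \<longrightarrow> null_algebra g \<kappa> (set F) \<simeq>\<^sub>L line_alg (odd n)) \<and>
     (\<forall>n. K = U n \<longrightarrow> null_algebra g \<kappa> (set F) \<simeq>\<^sub>L line_alg False) \<and>
     (\<forall>k. K = SU (2 * k) \<longrightarrow> null_algebra g \<kappa> (set F) \<simeq>\<^sub>L e2_hat) \<and>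
     (\<forall>k. K = SU (2 * k + 1) \<longrightarrow> null_algebra g \<kappa> (set F) \<simeq>\<^sub>L s2_alg) \<and>
     (\<forall>n. K = Sp n \<longrightarrow> null_algebra g \<kappa> (set F) \<simeq>\<^sub>L sp_alg 1) \<and>
     (\<forall>n. K = SpSp1 n \<longrightarrow> null_algebra g \<kappa> (set F) \<simeq>\<^sub>L line_alg False)"
proof -
  let ?p = "DIM('e) - 2"
  have dim: "DIM('e) = transverse_dim K + 2"
    using holonomy by (simp add: has_holonomy_def)
  \<comment> \<open>Coframes are chosen independently at each point; the products do not involve derivatives.\<close>
  have "\<exists>ep e. adapted_coframe (g x) (\<kappa> x) ep e \<and>
      map (\<lambda>\<phi>. \<phi> x) F = map (\<lambda>\<psi>. covector (\<kappa> x) \<and>\<^sub>w \<psi>) (transverse_forms K e)" for x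
    using forms unfolding fundamental_forms_def by metis
  then obtain ep e where coframe: "\<And>x. adapted_coframe (g x) (\<kappa> x) (ep x) (e x)"
    and F: "\<And>x. map (\<lambda>\<phi>. \<phi> x) F = map (\<lambda>\<psi>. covector (\<kappa> x) \<and>\<^sub>w \<psi>) (transverse_forms K (e x))"
    by metis
  interpret null_frame_field g \<kappa> ep e
  proof (unfold_locales)
    fix x
    obtain f where "bilinear (g x)" "lorentz_frame (g x) f"
      using lorentzian unfolding lorentzian_metric_def by blast
    then show "v = 0" if "\<And>w. g x v w = 0" for v
      using that by (rule lorentz_frame_nondegenerate)
    show "adapted_coframe (g x) (\<kappa> x) (ep x) (e x)" by (rule coframe)
    show "2 \<le> DIM('e)" by (simp add: dim)
  qed
  have F_eq: "set F = (\<lambda>i. null_of (\<lambda>x. transverse_forms K (e x) ! i)) ` {..<m}"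
    if m: "\<And>e :: nat \<Rightarrow> 'e \<Rightarrow> real. length (transverse_forms K e) = m" for m
  proof -
    fix x0 :: 'm
    have len: "length F = m" using arg_cong[OF F[of x0], of length] m by simp
    have "F ! i = null_of (\<lambda>x. transverse_forms K (e x) ! i)" if "i < m" for i
    proof
      show "(F ! i) x = null_of (\<lambda>x. transverse_forms K (e x) ! i) x" for x
        using arg_cong[OF F[of x], of "\<lambda>xs. xs ! i"] that len m by (simp add: null_of_def)
    qed
    then have "(!) F ` {..<m} = (\<lambda>i. null_of (\<lambda>x. transverse_forms K (e x) ! i)) ` {..<m}"
      by (intro image_cong) auto
    then show ?thesis by (simp add: set_conv_nth len lessThan_def setcompr_eq_image)
  qed
  show ?thesis
  proof (cases K)
    case (SO n)
    let ?\<psi> = "\<lambda>x. wedge_list (map (\<lambda>i. covector (e x i)) [0..<n])"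
    have p: "?p = n" using dim SO by simp
    have n: "n \<ge> 2" using range SO by simp
    have "set F = {null_of ?\<psi>}" using F_eq[of 1] SO by (simp add: lessThan_Suc)
    moreover have "null_model g \<kappa> ep e {null_of ?\<psi>} (line_alg (odd n)) (\<lambda>c x. c *\<^sub>t ?\<psi> x)"
    proof (rule line_model)
      show "has_degree n (?\<psi> x)" for x using has_degree_wedge_list[of "[0..<n]" "e x"] by simp
      show "?\<psi> x \<noteq> 0" for x
        using at.volume_neq_0[of x] by (auto simp: p pointwise)
    qed (use n at.transverse_volume at.frame_contraction_volume in \<open>simp_all add: p\<close>)
    ultimately show ?thesis using null_model.null_model_conclusion SO by fastforce
  next
    case (U n)
    let ?\<psi> = "\<lambda>x. kahler_form n (e x) :: ('e, real) tensor"
    have p: "?p = 2 * n" using dim U by simp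
    have n: "n \<ge> 1" using range U by simp
    have "set F = {null_of ?\<psi>}" using F_eq[of 1] U by (simp add: lessThan_Suc hermitian_form_eq_kahler_form)
    moreover have "null_model g \<kappa> ep e {null_of ?\<psi>} (line_alg (odd (2 :: nat))) (\<lambda>c x. c *\<^sub>t ?\<psi> x)"
    proof (rule line_model)
      show "has_degree 2 (?\<psi> x)" for x by (rule has_degree_kahler_form)
      show "?\<psi> x \<noteq> 0" for x
        using at.kahler_form_eval[of n x] n p by (auto simp: pointwise)
      show "at.C x (?\<psi> x) (?\<psi> x) = 0" for x by (rule at.frame_contraction_kahler_form_self)
    qed (simp_all add: p transverse_kahler_form)
    ultimately show ?thesis using null_model.null_model_conclusion U by fastforce
  next
    case (SU n)
    have p: "?p = 2 * n" using dim SU by simp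
    have n: "n \<ge> 3" using range SU by simp
    have "{..<3} = {0, 1, 2 :: nat}" by auto
    then have "set F = {null_of (\<lambda>x. kahler_form n (e x)),
      null_of (\<lambda>x vs. Re (holomorphic_volume n (e x) vs)),
      null_of (\<lambda>x vs. Im (holomorphic_volume n (e x) vs))}"
      using F_eq[of 3] SU by (simp add: hermitian_form_eq_kahler_form)
    from e2_hat_model[OF p n this] s2_alg_model[OF p n this]
    show ?thesis
      using null_model.null_model_conclusion SU by (cases "even n") fastforce+
  next
    case (Sp n)
    have p: "?p = 4 * n" using dim Sp by simp
    have n: "n \<ge> 1" using range Sp by simp
    have "{..<3} = {0, 1, 2 :: nat}" by auto
    then have "set F = {null_of (\<lambda>x. hyper_form n 1 2 3 (e x)), null_of (\<lambda>x. hyper_form n 2 3 1 (e x)),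
      null_of (\<lambda>x. hyper_form n 3 1 2 (e x))}"
      using F_eq[of 3] Sp by (simp add: hermitian_form_hyper hermitian_form_hyper[unfolded One_nat_def])
    from sp_alg_model[OF p n this]
    show ?thesis
      using null_model.null_model_conclusion Sp by fastforce
  next
    case (SpSp1 n)
    have p: "?p = 4 * n" using dim SpSp1 by simp
    have n: "n \<ge> 1" using range SpSp1 by simp
    interpret sp: quaternionic_dual_frame "DIM('e) - 2" "e x" "at.E x" n for x
      by unfold_locales (rule p)
    have "set F = {null_of (\<lambda>x. sp.four_form x)}"
      using F_eq[of 1] SpSp1 by (simp add: lessThan_Suc sp.four_form_def)
    moreover have "null_model g \<kappa> ep e {null_of (\<lambda>x. sp.four_form x)} (line_alg (odd (4 :: nat)))
      (\<lambda>c x. c *\<^sub>t sp.four_form x)"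
    proof (rule line_model)
      show "has_degree 4 (sp.four_form x)" for x by (rule sp.has_degree_four_form)
      show "sp.four_form x \<noteq> 0" for x
        using sp.four_form_eval[of x] n by (auto simp: pointwise)
      show "at.C x (sp.four_form x) (sp.four_form x) = 0" for x
        by (rule frame_contraction_self_even[OF has_parity_if_has_degree[OF sp.has_degree_four_form]]) simp
    qed (simp_all add: sp.transverse_four_form)
    ultimately show ?thesis using null_model.null_model_conclusion SpSp1 by fastforce
  qed
qed

end
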